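(* Let $G$ be a generalised Heisenberg group, let $S$ be a finite generating set of $G$, let $\psi:G\to G$ be an automorphism, and let $\overline\psi$ be the automorphism induced by $\psi$ on the abelianization $G/[G,G]$. Then $$\mathrm{Gr}_{\psi,G}^{S}(n)\simeq n^{\dim(G/[G,G])-\mathrm{rank}(\mathrm{id}-\overline\psi)}\,d(n),$$ where $d(n)$ is one of the functions $n^2$, $n$, $\ln(n)$ or $1$.
   Context: A generalised Heisenberg group is a finitely generated $2$-step nilpotent group (i.e. $[G,G]\subset Z(G)$) whose derived subgroup $[G,G]$ is infinite cyclic. For a finitely generated abelian group $A$, $\dim A$ is its torsion-free rank; the rank of an endomorphism of $A$ is the torsion-free rank of its image. For a finite generating set $S$ of $G$, $\|g\|_S$ is the word norm of $g$ with respect to $S\cup S^{-1}$ (with $\|e\|_S=0$). For an automorphism $\psi$ of $G$, $x\sim_\psi y$ means that there is $g\in G$ with $gx\psi(g)^{-1}=y$; the equivalence class of $x$ is $[x]_\psi$. The twisted conjugacy growth function is $\mathrm{Gr}^S_{\psi,G}(n)=\#\{[g]_\psi : g\in G,\ \|g\|_S\le n\}$. For non-decreasing $f,g:\mathbb N_{>0}\to\mathbb R_{>0}$, $f\prec g$ means there is a natural number $c\geq 1$ with $f(n)\le c\,g(cn)$ for all $n\ge1$; $f\simeq g$ means $f\prec g$ and $g\prec f$. For non-decreasing functions that may take non-positive values (such as $\ln n$), $f\prec g$ means $\max(1,f)\prec\max(1,g)$. *)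

theory Defs
  imports Complex_Main "HOL-Algebra.Algebra"
begin

section \<open>Generalised Heisenberg groups\<close>

definition center :: "('a, 'b) monoid_scheme \<Rightarrow> 'a set" where
  "center G = {z \<in> carrier G. \<forall>g \<in> carrier G. z \<otimes>\<^bsub>G\<^esub> g = g \<otimes>\<^bsub>G\<^esub> z}"

definition finite_generating_set :: "('a, 'b) monoid_scheme \<Rightarrow> 'a set \<Rightarrow> bool" where
  "finite_generating_set G S \<longleftrightarrow>
     finite S \<and> S \<subseteq> carrier G \<and> generate G S = carrier G"

definition generalised_Heisenberg_group :: "('a, 'b) monoid_scheme \<Rightarrow> bool" where
  "generalised_Heisenberg_group G \<longleftrightarrow>
     group G \<and>
     (\<exists>S. finite_generating_set G S) \<and>
     derived G (carrier G) \<subseteq> center G \<and>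
     cyclic_group (G\<lparr>carrier := derived G (carrier G)\<rparr>) \<and>
     infinite (derived G (carrier G))"


section \<open>Torsion-free rank\<close>

text \<open>The groups below are abelian but written multiplicatively.\<close>

definition int_independent :: "('a, 'b) monoid_scheme \<Rightarrow> 'a set \<Rightarrow> bool" where
  "int_independent A B \<longleftrightarrow>
     finite B \<and> B \<subseteq> carrier A \<and>
     (\<forall>c :: 'a \<Rightarrow> int.
        finprod A (\<lambda>b. b [^]\<^bsub>A\<^esub> c b) B = \<one>\<^bsub>A\<^esub> \<longrightarrow> (\<forall>b \<in> B. c b = 0))"

text \<open>Only meaningful for abelian groups of finite rank (e.g. finitely generated ones):
  there the set of cardinalities is bounded and the supremum is a maximum.\<close>

definition torsion_free_rank :: "('a, 'b) monoid_scheme \<Rightarrow> nat" where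
  "torsion_free_rank A = Sup {card B | B. int_independent A B}"

definition endo_rank :: "('a, 'b) monoid_scheme \<Rightarrow> ('a \<Rightarrow> 'a) \<Rightarrow> nat" where
  "endo_rank A f = torsion_free_rank (A\<lparr>carrier := f ` carrier A\<rparr>)"

text \<open>The endomorphism \<open>id - f\<close> of an abelian group.\<close>

definition id_minus :: "('a, 'b) monoid_scheme \<Rightarrow> ('a \<Rightarrow> 'a) \<Rightarrow> 'a \<Rightarrow> 'a" where
  "id_minus A f = (\<lambda>x. x \<otimes>\<^bsub>A\<^esub> inv\<^bsub>A\<^esub> (f x))"


section \<open>Abelianization\<close>

definition abelianization :: "('a, 'b) monoid_scheme \<Rightarrow> 'a set monoid" where
  "abelianization G = G Mod derived G (carrier G)"

text \<open>Elements of the abelianization are cosets. An automorphism maps the derived subgroup onto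
  itself, so the image of the coset of \<open>g\<close> is the coset of \<open>\<psi> g\<close>; see the lemma below.\<close>

definition induced_ab :: "('a \<Rightarrow> 'a) \<Rightarrow> 'a set \<Rightarrow> 'a set" where
  "induced_ab \<psi> C = \<psi> ` C"

lemma induced_ab_coset:
  assumes "group G" and \<psi>: "\<psi> \<in> iso G G" and g: "g \<in> carrier G"
  shows "induced_ab \<psi> (derived G (carrier G) #>\<^bsub>G\<^esub> g) = derived G (carrier G) #>\<^bsub>G\<^esub> \<psi> g"
proof -
  interpret group G by fact
  interpret \<psi>: group_hom G G \<psi>
    using \<psi> by unfold_locales (simp add: iso_def)
  have "\<psi> ` carrier G = carrier G"
    using \<psi> by (simp add: iso_def bij_betw_def)
  then have D: "\<psi> ` derived G (carrier G) = derived G (carrier G)"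
    using \<psi>.derived_img[of "carrier G"] by simp
  have "\<psi> ` (derived G (carrier G) #>\<^bsub>G\<^esub> g) = (\<lambda>h. \<psi> h \<otimes>\<^bsub>G\<^esub> \<psi> g) ` derived G (carrier G)"
    using derived_in_carrier[of "carrier G"] g
    by (force simp: r_coset_def)
  also have "\<dots> = \<psi> ` derived G (carrier G) #>\<^bsub>G\<^esub> \<psi> g"
    by (auto simp: r_coset_def)
  finally show ?thesis
    by (simp add: D induced_ab_def)
qed


section \<open>Twisted conjugacy growth\<close>

definition word_norm :: "('a, 'b) monoid_scheme \<Rightarrow> 'a set \<Rightarrow> 'a \<Rightarrow> nat" where
  "word_norm G S g =
     (LEAST k. \<exists>ws. length ws = k \<and> set ws \<subseteq> S \<union> m_inv G ` S \<and>
                    foldr (\<otimes>\<^bsub>G\<^esub>) ws \<one>\<^bsub>G\<^esub> = g)"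

definition twisted_conj ::
    "('a, 'b) monoid_scheme \<Rightarrow> ('a \<Rightarrow> 'a) \<Rightarrow> 'a \<Rightarrow> 'a \<Rightarrow> bool" where
  "twisted_conj G \<psi> x y \<longleftrightarrow> (\<exists>g \<in> carrier G. g \<otimes>\<^bsub>G\<^esub> x \<otimes>\<^bsub>G\<^esub> inv\<^bsub>G\<^esub> (\<psi> g) = y)"

definition twisted_class ::
    "('a, 'b) monoid_scheme \<Rightarrow> ('a \<Rightarrow> 'a) \<Rightarrow> 'a \<Rightarrow> 'a set" where
  "twisted_class G \<psi> x = {y \<in> carrier G. twisted_conj G \<psi> x y}"

definition twisted_growth ::
    "('a, 'b) monoid_scheme \<Rightarrow> 'a set \<Rightarrow> ('a \<Rightarrow> 'a) \<Rightarrow> nat \<Rightarrow> nat" where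
  "twisted_growth G S \<psi> n =
     card {twisted_class G \<psi> g | g. g \<in> carrier G \<and> word_norm G S g \<le> n}"


section \<open>Comparison of growth functions\<close>

text \<open>Growth functions live on the positive integers; their value at \<open>0\<close> is ignored.\<close>

definition growth_prec_pos :: "(nat \<Rightarrow> real) \<Rightarrow> (nat \<Rightarrow> real) \<Rightarrow> bool" where
  "growth_prec_pos f g \<longleftrightarrow> (\<exists>c::nat. c \<ge> 1 \<and> (\<forall>n\<ge>1. f n \<le> real c * g (c * n)))"

text \<open>The variant that also covers functions with non-positive values, such as \<open>ln\<close>. The lemma
  below shows that it agrees with the previous relation on non-decreasing positive functions.\<close>

definition growth_prec :: "(nat \<Rightarrow> real) \<Rightarrow> (nat \<Rightarrow> real) \<Rightarrow> bool" where
  "growth_prec f g \<longleftrightarrow> growth_prec_pos (\<lambda>n. max 1 (f n)) (\<lambda>n. max 1 (g n))"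

definition growth_equiv :: "(nat \<Rightarrow> real) \<Rightarrow> (nat \<Rightarrow> real) \<Rightarrow> bool" where
  "growth_equiv f g \<longleftrightarrow> growth_prec f g \<and> growth_prec g f"

lemma growth_prec_iff_pos:
  assumes f: "mono_on {1..} f" "\<And>n. n \<ge> 1 \<Longrightarrow> f n > 0"
    and g: "mono_on {1..} g" "\<And>n. n \<ge> 1 \<Longrightarrow> g n > 0"
  shows "growth_prec f g \<longleftrightarrow> growth_prec_pos f g"
proof -
  have bound: "\<exists>C::nat. C \<ge> 1 \<and> (\<forall>n\<ge>1. max 1 (h n) \<le> real C * h n)"
    if h: "mono_on {1..} h" "\<And>n. n \<ge> 1 \<Longrightarrow> h n > 0" for h :: "nat \<Rightarrow> real"
  proof -
    obtain C :: nat where C: "1 / h 1 \<le> real C"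
      using real_arch_simple by blast
    have pos: "h 1 > 0" using h(2) by simp
    have C1: "C \<ge> 1"
      using C pos by (cases C) (auto simp: field_simps)
    have "max 1 (h n) \<le> real C * h n" if "n \<ge> 1" for n
    proof -
      have "h 1 \<le> h n"
        using h(1) that by (simp add: mono_on_def)
      moreover have "1 \<le> real C * h 1"
        using C pos by (simp add: field_simps)
      ultimately have "1 \<le> real C * h n"
        by (meson mult_left_mono of_nat_0_le_iff order_trans)
      moreover have "h n \<le> real C * h n"
        using C1 h(2)[OF that] by simp
      ultimately show ?thesis by simp
    qed
    with C1 show ?thesis by blast
  qed
  show ?thesis
  proof
    assume "growth_prec f g"
    then obtain c :: nat where c: "c \<ge> 1"
      and le: "\<And>n. n \<ge> 1 \<Longrightarrow> max 1 (f n) \<le> real c * max 1 (g (c * n))"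
      unfolding growth_prec_def growth_prec_pos_def by blast
    obtain C :: nat where C: "C \<ge> 1" "\<And>n. n \<ge> 1 \<Longrightarrow> max 1 (g n) \<le> real C * g n"
      using bound[OF g] by blast
    have "f n \<le> real (c * C) * g (c * C * n)" if n: "n \<ge> 1" for n
    proof -
      have cn: "c * n \<ge> 1" "c * n \<le> c * C * n"
        using c C(1) n by auto
      have "f n \<le> real c * max 1 (g (c * n))"
        using le[OF n] by simp
      also have "\<dots> \<le> real c * (real C * g (c * n))"
        using C(2)[OF cn(1)] by (intro mult_left_mono) auto
      also have "\<dots> \<le> real c * (real C * g (c * C * n))"
        using g(1) cn by (intro mult_left_mono) (auto simp: mono_on_def)
      finally show ?thesis by (simp add: mult.assoc)
    qed
    moreover have "c * C \<ge> 1" using c C(1) by simp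
    ultimately show "growth_prec_pos f g"
      unfolding growth_prec_pos_def by blast
  next
    assume "growth_prec_pos f g"
    then obtain c :: nat where c: "c \<ge> 1"
      and le: "\<And>n. n \<ge> 1 \<Longrightarrow> f n \<le> real c * g (c * n)"
      unfolding growth_prec_pos_def by blast
    have "max 1 (f n) \<le> real c * max 1 (g (c * n))" if n: "n \<ge> 1" for n
    proof -
      have "f n \<le> real c * max 1 (g (c * n))"
        using le[OF n] by (rule order_trans) (intro mult_left_mono, auto)
      moreover have "1 * 1 \<le> real c * max 1 (g (c * n))"
        using c by (intro mult_mono) auto
      ultimately show ?thesis by simp
    qed
    with c show "growth_prec f g"
      unfolding growth_prec_def growth_prec_pos_def by blast
  qed
qed

end

theory Submission
  imports Defs "HOL-Library.Function_Algebras" "HOL-Library.FuncSet" "HOL-Number_Theory.Totient"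
begin

text \<open>
  Let \<open>A = G/[G,G]\<close>, let \<open>c\<close> generate \<open>[G,G]\<close>, and let \<open>k\<close> be the rank of \<open>A / im (id - \<psi>)\<close>, that is
  \<open>dim A - rank (id - \<psi>)\<close>. The twisted classes over a given element of this quotient are \<open>x c\<^sup>z\<close> with
  \<open>z\<close> taken modulo the subgroup of all \<open>\<tau> g + \<omega> g x\<close>, where \<open>g\<close> runs through the elements fixed by \<open>\<psi>\<close>
  modulo \<open>[G,G]\<close>, \<open>\<omega>\<close> is the commutator form and \<open>g = \<psi> g c\<^bsup>\<tau> g\<^esup>\<close>. As the ball of radius \<open>n\<close> consists,
  up to constants, of elements with linearly bounded image in \<open>A\<close> and quadratically bounded central
  component, the growth is the sum of \<open>min d\<^sub>x n\<^sup>2\<close> over a box of side \<open>n\<close> in \<open>\<int>\<^sup>k\<close>, where \<open>d\<^sub>x\<close> generates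
  the above subgroup (and the minimum is \<open>n\<^sup>2\<close> if \<open>d\<^sub>x = 0\<close>).

  If \<open>\<psi>\<close> inverts \<open>c\<close> then \<open>d\<^sub>x\<close> divides \<open>2\<close>. Otherwise bring \<open>\<omega>\<close> (restricted to fixed elements on the left)
  into diagonal form, of rank \<open>r\<close> say. If \<open>\<tau>\<close> is not a rational combination of the forms \<open>\<omega> (\<cdot>) x\<close> then
  \<open>d\<^sub>x\<close> is bounded. If it is, then \<open>d\<^sub>x\<close> agrees up to a bounded factor with the greatest common divisor
  of \<open>r\<close> affine functions of distinct coordinates of \<open>x\<close>, and summing over the box yields the factor
  \<open>n\<^sup>2\<close>, \<open>n\<close>, \<open>ln n\<close> or \<open>1\<close> according to whether \<open>r\<close> is \<open>0\<close>, \<open>1\<close>, \<open>2\<close> or at least \<open>3\<close>.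
\<close>

section \<open>Subgroups of exponent vectors and their rational bases\<close>

type_synonym ivec = "nat \<Rightarrow> int"

definition smul :: "int \<Rightarrow> ivec \<Rightarrow> ivec" where
  "smul c v = (\<lambda>j. c * v j)"

lemma smul_apply: "smul c v j = c * v j"
  by (simp add: smul_def)

(* The induction method eta-expands terms of function type, after which these rules would
   unfold every vector. *)
lemmas vec_apply = smul_apply plus_fun_apply zero_fun_apply uminus_apply minus_apply

declare vec_apply [simp del]

lemma smul_add: "smul c (u + v) = smul c u + smul c v"
  and smul_diff: "smul c (u - v) = smul c u - smul c v"
  and smul_add_left: "smul (c + d) u = smul c u + smul d u"
  and smul_diff_left: "smul (c - d) u = smul c u - smul d u"
  and smul_smul: "smul c (smul d u) = smul (c * d) u"
  and smul_zero [simp]: "smul c 0 = 0"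
  and smul_0 [simp]: "smul 0 u = 0"
  and smul_1 [simp]: "smul 1 u = u"
  and smul_uminus_left: "smul (- c) u = - smul c u"
  by (auto simp: fun_eq_iff vec_apply algebra_simps)

lemma smul_sum: "smul c (\<Sum>i\<in>I. f i) = (\<Sum>i\<in>I. smul c (f i))"
  by (induction I rule: infinite_finite_induct) (auto simp: smul_add)

lemma smul_sum_left: "smul (\<Sum>i\<in>I. f i) v = (\<Sum>i\<in>I. smul (f i) v)"
  by (induction I rule: infinite_finite_induct) (auto simp: smul_add_left)

definition lincomb :: "'i set \<Rightarrow> ('i \<Rightarrow> int) \<Rightarrow> ('i \<Rightarrow> ivec) \<Rightarrow> ivec" where
  "lincomb I a x = (\<Sum>i\<in>I. smul (a i) (x i))"

lemma lincomb_apply: "lincomb I a x j = (\<Sum>i\<in>I. a i * x i j)"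
  unfolding lincomb_def
  by (induction I rule: infinite_finite_induct) (auto simp: vec_apply)

lemma lincomb_diff: "lincomb I (\<lambda>i. a i - b i) x = lincomb I a x - lincomb I b x"
  and lincomb_smul: "lincomb I (\<lambda>i. c * a i) x = smul c (lincomb I a x)"
  by (simp_all add: lincomb_def smul_diff_left sum_subtractf smul_sum smul_smul)

lemma lincomb_cong: "(\<And>i. i \<in> I \<Longrightarrow> a i = b i) \<Longrightarrow> (\<And>i. i \<in> I \<Longrightarrow> x i = y i) \<Longrightarrow>
    lincomb I a x = lincomb I b y"
  by (simp add: lincomb_def)

lemma lincomb_lincomb:
  "lincomb I a (\<lambda>i. lincomb J (b i) x) = lincomb J (\<lambda>j. \<Sum>i\<in>I. a i * b i j) x"
  unfolding lincomb_def smul_sum smul_sum_left smul_smul by (rule sum.swap)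

lemma lincomb_delta: "finite I \<Longrightarrow> i \<in> I \<Longrightarrow> lincomb I (\<lambda>j. if j = i then c else 0) x = smul c (x i)"
proof -
  assume "finite I" "i \<in> I"
  have "lincomb I (\<lambda>j. if j = i then c else 0) x = (\<Sum>j\<in>I. if j = i then smul c (x j) else 0)"
    unfolding lincomb_def by (intro sum.cong) auto
  then show ?thesis using \<open>finite I\<close> \<open>i \<in> I\<close> by simp
qed

definition add_subgroup :: "ivec set \<Rightarrow> bool" where
  "add_subgroup M \<longleftrightarrow> 0 \<in> M \<and> (\<forall>u\<in>M. \<forall>v\<in>M. u - v \<in> M)"

lemma add_subgroup_UNIV: "add_subgroup UNIV"
  by (simp add: add_subgroup_def)

lemma add_subgroupD:
  assumes "add_subgroup M"
  shows add_subgroup_zero: "0 \<in> M"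
    and add_subgroup_diff: "u \<in> M \<Longrightarrow> v \<in> M \<Longrightarrow> u - v \<in> M"
    and add_subgroup_uminus: "u \<in> M \<Longrightarrow> - u \<in> M"
    and add_subgroup_add: "u \<in> M \<Longrightarrow> v \<in> M \<Longrightarrow> u + v \<in> M"
proof -
  show "0 \<in> M" and d: "\<And>u v. u \<in> M \<Longrightarrow> v \<in> M \<Longrightarrow> u - v \<in> M"
    using assms by (auto simp: add_subgroup_def)
  show m: "- u \<in> M" if "u \<in> M" for u using d[OF \<open>0 \<in> M\<close> that] by simp
  show "u + v \<in> M" if "u \<in> M" "v \<in> M" for u v
    using d[OF that(1) m[OF that(2)]] by simp
qed

lemma add_subgroup_smul:
  assumes "add_subgroup M" "u \<in> M"
  shows "smul c u \<in> M"
proof -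
  have n: "smul (int n) u \<in> M" for n
    by (induction n) (auto simp: smul_add_left assms add_subgroupD[OF assms(1)])
  show ?thesis
    using n[of "nat c"] add_subgroup_uminus[OF assms(1) n[of "nat (- c)"]]
    by (cases "c \<ge> 0") (auto simp: smul_uminus_left)
qed

lemma add_subgroup_sum:
  assumes "add_subgroup M" "\<And>i. i \<in> I \<Longrightarrow> f i \<in> M"
  shows "(\<Sum>i\<in>I. f i) \<in> M"
  using assms(2)
  by (induction I rule: infinite_finite_induct) (auto simp: add_subgroupD[OF assms(1)])

lemma add_subgroup_lincomb:
  assumes "add_subgroup M" "\<And>i. i \<in> I \<Longrightarrow> x i \<in> M"
  shows "lincomb I a x \<in> M"
  unfolding lincomb_def using assms by (intro add_subgroup_sum add_subgroup_smul) auto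

lemma additive_lincomb:
  fixes f :: "ivec \<Rightarrow> int"
  assumes M: "add_subgroup M"
    and f: "\<And>u v. u \<in> M \<Longrightarrow> v \<in> M \<Longrightarrow> f (u + v) = f u + f v"
    and x: "\<And>i. i \<in> I \<Longrightarrow> x i \<in> M"
  shows "f (lincomb I a x) = (\<Sum>i\<in>I. a i * f (x i))"
proof -
  have f0: "f 0 = 0"
    using f[of 0 0] add_subgroup_zero[OF M] by simp
  have n: "f (smul (int n) u) = int n * f u" if "u \<in> M" for n u
    by (induction n) (auto simp: f0 smul_add_left f[OF that] add_subgroup_smul[OF M that] algebra_simps)
  have neg: "f (- u) = - f u" if "u \<in> M" for u
    using f[OF that add_subgroup_uminus[OF M that]] f0 by simp
  have smul: "f (smul c u) = c * f u" if "u \<in> M" for c u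
    using n[OF that, of "nat c"] n[OF that, of "nat (- c)"]
      neg[OF add_subgroup_smul[OF M that, of "- c"]]
    by (cases "c \<ge> 0") (auto simp: smul_uminus_left)
  show ?thesis
    using x
  proof (induction I rule: infinite_finite_induct)
    case (insert i I)
    have "lincomb I a x \<in> M"
      using insert.prems by (intro add_subgroup_lincomb[OF M]) auto
    moreover have "lincomb (insert i I) a x = smul (a i) (x i) + lincomb I a x"
      using insert.hyps by (simp add: lincomb_def)
    ultimately show ?case
      using insert by (simp add: f add_subgroup_smul[OF M] smul)
  qed (auto simp: f0 lincomb_def)
qed

lemma int_linear_dependence:
  fixes c :: "'i \<Rightarrow> 'j \<Rightarrow> int"
  assumes "finite J" "finite I" "card J < card I"
  shows "\<exists>e. (\<exists>i\<in>I. e i \<noteq> 0) \<and> (\<forall>j\<in>J. (\<Sum>i\<in>I. e i * c i j) = 0)"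
  using assms
proof (induction J arbitrary: I c rule: finite_induct)
  case empty
  then have "I \<noteq> {}" by auto
  then show ?case by (intro exI[of _ "\<lambda>_. 1"]) auto
next
  case (insert p J)
  show ?case
  proof (cases "\<forall>i\<in>I. c i p = 0")
    case True
    have "card J < card I" using insert by simp
    then obtain e where "\<exists>i\<in>I. e i \<noteq> 0" "\<forall>j\<in>J. (\<Sum>i\<in>I. e i * c i j) = 0"
      using insert.IH insert.prems by blast
    then show ?thesis using True by (intro exI[of _ e]) auto
  next
    case False
    then obtain q where q: "q \<in> I" "c q p \<noteq> 0" by blast
    define I' where "I' = I - {q}"
    have I': "finite I'" "card J < card I'"
      using insert q by (auto simp: I'_def)
    obtain e where e: "\<exists>i\<in>I'. e i \<noteq> 0"
      "\<forall>j\<in>J. (\<Sum>i\<in>I'. e i * (c q p * c i j - c i p * c q j)) = 0"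
      using insert.IH[OF I', of "\<lambda>i j. c q p * c i j - c i p * c q j"] by blast
    define f where "f = (\<lambda>i. if i = q then - (\<Sum>i\<in>I'. e i * c i p) else c q p * e i)"
    have I: "(\<Sum>i\<in>I. f i * c i j) = f q * c q j + (\<Sum>i\<in>I'. f i * c i j)" for j
      using q insert.prems by (simp add: I'_def sum.remove)
    have s: "(\<Sum>i\<in>I'. f i * c i j) = (\<Sum>i\<in>I'. c q p * e i * c i j)" for j
      by (intro sum.cong) (auto simp: f_def I'_def)
    have "(\<Sum>i\<in>I. f i * c i j) = (\<Sum>i\<in>I'. e i * (c q p * c i j - c i p * c q j))" for j
      unfolding I s by (simp add: f_def sum_distrib_left sum_distrib_right sum_subtractf algebra_simps)
    then have "\<forall>j\<in>insert p J. (\<Sum>i\<in>I. f i * c i j) = 0"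
      using e(2) by (simp add: mult.commute)
    moreover have "\<exists>i\<in>I. f i \<noteq> 0"
      using e(1) q by (auto simp: f_def I'_def)
    ultimately show ?thesis by blast
  qed
qed

definition indep_mod :: "ivec set \<Rightarrow> 'i set \<Rightarrow> ('i \<Rightarrow> ivec) \<Rightarrow> bool" where
  "indep_mod L I x \<longleftrightarrow> (\<forall>a. lincomb I a x \<in> L \<longrightarrow> (\<forall>i\<in>I. a i = 0))"

definition spans_mod :: "ivec set \<Rightarrow> ivec set \<Rightarrow> 'i set \<Rightarrow> ('i \<Rightarrow> ivec) \<Rightarrow> bool" where
  "spans_mod L H I x \<longleftrightarrow> (\<forall>z\<in>H. \<exists>N>0. \<exists>a. smul N z - lincomb I a x \<in> L)"

text \<open>For subgroups \<open>L \<subseteq> H\<close> this says that \<open>x\<close> induces a basis of the rational vector space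
  \<open>H/L \<otimes> \<rat>\<close>.\<close>

definition rational_basis :: "ivec set \<Rightarrow> ivec set \<Rightarrow> 'i set \<Rightarrow> ('i \<Rightarrow> ivec) \<Rightarrow> bool" where
  "rational_basis L H I x \<longleftrightarrow>
     finite I \<and> (\<forall>i\<in>I. x i \<in> H) \<and> indep_mod L I x \<and> spans_mod L H I x"

lemma common_multiple:
  assumes "finite I" "\<And>i. i \<in> I \<Longrightarrow> \<exists>N>0. P i N"
    and mult: "\<And>i N M. P i N \<Longrightarrow> M > 0 \<Longrightarrow> P i (M * N)"
  shows "\<exists>N>(0::int). \<forall>i\<in>I. P i N"
  using assms(1,2)
proof (induction I rule: finite_induct)
  case empty
  show ?case by (intro exI[of _ 1]) auto
next
  case (insert i I)
  obtain N where N: "N > 0" "\<forall>i\<in>I. P i N" using insert by auto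
  obtain M where M: "M > 0" "P i M" using insert.prems by auto
  show ?case
    using N M mult[of i M N] mult[of _ N M]
    by (intro exI[of _ "N * M"]) (auto simp: mult.commute)
qed

lemma spans_mod_common:
  assumes L: "add_subgroup L" and sp: "spans_mod L H J x"
    and J: "finite I" "\<And>i. i \<in> I \<Longrightarrow> z i \<in> H"
  obtains N A where "N > 0" "\<And>i. i \<in> I \<Longrightarrow> smul N (z i) - lincomb J (A i) x \<in> L"
proof -
  have "\<exists>N>0. \<forall>i\<in>I. \<exists>a. smul N (z i) - lincomb J a x \<in> L"
  proof (rule common_multiple[OF \<open>finite I\<close>])
    show "\<exists>N>0. \<exists>a. smul N (z i) - lincomb J a x \<in> L" if "i \<in> I" for i
      using sp J(2)[OF that] by (auto simp: spans_mod_def)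
    show "\<exists>a. smul (M * N) (z i) - lincomb J a x \<in> L"
      if "\<exists>a. smul N (z i) - lincomb J a x \<in> L" for i N M
    proof -
      from that obtain a where "smul N (z i) - lincomb J a x \<in> L" ..
      from add_subgroup_smul[OF L this, of M] show ?thesis
        by (intro exI[of _ "\<lambda>j. M * a j"]) (simp add: smul_diff smul_smul lincomb_smul)
    qed
  qed
  then obtain N where N: "N > 0" "\<forall>i\<in>I. \<exists>a. smul N (z i) - lincomb J a x \<in> L" by blast
  then obtain A where "\<forall>i\<in>I. smul N (z i) - lincomb J (A i) x \<in> L" by metis
  with N(1) show thesis by (intro that) auto
qed

lemma indep_mod_card_le:
  assumes L: "add_subgroup L" and sp: "spans_mod L H J x" and J: "finite J"
    and I: "finite I" "\<And>i. i \<in> I \<Longrightarrow> z i \<in> H" and ind: "indep_mod L I z"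
  shows "card I \<le> card J"
proof (rule ccontr)
  assume less: "\<not> card I \<le> card J"
  obtain N A where N: "N > 0" and A: "\<And>i. i \<in> I \<Longrightarrow> smul N (z i) - lincomb J (A i) x \<in> L"
    using spans_mod_common[OF L sp I(1), of z] I(2) by metis
  obtain e where e: "\<exists>i\<in>I. e i \<noteq> 0" "\<forall>j\<in>J. (\<Sum>i\<in>I. e i * A i j) = 0"
    using int_linear_dependence[OF J I(1), of A] less by auto
  have "lincomb I e (\<lambda>i. smul N (z i) - lincomb J (A i) x) \<in> L"
    using A by (intro add_subgroup_lincomb[OF L]) auto
  also have "lincomb I e (\<lambda>i. smul N (z i) - lincomb J (A i) x) =
      lincomb I (\<lambda>i. N * e i) z - lincomb I e (\<lambda>i. lincomb J (A i) x)"
    by (simp add: lincomb_def smul_diff smul_smul sum_subtractf mult.commute)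
  also have "lincomb I e (\<lambda>i. lincomb J (A i) x) = 0"
    unfolding lincomb_lincomb using e(2) by (simp add: lincomb_def)
  finally have "\<forall>i\<in>I. N * e i = 0"
    using ind by (auto simp: indep_mod_def)
  with e(1) N show False by auto
qed

lemma rational_basis_exists:
  fixes L H :: "ivec set"
  assumes L: "add_subgroup L" and bound: "\<And>v. (\<forall>j<m. v j = 0) \<Longrightarrow> v \<in> L"
    and H: "add_subgroup H"
  obtains p x where "rational_basis L H {..<p::nat} x"
proof -
  have le: "card I \<le> m" if "finite I" "indep_mod L I z" for I :: "nat set" and z
  proof (rule ccontr)
    assume "\<not> card I \<le> m"
    then obtain e where e: "\<exists>i\<in>I. e i \<noteq> 0" "\<forall>j<m. (\<Sum>i\<in>I. e i * z i j) = 0"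
      using int_linear_dependence[of "{..<m}" I z] that by fastforce
    have "lincomb I e z \<in> L"
      using e(2) by (intro bound) (auto simp: lincomb_apply)
    with that e(1) show False by (auto simp: indep_mod_def)
  qed
  define Q :: "nat \<Rightarrow> bool" where "Q = (\<lambda>p. \<exists>x. (\<forall>i<p. x i \<in> H) \<and> indep_mod L {..<p} x)"
  have "Q 0" by (simp add: Q_def indep_mod_def)
  moreover have "\<forall>p. Q p \<longrightarrow> p \<le> m" unfolding Q_def using le by fastforce
  ultimately obtain p where p: "Q p" "\<And>q. Q q \<Longrightarrow> q \<le> p"
    using Nat.ex_has_greatest_nat[of Q 0 m] by blast
  from p(1) obtain x where x: "\<forall>i<p. x i \<in> H" "indep_mod L {..<p} x" by (auto simp: Q_def)
  have "\<exists>N>0. \<exists>a. smul N z - lincomb {..<p} a x \<in> L" if z: "z \<in> H" for z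
  proof -
    define x' where "x' = x(p := z)"
    have "\<not> indep_mod L {..<Suc p} x'"
    proof
      assume "indep_mod L {..<Suc p} x'"
      then have "Q (Suc p)"
        unfolding Q_def using x z by (intro exI[of _ x']) (auto simp: x'_def less_Suc_eq)
      from p(2)[OF this] show False by simp
    qed
    then obtain a where a: "lincomb {..<Suc p} a x' \<in> L" "\<exists>i<Suc p. a i \<noteq> 0"
      by (auto simp: indep_mod_def)
    have eq: "lincomb {..<Suc p} a x' = lincomb {..<p} a x + smul (a p) z"
      by (simp add: lincomb_def x'_def)
    have ap: "a p \<noteq> 0"
    proof
      assume "a p = 0"
      with a eq have "lincomb {..<p} a x \<in> L" by simp
      with x(2) a(2) \<open>a p = 0\<close> show False by (auto simp: indep_mod_def less_Suc_eq)
    qed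
    have "smul (sgn (a p)) (lincomb {..<Suc p} a x') \<in> L"
      by (rule add_subgroup_smul[OF L a(1)])
    also have "smul (sgn (a p)) (lincomb {..<Suc p} a x') =
        smul \<bar>a p\<bar> z - lincomb {..<p} (\<lambda>i. (- sgn (a p)) * a i) x"
      unfolding eq smul_add lincomb_smul smul_smul
      by (simp add: smul_uminus_left mult_sgn_abs abs_sgn mult.commute)
    finally show ?thesis using ap
      by (intro exI[of _ "\<bar>a p\<bar>"] conjI exI[of _ "\<lambda>i. (- sgn (a p)) * a i"]) auto
  qed
  with x have "rational_basis L H {..<p} x"
    by (auto simp: rational_basis_def spans_mod_def)
  then show thesis by (rule that)
qed

lemma sum_lessThan_add:
  fixes f :: "nat \<Rightarrow> 'c::comm_monoid_add"
  shows "(\<Sum>i<p + q. f i) = (\<Sum>i<p. f i) + (\<Sum>i<q. f (p + i))"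
  by (induction q) (auto simp: add.assoc)

lemma rational_basis_append:
  fixes p q :: nat
  assumes L: "add_subgroup L" and H: "add_subgroup H" and sub: "L \<subseteq> H" "H \<subseteq> K"
    and x: "rational_basis L H {..<p} x" and y: "rational_basis H K {..<q} y"
  shows "rational_basis L K {..<q + p} (\<lambda>i. if i < q then y i else x (i - q))"
    (is "rational_basis L K _ ?z")
proof -
  have split: "lincomb {..<q + p} a ?z = lincomb {..<q} a y + lincomb {..<p} (\<lambda>i. a (q + i)) x" for a
    unfolding lincomb_def sum_lessThan_add by simp
  have xH: "lincomb {..<p} a x \<in> H" for a
    using x by (intro add_subgroup_lincomb[OF H]) (auto simp: rational_basis_def)
  have "indep_mod L {..<q + p} ?z"
    unfolding indep_mod_def
  proof (intro allI impI)
    fix a assume a: "lincomb {..<q + p} a ?z \<in> L"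
    then have "lincomb {..<q} a y + lincomb {..<p} (\<lambda>i. a (q + i)) x \<in> H"
      using sub by (auto simp: split)
    from add_subgroup_diff[OF H this xH[of "\<lambda>i. a (q + i)"]] have "lincomb {..<q} a y \<in> H" by simp
    then have 1: "\<forall>i\<in>{..<q}. a i = 0"
      using y by (simp add: rational_basis_def indep_mod_def)
    then have "lincomb {..<q} a y = 0" by (simp add: lincomb_def)
    with a have "lincomb {..<p} (\<lambda>i. a (q + i)) x \<in> L" by (simp add: split)
    then have 2: "\<forall>i\<in>{..<p}. a (q + i) = 0"
      using x unfolding rational_basis_def indep_mod_def by blast
    show "\<forall>i\<in>{..<q + p}. a i = 0"
    proof
      fix i assume "i \<in> {..<q + p}"
      then show "a i = 0"
        using 1 2[rule_format, of "i - q"] by (cases "i < q") auto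
    qed
  qed
  moreover have "spans_mod L K {..<q + p} ?z"
    unfolding spans_mod_def
  proof
    fix z assume "z \<in> K"
    with y obtain N a where N: "N > 0" and a: "smul N z - lincomb {..<q} a y \<in> H"
      by (auto simp: rational_basis_def spans_mod_def)
    with x obtain M b where M: "M > 0"
      and b: "smul M (smul N z - lincomb {..<q} a y) - lincomb {..<p} b x \<in> L"
      by (force simp: rational_basis_def spans_mod_def)
    define d where "d = (\<lambda>i. if i < q then M * a i else b (i - q))"
    have "lincomb {..<q} d y = smul M (lincomb {..<q} a y)"
      unfolding lincomb_smul[symmetric] by (intro lincomb_cong) (auto simp: d_def)
    moreover have "lincomb {..<p} (\<lambda>i. d (q + i)) x = lincomb {..<p} b x"
      by (intro lincomb_cong) (auto simp: d_def)
    ultimately have "smul (M * N) z - lincomb {..<q + p} d ?z \<in> L"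
      using b unfolding split by (simp add: smul_diff smul_smul diff_diff_eq)
    with N M show "\<exists>N>0. \<exists>a. smul N z - lincomb {..<q + p} a ?z \<in> L"
      by (intro exI[of _ "M * N"]) auto
  qed
  moreover have "\<forall>i\<in>{..<q + p}. ?z i \<in> K"
    using x y sub by (auto simp: rational_basis_def)
  ultimately show ?thesis by (simp add: rational_basis_def)
qed

lemma ivec_hom:
  fixes A :: "('c, 'd) monoid_scheme"
  assumes A: "group A" and H: "add_subgroup H" and fc: "\<And>v. v \<in> H \<Longrightarrow> f v \<in> carrier A"
    and add: "\<And>u v. u \<in> H \<Longrightarrow> v \<in> H \<Longrightarrow> f (u + v) = f u \<otimes>\<^bsub>A\<^esub> f v"
  shows "f 0 = \<one>\<^bsub>A\<^esub>"
    and "u \<in> H \<Longrightarrow> v \<in> H \<Longrightarrow> f (u - v) = f u \<otimes>\<^bsub>A\<^esub> inv\<^bsub>A\<^esub> f v"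
    and "v \<in> H \<Longrightarrow> f (smul k v) = f v [^]\<^bsub>A\<^esub> k"
proof -
  interpret group A by fact
  show f0: "f 0 = \<one>\<^bsub>A\<^esub>"
    using add[of 0 0] fc[of 0] add_subgroup_zero[OF H] by simp
  show fd: "f (u - v) = f u \<otimes>\<^bsub>A\<^esub> inv\<^bsub>A\<^esub> f v" if "u \<in> H" "v \<in> H" for u v
  proof -
    have "f (u - v) \<otimes>\<^bsub>A\<^esub> f v = f u"
      using add[of "u - v" v] that add_subgroup_diff[OF H] by simp
    then show ?thesis
      using fc that add_subgroup_diff[OF H that] by (metis inv_solve_right)
  qed
  have fn: "f (smul (int n) v) = f v [^]\<^bsub>A\<^esub> int n" if "v \<in> H" for n v
  proof (induction n)
    case (Suc n)
    then show ?case
      using that by (simp add: smul_add_left add add_subgroup_smul[OF H] fc int_pow_mult)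
  qed (simp add: f0)
  show "f (smul k v) = f v [^]\<^bsub>A\<^esub> k" if "v \<in> H"
  proof (cases "k \<ge> 0")
    case True
    then show ?thesis using fn[OF that, of "nat k"] by simp
  next
    case False
    have "f (smul k v) = f (0 - smul (- k) v)" by (simp add: smul_uminus_left)
    also have "\<dots> = inv\<^bsub>A\<^esub> (f (smul (- k) v))"
      using that add_subgroup_smul[OF H that] add_subgroup_zero[OF H] by (subst fd) (auto simp: f0 fc)
    also have "f (smul (- k) v) = f v [^]\<^bsub>A\<^esub> (- k)"
      using fn[OF that, of "nat (- k)"] False by simp
    finally show ?thesis using that by (simp add: int_pow_neg fc)
  qed
qed

lemma torsion_free_rank_eq:
  fixes A :: "('c, 'd) monoid_scheme"
  assumes A: "comm_group A" and H: "add_subgroup H" and onto: "f ` H = carrier A"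
    and add: "\<And>u v. u \<in> H \<Longrightarrow> v \<in> H \<Longrightarrow> f (u + v) = f u \<otimes>\<^bsub>A\<^esub> f v"
    and ker: "L = {v \<in> H. f v = \<one>\<^bsub>A\<^esub>}" and x: "rational_basis L H I x"
  shows "torsion_free_rank A = card I"
proof -
  interpret comm_group A by fact
  have fc: "f v \<in> carrier A" if "v \<in> H" for v using onto that by auto
  note hom = ivec_hom[OF is_group H fc add]
  note f0 = hom(1) and fd = hom(2) and fs = hom(3)
  have L: "add_subgroup L"
    unfolding add_subgroup_def ker using add_subgroupD[OF H] by (auto simp: f0 fd)
  have fl: "f (lincomb J a z) = finprod A (\<lambda>i. f (z i) [^]\<^bsub>A\<^esub> a i) J"
    if "finite J" "\<And>i. i \<in> J \<Longrightarrow> z i \<in> H" for J :: "'j set" and a z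
    using that
  proof (induction J rule: finite_induct)
    case (insert i J)
    have "lincomb (insert i J) a z = smul (a i) (z i) + lincomb J a z"
      using insert by (simp add: lincomb_def)
    moreover have "lincomb J a z \<in> H" "smul (a i) (z i) \<in> H"
      using insert.prems by (auto intro!: add_subgroup_lincomb[OF H] add_subgroup_smul[OF H])
    moreover have "finprod A (\<lambda>i. f (z i) [^]\<^bsub>A\<^esub> a i) (insert i J) =
        f (z i) [^]\<^bsub>A\<^esub> a i \<otimes>\<^bsub>A\<^esub> finprod A (\<lambda>i. f (z i) [^]\<^bsub>A\<^esub> a i) J"
      using insert fc by (intro finprod_insert) auto
    ultimately show ?case using insert by (simp add: add fs)
  qed (simp add: lincomb_def f0)
  have xH: "\<And>i. i \<in> I \<Longrightarrow> x i \<in> H" and I: "finite I" and ind: "indep_mod L I x"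
    and sp: "spans_mod L H I x"
    using x by (auto simp: rational_basis_def)
  have upper: "card B \<le> card I" if B: "int_independent A B" for B
  proof -
    have B': "finite B" "B \<subseteq> f ` H" using B onto by (auto simp: int_independent_def)
    then obtain z where z: "\<And>b. b \<in> B \<Longrightarrow> z b \<in> H \<and> f (z b) = b" by (metis image_iff subsetD)
    have "indep_mod L B z"
      unfolding indep_mod_def
    proof (intro allI impI)
      fix a assume "lincomb B a z \<in> L"
      then have "finprod A (\<lambda>b. f (z b) [^]\<^bsub>A\<^esub> a b) B = \<one>\<^bsub>A\<^esub>"
        using fl[OF B'(1)] z by (simp add: ker)
      also have "finprod A (\<lambda>b. f (z b) [^]\<^bsub>A\<^esub> a b) B = finprod A (\<lambda>b. b [^]\<^bsub>A\<^esub> a b) B"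
        using z B' B by (intro finprod_cong) (auto simp: int_independent_def simp_implies_def)
      finally show "\<forall>i\<in>B. a i = 0" using B by (simp add: int_independent_def)
    qed
    from indep_mod_card_le[OF L sp I B'(1) _ this] z show ?thesis by blast
  qed
  have inj: "inj_on (\<lambda>i. f (x i)) I"
  proof (rule inj_onI, rule ccontr)
    fix i j assume ij: "i \<in> I" "j \<in> I" "f (x i) = f (x j)" "i \<noteq> j"
    define a where "a = (\<lambda>k. (if k = i then 1 else 0) - (if k = j then 1 else (0::int)))"
    have "lincomb I a x = x i - x j"
      unfolding a_def lincomb_diff using ij I by (simp add: lincomb_delta)
    moreover have "x i - x j \<in> L"
      using ij xH by (simp add: ker add_subgroup_diff[OF H] fd fc)
    ultimately have "a i = 0" using ind ij by (simp add: indep_mod_def)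
    then show False using ij by (simp add: a_def)
  qed
  have "int_independent A ((\<lambda>i. f (x i)) ` I)"
    unfolding int_independent_def
  proof (intro conjI allI impI)
    show "finite ((\<lambda>i. f (x i)) ` I)" using I by simp
    show "(\<lambda>i. f (x i)) ` I \<subseteq> carrier A" using xH fc by auto
    fix c :: "'c \<Rightarrow> int"
    assume "finprod A (\<lambda>b. b [^]\<^bsub>A\<^esub> c b) ((\<lambda>i. f (x i)) ` I) = \<one>\<^bsub>A\<^esub>"
    also have "finprod A (\<lambda>b. b [^]\<^bsub>A\<^esub> c b) ((\<lambda>i. f (x i)) ` I) =
        finprod A (\<lambda>i. f (x i) [^]\<^bsub>A\<^esub> c (f (x i))) I"
      using inj xH fc by (subst finprod_reindex) auto
    also have "\<dots> = f (lincomb I (\<lambda>i. c (f (x i))) x)"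
      using fl[OF I, of x "\<lambda>i. c (f (x i))"] xH by simp
    finally have "lincomb I (\<lambda>i. c (f (x i))) x \<in> L"
      using xH by (simp add: ker add_subgroup_lincomb[OF H])
    then show "\<forall>b\<in>(\<lambda>i. f (x i)) ` I. c b = 0"
      using ind by (auto simp: indep_mod_def)
  qed
  then have mem: "card I \<in> {card B | B. int_independent A B}"
    using card_image[OF inj] by (metis (mono_tags, lifting) mem_Collect_eq)
  have ub: "\<And>y. y \<in> {card B | B. int_independent A B} \<Longrightarrow> y \<le> card I" using upper by blast
  show ?thesis
    unfolding torsion_free_rank_def by (rule cSup_eq_maximum[OF mem ub])
qed

definition vnorm :: "nat \<Rightarrow> ivec \<Rightarrow> int" where
  "vnorm m v = (\<Sum>j<m. \<bar>v j\<bar>)"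

lemma vnorm_nonneg [simp]: "vnorm m v \<ge> 0"
  by (auto simp: vnorm_def intro: sum_nonneg)

lemma vnorm_add: "vnorm m (u + v) \<le> vnorm m u + vnorm m v"
  unfolding vnorm_def sum.distrib[symmetric]
  by (intro sum_mono) (auto simp: vec_apply abs_triangle_ineq)

lemma vnorm_smul: "vnorm m (smul c v) = \<bar>c\<bar> * vnorm m v"
  by (simp add: vnorm_def vec_apply abs_mult sum_distrib_left)

lemma vnorm_lincomb: "vnorm m (lincomb I a x) \<le> (\<Sum>i\<in>I. \<bar>a i\<bar> * vnorm m (x i))"
proof (induction I rule: infinite_finite_induct)
  case (insert i I)
  have "lincomb (insert i I) a x = smul (a i) (x i) + lincomb I a x"
    using insert by (simp add: lincomb_def)
  then show ?case
    using insert vnorm_add[of m "smul (a i) (x i)" "lincomb I a x"] by (simp add: vnorm_smul)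
qed (auto simp: lincomb_def vnorm_def vec_apply)

lemma abs_div_le:
  fixes a N :: int
  assumes "N > 0"
  shows "\<bar>a div N\<bar> \<le> \<bar>a\<bar>"
proof (cases "a \<ge> 0")
  case True
  then have "a div N \<le> a" using assms
    by (metis div_by_1 int_one_le_iff_zero_less zdiv_mono2 zero_less_one)
  with True assms show ?thesis by (simp add: pos_imp_zdiv_nonneg_iff)
next
  case False
  have "a = a div 1" by simp
  also have "\<dots> \<le> a div N" using False assms by (intro zdiv_mono2_neg) auto
  finally show ?thesis using False assms div_neg_pos_less0[of a N] by linarith
qed

lemma rational_basis_remainder:
  assumes L: "add_subgroup L" and bound: "\<And>v. (\<forall>j<m. v j = 0) \<Longrightarrow> v \<in> L"
    and x: "rational_basis L UNIV I x"
  obtains T C where "finite T" "C \<ge> 0"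
    "\<And>v. \<exists>w\<in>T. \<exists>a. (\<forall>i\<in>I. \<bar>a i\<bar> \<le> C * vnorm m v) \<and> v - (w + lincomb I a x) \<in> L"
proof -
  define e :: "nat \<Rightarrow> ivec" where "e = (\<lambda>i j. if i = j then 1 else 0)"
  have I: "finite I" and sp: "spans_mod L UNIV I x" using x by (auto simp: rational_basis_def)
  obtain N A where N: "N > 0" and A: "\<And>i. i \<in> {..<m} \<Longrightarrow> smul N (e i) - lincomb I (A i) x \<in> L"
    using spans_mod_common[OF L sp, of "{..<m}" e] by auto
  define T :: "ivec set" where "T = {w. \<forall>j. (j \<in> {..<m} \<longrightarrow> w j \<in> {0..<N}) \<and> (j \<notin> {..<m} \<longrightarrow> w j = 0)}"
  define C where "C = (\<Sum>i\<in>I. \<Sum>j<m. \<bar>A j i\<bar>)"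
  have C: "C \<ge> 0" by (auto simp: C_def intro!: sum_nonneg)
  have "\<exists>w\<in>T. \<exists>a. (\<forall>i\<in>I. \<bar>a i\<bar> \<le> C * vnorm m v) \<and> v - (w + lincomb I a x) \<in> L" for v
  proof -
    define w where "w = (\<lambda>j. if j < m then v j mod N else 0)"
    define q where "q = (\<lambda>j. if j < m then v j div N else 0)"
    define a where "a = (\<lambda>i. \<Sum>j<m. q j * A j i)"
    have q_le: "\<bar>q j\<bar> \<le> \<bar>v j\<bar>" if "j < m" for j
    proof -
      have "\<bar>v j div N\<bar> \<le> \<bar>v j\<bar>"
        using N by (rule abs_div_le)
      then show ?thesis using that by (simp add: q_def)
    qed
    have "w \<in> T" using N by (auto simp: T_def w_def)
    moreover have "\<bar>a i\<bar> \<le> C * vnorm m v" if "i \<in> I" for i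
    proof -
      have "\<bar>a i\<bar> \<le> (\<Sum>j<m. \<bar>q j\<bar> * \<bar>A j i\<bar>)"
        unfolding a_def by (rule order_trans[OF sum_abs]) (simp add: abs_mult)
      also have "\<dots> \<le> (\<Sum>j<m. vnorm m v * \<bar>A j i\<bar>)"
      proof (intro sum_mono mult_right_mono)
        fix j assume "j \<in> {..<m}"
        then show "\<bar>q j\<bar> \<le> vnorm m v"
          using q_le[of j] member_le_sum[of j "{..<m}" "\<lambda>j. \<bar>v j\<bar>"] by (simp add: vnorm_def)
      qed auto
      also have "\<dots> = vnorm m v * (\<Sum>j<m. \<bar>A j i\<bar>)" by (simp add: sum_distrib_left)
      also have "\<dots> \<le> vnorm m v * C"
        unfolding C_def using I that
        by (intro mult_left_mono member_le_sum[of i I "\<lambda>i. \<Sum>j<m. \<bar>A j i\<bar>"]) (auto intro: sum_nonneg)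
      finally show ?thesis by (simp add: mult.commute)
    qed
    moreover have "v - (w + lincomb I a x) \<in> L"
    proof -
      have "lincomb {..<m} q (\<lambda>j. smul N (e j) - lincomb I (A j) x) \<in> L"
        using A by (intro add_subgroup_lincomb[OF L]) auto
      also have "lincomb {..<m} q (\<lambda>j. smul N (e j) - lincomb I (A j) x) =
          smul N (lincomb {..<m} q e) - lincomb I a x"
        unfolding a_def lincomb_lincomb[symmetric]
        by (simp add: lincomb_def smul_diff smul_smul sum_subtractf smul_sum mult.commute)
      finally have 1: "smul N (lincomb {..<m} q e) - lincomb I a x \<in> L" .
      have "lincomb {..<m} q e j = (if j < m then q j else 0)" for j
        by (simp add: lincomb_apply e_def if_distrib cong: if_cong)
      then have 2: "v - w - smul N (lincomb {..<m} q e) \<in> L"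
        by (intro bound) (auto simp: vec_apply w_def q_def minus_mod_eq_mult_div)
      from add_subgroup_add[OF L 2 1] show ?thesis by (simp add: algebra_simps)
    qed
    ultimately show ?thesis by blast
  qed
  moreover have "finite T"
    unfolding T_def by (rule finite_set_of_finite_funs) auto
  ultimately show thesis using C by (intro that) auto
qed

section \<open>Sums of greatest common divisors\<close>

lemma sum_inverse_le_ln: "n \<ge> 1 \<Longrightarrow> (\<Sum>g=1..n. 1 / real g) \<le> 1 + ln (real n)"
proof (induction n rule: nat_induct_at_least)
  case (Suc n)
  have "ln (real n / real (Suc n)) \<le> real n / real (Suc n) - 1"
    using Suc.hyps by (intro ln_le_minus_one) auto
  then have "1 / real (Suc n) \<le> ln (real (Suc n)) - ln (real n)"
    using Suc.hyps by (simp add: ln_div field_simps)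
  with Suc show ?case by simp
qed simp

lemma ln_le_sum_inverse: "ln (real (Suc n)) \<le> (\<Sum>g=1..n. 1 / real g)"
proof (induction n)
  case (Suc n)
  have "ln (real (Suc (Suc n)) / real (Suc n)) \<le> real (Suc (Suc n)) / real (Suc n) - 1"
    by (intro ln_le_minus_one) auto
  then have "ln (real (Suc (Suc n))) - ln (real (Suc n)) \<le> 1 / real (Suc n)"
    by (simp add: ln_div field_simps)
  with Suc show ?case by simp
qed simp

lemma inverse_square_le:
  assumes "n \<ge> 1"
  shows "1 / (real (Suc n))\<^sup>2 \<le> 1 / real n - 1 / real (Suc n)"
proof -
  have "1 / (real (Suc n))\<^sup>2 \<le> 1 / (real n * real (Suc n))"
    using assms by (intro divide_left_mono) (auto simp: power2_eq_square)
  also have "\<dots> = 1 / real n - 1 / real (Suc n)"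
    using assms by (simp add: field_simps)
  finally show ?thesis .
qed

lemma sum_inverse_squares_le: "n \<ge> 1 \<Longrightarrow> (\<Sum>g=1..n. 1 / (real g)\<^sup>2) \<le> 2 - 1 / real n"
proof (induction n rule: nat_induct_at_least)
  case (Suc n)
  with inverse_square_le[of n] show ?case by simp
qed simp

lemma sum_inverse_squares_tail: "n \<ge> 2 \<Longrightarrow> (\<Sum>g=2..n. 1 / (real g)\<^sup>2) \<le> 3 / 4 - 1 / real n"
proof (induction n rule: nat_induct_at_least)
  case base
  show ?case by simp
next
  case (Suc n)
  with inverse_square_le[of n] show ?case by simp
qed

abbreviation box :: "int \<Rightarrow> int set" where "box M \<equiv> {-M..M}"

abbreviation cube :: "nat \<Rightarrow> int \<Rightarrow> (nat \<Rightarrow> int) set" where "cube k M \<equiv> Pi\<^sub>E {..<k} (\<lambda>_. box M)"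

lemma sum_by_values:
  fixes G :: "'t \<Rightarrow> nat"
  assumes "finite D" "\<And>t. t \<in> D \<Longrightarrow> G t \<le> M"
  shows "(\<Sum>t\<in>D. real (G t)) = (\<Sum>g=1..M. real g * real (card {t \<in> D. G t = g}))"
proof -
  have "(\<Sum>t\<in>D. real (G t)) = (\<Sum>t\<in>D. \<Sum>g=1..M. if G t = g then real g else 0)"
  proof (intro sum.cong refl)
    fix t assume "t \<in> D"
    with assms(2)[OF this] show "real (G t) = (\<Sum>g=1..M. if G t = g then real g else 0)"
      by (cases "G t") (auto simp: sum.delta')
  qed
  also have "\<dots> = (\<Sum>g=1..M. \<Sum>t\<in>D. if G t = g then real g else 0)"
    by (rule sum.swap)
  also have "\<dots> = (\<Sum>g=1..M. real g * real (card {t \<in> D. G t = g}))"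
    using assms(1) by (intro sum.cong refl) (simp add: sum.If_cases Int_def)
  finally show ?thesis .
qed

lemma card_multiples_le:
  assumes "1 \<le> g" "g \<le> M"
  shows "real (card {u \<in> box (int M). int g dvd u}) \<le> 3 * real M / real g"
proof -
  define q where "q = M div g"
  have q: "1 \<le> q" "real q \<le> real M / real g"
    using assms by (auto simp: q_def of_nat_div_le_of_nat Suc_le_eq div_greater_zero_iff)
  have "{u \<in> box (int M). int g dvd u} \<subseteq> (\<lambda>k. int g * k) ` {- int q..int q}"
  proof
    fix u assume u: "u \<in> {u \<in> box (int M). int g dvd u}"
    then obtain k where k: "u = int g * k" by (auto elim: dvdE)
    have "int g * \<bar>k\<bar> \<le> int M" using u k by (auto simp: abs_if)
    then have "\<bar>k\<bar> \<le> int M div int g"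
      using assms(1) zdiv_mono1[of "int g * \<bar>k\<bar>" "int M" "int g"] by simp
    then have "\<bar>k\<bar> \<le> int q" by (simp add: q_def zdiv_int)
    then have "k \<in> {- int q..int q}" by auto
    then show "u \<in> (\<lambda>k. int g * k) ` {- int q..int q}" using k by blast
  qed
  then have "card {u \<in> box (int M). int g dvd u} \<le> card {- int q..int q}"
    by (rule surj_card_le[rotated]) simp
  then have "real (card {u \<in> box (int M). int g dvd u}) \<le> 2 * real q + 1"
    by simp
  also have "\<dots> \<le> 3 * real q" using q by simp
  finally show ?thesis using q(2) by simp
qed

lemma sum_gcd2_le:
  assumes "M \<ge> 1"
  shows "(\<Sum>u\<in>box (int M). \<Sum>v\<in>box (int M). real_of_int (gcd u v))
           \<le> 9 * (real M)\<^sup>2 * (1 + ln (real M))"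
proof -
  let ?B = "box (int M)"
  define G where "G = (\<lambda>(u::int, v). nat (gcd u v))"
  have le: "G t \<le> M" if "t \<in> ?B \<times> ?B" for t
  proof -
    obtain u v where t: "t = (u, v)" by (cases t)
    have "gcd u v \<le> int M"
    proof (cases "u = 0")
      case False
      then have "gcd u v \<le> \<bar>u\<bar>" by (intro zdvd_imp_le) auto
      then show ?thesis using that t by auto
    qed (use that t in auto)
    then show ?thesis by (simp add: G_def t)
  qed
  have "(\<Sum>u\<in>?B. \<Sum>v\<in>?B. real_of_int (gcd u v)) = (\<Sum>t\<in>?B \<times> ?B. real (G t))"
    unfolding sum.cartesian_product by (intro sum.cong) (auto simp: G_def)
  also have "\<dots> = (\<Sum>g=1..M. real g * real (card {t \<in> ?B \<times> ?B. G t = g}))"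
    by (rule sum_by_values) (use le in auto)
  also have "\<dots> \<le> (\<Sum>g=1..M. real g * (3 * real M / real g)\<^sup>2)"
  proof (intro sum_mono mult_left_mono)
    fix g assume g: "g \<in> {1..M}"
    let ?E = "{u \<in> ?B. int g dvd u}"
    have finE: "finite ?E" by (rule finite_subset[of _ ?B]) auto
    have "card {t \<in> ?B \<times> ?B. G t = g} \<le> card (?E \<times> ?E)"
      by (intro card_mono finite_cartesian_product finE) (auto simp: G_def)
    then have "real (card {t \<in> ?B \<times> ?B. G t = g}) \<le> (real (card ?E))\<^sup>2"
      by (simp add: card_cartesian_product power2_eq_square flip: of_nat_mult)
    also have "\<dots> \<le> (3 * real M / real g)\<^sup>2"
      using g card_multiples_le[of g M] by (intro power_mono) auto
    finally show "real (card {t \<in> ?B \<times> ?B. G t = g}) \<le> (3 * real M / real g)\<^sup>2" .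
  qed auto
  also have "\<dots> = (\<Sum>g=1..M. 9 * (real M)\<^sup>2 * (1 / real g))"
    by (intro sum.cong) (auto simp: power2_eq_square)
  also have "\<dots> = 9 * (real M)\<^sup>2 * (\<Sum>g=1..M. 1 / real g)"
    by (simp add: sum_distrib_left)
  also have "\<dots> \<le> 9 * (real M)\<^sup>2 * (1 + ln (real M))"
    using assms by (intro mult_left_mono sum_inverse_le_ln) auto
  finally show ?thesis .
qed

lemma sum_gcd3_le:
  assumes "M \<ge> 1"
  shows "(\<Sum>u\<in>box (int M). \<Sum>v\<in>box (int M). \<Sum>w\<in>box (int M).
            real_of_int (gcd u (gcd v w))) \<le> 54 * (real M) ^ 3"
proof -
  let ?B = "box (int M)"
  define G where "G = (\<lambda>(u::int, v, w). nat (gcd u (gcd v w)))"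
  have le: "G t \<le> M" if "t \<in> ?B \<times> ?B \<times> ?B" for t
  proof -
    obtain u v w where t: "t = (u, v, w)" by (cases t)
    have abs: "\<bar>u\<bar> \<le> int M" "\<bar>v\<bar> \<le> int M" "\<bar>w\<bar> \<le> int M" using that t by auto
    have "gcd u (gcd v w) \<le> \<bar>x\<bar>" if "x \<in> {u, v, w}" "x \<noteq> 0" for x
      using that by (intro zdvd_imp_le) (auto intro: dvd_trans)
    then have "gcd u (gcd v w) \<le> int M"
      using abs by (cases "u = 0 \<and> v = 0 \<and> w = 0") (auto intro: order_trans)
    then show ?thesis by (simp add: G_def t)
  qed
  have "(\<Sum>u\<in>?B. \<Sum>v\<in>?B. \<Sum>w\<in>?B. real_of_int (gcd u (gcd v w))) = (\<Sum>t\<in>?B \<times> ?B \<times> ?B. real (G t))"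
    unfolding sum.cartesian_product by (intro sum.cong) (auto simp: G_def)
  also have "\<dots> = (\<Sum>g=1..M. real g * real (card {t \<in> ?B \<times> ?B \<times> ?B. G t = g}))"
    by (rule sum_by_values) (use le in auto)
  also have "\<dots> \<le> (\<Sum>g=1..M. real g * (3 * real M / real g) ^ 3)"
  proof (intro sum_mono mult_left_mono)
    fix g assume g: "g \<in> {1..M}"
    let ?E = "{u \<in> ?B. int g dvd u}"
    have finE: "finite ?E" by (rule finite_subset[of _ ?B]) auto
    have "{t \<in> ?B \<times> ?B \<times> ?B. G t = g} \<subseteq> ?E \<times> ?E \<times> ?E"
      by (auto simp: G_def intro: dvd_trans[OF gcd_dvd2])
    then have "card {t \<in> ?B \<times> ?B \<times> ?B. G t = g} \<le> card (?E \<times> ?E \<times> ?E)"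
      by (intro card_mono finite_cartesian_product finE)
    then have "real (card {t \<in> ?B \<times> ?B \<times> ?B. G t = g}) \<le> (real (card ?E)) ^ 3"
      by (simp add: card_cartesian_product power3_eq_cube mult.assoc flip: of_nat_mult)
    also have "\<dots> \<le> (3 * real M / real g) ^ 3"
      using g card_multiples_le[of g M] by (intro power_mono) auto
    finally show "real (card {t \<in> ?B \<times> ?B \<times> ?B. G t = g}) \<le> (3 * real M / real g) ^ 3" .
  qed auto
  also have "\<dots> = (\<Sum>g=1..M. 27 * (real M) ^ 3 * (1 / (real g)\<^sup>2))"
    by (intro sum.cong) (auto simp: power2_eq_square power3_eq_cube)
  also have "\<dots> = 27 * (real M) ^ 3 * (\<Sum>g=1..M. 1 / (real g)\<^sup>2)"
    by (simp add: sum_distrib_left)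
  also have "\<dots> \<le> 27 * (real M) ^ 3 * 2"
  proof (rule mult_left_mono)
    show "(\<Sum>g=1..M. 1 / (real g)\<^sup>2) \<le> 2"
      using sum_inverse_squares_le[OF assms] by (rule order_trans) simp
  qed simp
  finally show ?thesis by simp
qed

lemma totient_ge:
  assumes "g \<ge> 1"
  shows "real (totient g) \<ge> real g - (\<Sum>e | e \<in> {2..g} \<and> e dvd g. real g / real e)"
proof -
  let ?E = "{e \<in> {2..g}. e dvd g}"
  have sub: "{1..g} - totatives g \<subseteq> (\<Union>e\<in>?E. (\<lambda>k. e * k) ` {1..g div e})"
  proof
    fix k assume k: "k \<in> {1..g} - totatives g"
    define e where "e = gcd k g"
    have "e \<noteq> 1" using k by (auto simp: in_totatives_iff e_def coprime_iff_gcd_eq_1)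
    moreover have "e \<noteq> 0" "e \<le> g" using assms by (auto simp: e_def intro: dvd_imp_le)
    ultimately have "2 \<le> e" "e \<le> g" by auto
    then have e: "e \<in> ?E" by (simp add: e_def)
    have "e dvd k" by (simp add: e_def)
    then have "k = e * (k div e)" by simp
    moreover have "k div e \<in> {1..g div e}"
      using k e \<open>e dvd k\<close> by (auto simp: Suc_le_eq div_greater_zero_iff div_le_mono dvd_imp_le)
    ultimately show "k \<in> (\<Union>e\<in>?E. (\<lambda>k. e * k) ` {1..g div e})" using e by blast
  qed
  have "g - totient g = card ({1..g} - totatives g)"
    using totatives_subset[of g] by (subst card_Diff_subset) (auto simp: totient_def Suc_le_eq)
  also have "\<dots> \<le> card (\<Union>e\<in>?E. (\<lambda>k. e * k) ` {1..g div e})"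
    by (intro card_mono sub) auto
  also have "\<dots> \<le> (\<Sum>e\<in>?E. card ((\<lambda>k. e * k) ` {1..g div e}))"
    by (intro card_UN_le) auto
  also have "\<dots> \<le> (\<Sum>e\<in>?E. g div e)"
    by (intro sum_mono) (metis card_atLeastAtMost card_image_le diff_Suc_1 finite_atLeastAtMost)
  finally have "real (g - totient g) \<le> (\<Sum>e\<in>?E. real (g div e))"
    by (metis of_nat_le_iff of_nat_sum)
  also have "\<dots> \<le> (\<Sum>e\<in>?E. real g / real e)"
    by (intro sum_mono of_nat_div_le_of_nat)
  finally show ?thesis using totient_le[of g] by (simp add: of_nat_diff)
qed

text \<open>Since the divisors of a number coprime to \<open>\<Delta>\<close> are again coprime to \<open>\<Delta>\<close>, the non-coprime pairs
  take away at most the proportion \<open>\<Sum>e\<ge>2. 1/e\<^sup>2 \<le> 3/4\<close>.\<close>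

lemma sum_totient_ge:
  assumes "\<Delta> \<ge> 1"
  shows "(\<Sum>g | g \<in> {1..n} \<and> coprime g \<Delta>. real (totient g) / (real g)\<^sup>2)
           \<ge> 1 / 4 * (\<Sum>g | g \<in> {1..n} \<and> coprime g \<Delta>. 1 / real g)"
proof -
  let ?D = "{g \<in> {1..n}. coprime g \<Delta>}"
  have fin: "finite ?D" by (rule finite_subset[of _ "{1..n}"]) auto
  define s where "s = (\<Sum>g\<in>?D. 1 / real g)"
  have s0: "s \<ge> 0" by (auto simp: s_def intro!: sum_nonneg)
  have inner: "(\<Sum>g\<in>?D. if e dvd g then 1 / real g else 0) \<le> 1 / real e * s" if e: "e \<ge> 2" for e
  proof -
    have "(\<Sum>g\<in>?D. if e dvd g then 1 / real g else 0) = (\<Sum>g\<in>{g\<in>?D. e dvd g}. 1 / real g)"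
      by (rule sum.inter_filter[symmetric, OF fin])
    also have "\<dots> = (\<Sum>f\<in>(\<lambda>g. g div e) ` {g\<in>?D. e dvd g}. 1 / real (e * f))"
      using e by (subst sum.reindex) (auto simp: inj_on_def elim!: dvdE intro!: sum.cong)
    also have "\<dots> \<le> (\<Sum>f\<in>?D. 1 / real (e * f))"
    proof (intro sum_mono2)
      show "(\<lambda>g. g div e) ` {g\<in>?D. e dvd g} \<subseteq> ?D"
      proof clarify
        fix g assume g: "g \<in> {1..n}" "coprime g \<Delta>" "e dvd g"
        then obtain f where f: "g = e * f" by (auto elim: dvdE)
        have "f \<le> e * f" using e by simp
        then show "g div e \<in> {1..n} \<and> coprime (g div e) \<Delta>"
          using g e f order_trans[OF \<open>f \<le> e * f\<close>, of n] by (cases "f = 0") auto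
      qed
    qed auto
    also have "\<dots> = 1 / real e * s"
      by (simp add: s_def sum_distrib_left)
    finally show ?thesis .
  qed
  have tail: "(\<Sum>e=2..n. 1 / (real e)\<^sup>2) \<le> 3 / 4"
  proof (cases "n \<ge> 2")
    case True
    from sum_inverse_squares_tail[OF this] show ?thesis by (rule order_trans) simp
  qed auto
  have "(\<Sum>g\<in>?D. \<Sum>e=2..n. if e dvd g then 1 / (real e * real g) else 0)
      = (\<Sum>e=2..n. 1 / real e * (\<Sum>g\<in>?D. if e dvd g then 1 / real g else 0))"
    unfolding sum_distrib_left by (subst sum.swap) (intro sum.cong, auto)
  also have "\<dots> \<le> (\<Sum>e=2..n. 1 / real e * (1 / real e * s))"
    by (intro sum_mono mult_left_mono inner) auto
  also have "\<dots> = (\<Sum>e=2..n. 1 / (real e)\<^sup>2) * s"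
    by (simp add: sum_distrib_right power2_eq_square)
  also have "\<dots> \<le> 3 / 4 * s"
    using tail s0 by (intro mult_right_mono) auto
  finally have noncop: "(\<Sum>g\<in>?D. \<Sum>e=2..n. if e dvd g then 1 / (real e * real g) else 0) \<le> 3 / 4 * s" .
  have "s - 3 / 4 * s \<le> (\<Sum>g\<in>?D. 1 / real g - (\<Sum>e=2..n. if e dvd g then 1 / (real e * real g) else 0))"
    using noncop by (simp add: sum_subtractf s_def)
  also have "\<dots> \<le> (\<Sum>g\<in>?D. real (totient g) / (real g)\<^sup>2)"
  proof (intro sum_mono)
    fix g assume g: "g \<in> ?D"
    have "(\<Sum>e | e \<in> {2..g} \<and> e dvd g. real g / real e) \<le> (\<Sum>e | e \<in> {2..n} \<and> e dvd g. real g / real e)"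
      using g by (intro sum_mono2) auto
    also have "\<dots> = (\<Sum>e=2..n. if e dvd g then real g / real e else 0)"
      by (subst sum.inter_filter[symmetric]) auto
    finally have "real g - (\<Sum>e=2..n. if e dvd g then real g / real e else 0) \<le> real (totient g)"
      using totient_ge[of g] g by simp
    then have "(real g - (\<Sum>e=2..n. if e dvd g then real g / real e else 0)) / (real g)\<^sup>2
        \<le> real (totient g) / (real g)\<^sup>2"
      by (intro divide_right_mono) auto
    also have "(real g - (\<Sum>e=2..n. if e dvd g then real g / real e else 0)) / (real g)\<^sup>2
        = 1 / real g - (\<Sum>e=2..n. if e dvd g then 1 / (real e * real g) else 0)"
      using g unfolding diff_divide_distrib sum_divide_distrib
      by (intro arg_cong2[where f = minus] sum.cong) (auto simp: power2_eq_square)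
    finally show "1 / real g - (\<Sum>e=2..n. if e dvd g then 1 / (real e * real g) else 0)
        \<le> real (totient g) / (real g)\<^sup>2" .
  qed
  finally show ?thesis by (simp add: s_def)
qed

lemma sum_inverse_coprime_ge:
  assumes "\<Delta> \<ge> 1" "n \<ge> \<Delta>\<^sup>2"
  shows "(\<Sum>g | g \<in> {1..n} \<and> coprime g \<Delta>. 1 / real g) \<ge> ln (real n) / (2 * real \<Delta>)"
proof -
  let ?D = "{g \<in> {1..n}. coprime g \<Delta>}"
  define q where "q = n div \<Delta>"
  have n: "n \<ge> 1" using assms by (cases n) auto
  have sub: "(\<lambda>i. 1 + \<Delta> * i) ` {..<q} \<subseteq> ?D"
  proof clarify
    fix i assume "i < q"
    then have "\<Delta> * (i + 1) \<le> \<Delta> * q" by (intro mult_left_mono) auto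
    also have "\<dots> \<le> n" by (simp add: q_def)
    finally have "\<Delta> * i + 1 \<le> n" using assms(1) by simp
    moreover have "coprime (1 + \<Delta> * i) \<Delta>"
      by (rule coprimeI) (metis dvd_add_left_iff dvd_mult2)
    ultimately show "1 + \<Delta> * i \<in> {1..n} \<and> coprime (1 + \<Delta> * i) \<Delta>" by simp
  qed
  have "ln (real n) / 2 \<le> ln (real n / real \<Delta>)"
  proof -
    have "2 * ln (real \<Delta>) = ln (real \<Delta> ^ 2)"
      using assms(1) by (subst ln_realpow) auto
    also have "\<dots> \<le> ln (real n)"
      using assms n by (subst ln_le_cancel_iff) (auto simp flip: of_nat_power)
    finally show ?thesis using assms(1) n by (simp add: ln_div)
  qed
  also have "\<dots> \<le> ln (real (Suc q))"
  proof -
    have "n < \<Delta> * Suc q" using assms(1) unfolding q_def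
      by (metis dividend_less_times_div less_le_trans mult_Suc_right add.commute zero_less_one)
    then have "real n < real \<Delta> * real (Suc q)" by (metis of_nat_less_iff of_nat_mult)
    then show ?thesis using assms(1) n by (subst ln_le_cancel_iff) (auto simp: field_simps)
  qed
  also have "\<dots> \<le> (\<Sum>g=1..q. 1 / real g)" by (rule ln_le_sum_inverse)
  also have "\<dots> = (\<Sum>i<q. 1 / real (Suc i))"
    by (rule sum.reindex_bij_witness[of _ Suc "\<lambda>i. i - 1"]) auto
  finally have "ln (real n) / (2 * real \<Delta>) \<le> (\<Sum>i<q. 1 / real (Suc i)) / real \<Delta>"
    using assms(1) by (simp add: field_simps)
  also have "\<dots> \<le> (\<Sum>i<q. 1 / real (1 + \<Delta> * i))"
    unfolding sum_divide_distrib
  proof (intro sum_mono)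
    fix i
    have "1 + \<Delta> * i \<le> \<Delta> * Suc i" using assms(1) by simp
    then have "real (1 + \<Delta> * i) \<le> real \<Delta> * real (Suc i)" by (metis of_nat_le_iff of_nat_mult)
    then have "1 / (real \<Delta> * real (Suc i)) \<le> 1 / real (1 + \<Delta> * i)"
      using assms(1) by (intro divide_left_mono mult_pos_pos) (auto intro: add_pos_nonneg)
    then show "1 / real (Suc i) / real \<Delta> \<le> 1 / real (1 + \<Delta> * i)" by (simp add: field_simps)
  qed
  also have "\<dots> = (\<Sum>g\<in>(\<lambda>i. 1 + \<Delta> * i) ` {..<q}. 1 / real g)"
    using assms(1) by (subst sum.reindex) (auto simp: inj_on_def)
  also have "\<dots> \<le> (\<Sum>g\<in>?D. 1 / real g)"
    using sub by (intro sum_mono2) auto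
  finally show ?thesis .
qed

lemma card_affine_multiples_ge:
  fixes \<alpha> :: int
  assumes "coprime g \<Delta>" "1 \<le> g" "g \<le> n"
  shows "real n / (2 * real g) \<le> real (card {a \<in> box (int n). int g dvd \<alpha> + int \<Delta> * a})"
proof -
  have "coprime (int \<Delta>) (int g)" using assms(1) by (simp add: coprime_commute)
  then obtain x where x: "[int \<Delta> * x = 1] (mod int g)"
    using cong_solve_coprime_int by blast
  define s where "s = (- \<alpha> * x) mod int g"
  have s: "0 \<le> s" "s < int g" using assms(2) by (auto simp: s_def)
  have "[int \<Delta> * s = int \<Delta> * (- \<alpha> * x)] (mod int g)"
    unfolding s_def by (intro cong_mult cong_refl) (simp add: cong_def)
  also have "int \<Delta> * (- \<alpha> * x) = - \<alpha> * (int \<Delta> * x)" by simp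
  also have "[\<dots> = - \<alpha> * 1] (mod int g)" by (intro cong_mult cong_refl x)
  finally have dvd: "int g dvd \<alpha> + int \<Delta> * s"
    by (simp add: cong_iff_dvd_diff add.commute)
  define q where "q = n div g"
  have "(\<lambda>t. s + int g * int t) ` {..<q} \<subseteq> {a \<in> box (int n). int g dvd \<alpha> + int \<Delta> * a}"
  proof clarify
    fix t assume "t < q"
    then have "g * (t + 1) \<le> g * q" by (intro mult_left_mono) auto
    also have "\<dots> \<le> n" by (simp add: q_def)
    finally have "int g * int t + int g \<le> int n" by (simp add: algebra_simps flip: of_nat_mult of_nat_add)
    moreover have "0 \<le> int g * int t" by simp
    ultimately have "s + int g * int t \<in> box (int n)"
      using s unfolding atLeastAtMost_iff by linarith
    moreover have "\<alpha> + int \<Delta> * (s + int g * int t) = \<alpha> + int \<Delta> * s + int g * (int \<Delta> * int t)"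
      by (simp add: algebra_simps)
    moreover have "int g dvd \<alpha> + int \<Delta> * s + int g * (int \<Delta> * int t)"
      by (rule dvd_add[OF dvd]) simp
    ultimately show "s + int g * int t \<in> box (int n) \<and> int g dvd \<alpha> + int \<Delta> * (s + int g * int t)"
      by metis
  qed
  then have "card ((\<lambda>t. s + int g * int t) ` {..<q}) \<le> card {a \<in> box (int n). int g dvd \<alpha> + int \<Delta> * a}"
    by (rule card_mono[rotated]) (rule finite_subset[of _ "box (int n)"], auto)
  also have "card ((\<lambda>t. s + int g * int t) ` {..<q}) = q"
    using assms(2) by (subst card_image) (auto simp: inj_on_def)
  finally have "real q \<le> real (card {a \<in> box (int n). int g dvd \<alpha> + int \<Delta> * a})" by simp
  moreover have "real n / (2 * real g) \<le> real q"
  proof -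
    have "q \<ge> 1" using assms by (simp add: q_def Suc_le_eq div_greater_zero_iff)
    have "n < g * q + g"
      using mult_div_mod_eq[of g n] mod_less_divisor[of g n] assms(2) unfolding q_def by linarith
    also have "\<dots> \<le> g * (2 * q)" using \<open>q \<ge> 1\<close> by simp
    finally have "real n \<le> real g * (2 * real q)"
      by (metis (no_types, lifting) less_imp_le of_nat_le_iff of_nat_mult of_nat_numeral)
    then show ?thesis using assms(2) by (simp add: field_simps)
  qed
  ultimately show ?thesis by linarith
qed

definition replace_zero :: "real \<Rightarrow> int \<Rightarrow> real" where
  "replace_zero Z g = (if g = 0 then Z else real_of_int \<bar>g\<bar>)"

lemma sum_gcd2_ge:
  fixes \<alpha> \<beta> :: int
  assumes "\<Delta> \<ge> 1" "n \<ge> \<Delta>\<^sup>2"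
  shows "(\<Sum>a\<in>box (int n). \<Sum>b\<in>box (int n).
            replace_zero ((real n)\<^sup>2) (gcd (\<alpha> + int \<Delta> * a) (\<beta> + int \<Delta> * b)))
          \<ge> (real n)\<^sup>2 * ln (real n) / (32 * real \<Delta>)"
proof -
  let ?B = "box (int n)" and ?D = "{g \<in> {1..n}. coprime g \<Delta>}"
  let ?u = "\<lambda>a. \<alpha> + int \<Delta> * a" and ?v = "\<lambda>b. \<beta> + int \<Delta> * b"
  have pt: "(\<Sum>g\<in>?D. if int g dvd u \<and> int g dvd v then real (totient g) else 0)
      \<le> replace_zero ((real n)\<^sup>2) (gcd u v)" for u v
  proof (cases "gcd u v = 0")
    case True
    have "(\<Sum>g\<in>?D. if int g dvd u \<and> int g dvd v then real (totient g) else 0) \<le> (\<Sum>g\<in>?D. real n)"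
    proof (intro sum_mono)
      fix g assume "g \<in> ?D"
      with totient_le[of g] show "(if int g dvd u \<and> int g dvd v then real (totient g) else 0) \<le> real n"
        by auto
    qed
    also have "\<dots> = real (card ?D) * real n" by simp
    also have "\<dots> \<le> real n * real n"
    proof (intro mult_right_mono)
      have "card ?D \<le> card {1..n}" by (intro card_mono) auto
      then show "real (card ?D) \<le> real n" by simp
    qed simp
    finally show ?thesis using True by (simp add: replace_zero_def power2_eq_square)
  next
    case False
    define G where "G = nat (gcd u v)"
    have "gcd u v > 0" using False gcd_ge_0_int[of u v] by linarith
    then have G: "G > 0" "gcd u v = int G" by (simp_all add: G_def)
    have "(\<Sum>g\<in>?D. if int g dvd u \<and> int g dvd v then real (totient g) else 0)
        = (\<Sum>g\<in>{g\<in>?D. int g dvd u \<and> int g dvd v}. real (totient g))"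
      by (rule sum.inter_filter[symmetric]) (rule finite_subset[of _ "{1..n}"], auto)
    also have "\<dots> \<le> (\<Sum>g | g dvd G. real (totient g))"
    proof (intro sum_mono2)
      show "finite {g. g dvd G}" using G by simp
      show "{g\<in>?D. int g dvd u \<and> int g dvd v} \<subseteq> {g. g dvd G}"
      proof clarify
        fix g assume "int g dvd u" "int g dvd v"
        then have "int g dvd int G" unfolding G(2)[symmetric] by simp
        then show "g dvd G" by simp
      qed
    qed auto
    also have "\<dots> = real G" using totient_divisor_sum[of G] by (metis of_nat_sum)
    finally show ?thesis using G by (simp add: replace_zero_def)
  qed
  have ind: "(if P \<and> Q then x else 0) = x * (if P then 1 else 0) * (if Q then 1 else 0)"
    for P Q and x :: real by simp
  have card: "(\<Sum>a\<in>?B. if P a then 1 else 0) = real (card {a \<in> ?B. P a})" for P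
    by (simp add: sum.If_cases Int_def)
  have "(real n)\<^sup>2 * ln (real n) / (32 * real \<Delta>)
      = (real n)\<^sup>2 / 4 * (1 / 4 * (ln (real n) / (2 * real \<Delta>)))" by simp
  also have "\<dots> \<le> (real n)\<^sup>2 / 4 * (1 / 4 * (\<Sum>g\<in>?D. 1 / real g))"
    using sum_inverse_coprime_ge[OF assms] by (intro mult_left_mono) auto
  also have "\<dots> \<le> (real n)\<^sup>2 / 4 * (\<Sum>g\<in>?D. real (totient g) / (real g)\<^sup>2)"
    using sum_totient_ge[OF assms(1)] by (intro mult_left_mono) auto
  also have "\<dots> = (\<Sum>g\<in>?D. real (totient g) * (real n / (2 * real g)) * (real n / (2 * real g)))"
    unfolding sum_distrib_left by (intro sum.cong) (auto simp: power2_eq_square)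
  also have "\<dots> \<le> (\<Sum>g\<in>?D. real (totient g) * real (card {a \<in> ?B. int g dvd ?u a})
      * real (card {b \<in> ?B. int g dvd ?v b}))"
    by (intro sum_mono mult_mono card_affine_multiples_ge mult_nonneg_nonneg) auto
  also have "\<dots> = (\<Sum>g\<in>?D. \<Sum>a\<in>?B. \<Sum>b\<in>?B.
      if int g dvd ?u a \<and> int g dvd ?v b then real (totient g) else 0)"
  proof (intro sum.cong refl)
    fix g
    have "real (totient g) * (\<Sum>a\<in>?B. if int g dvd ?u a then 1 else 0) * (\<Sum>b\<in>?B. if int g dvd ?v b then 1 else 0)
        = (\<Sum>a\<in>?B. \<Sum>b\<in>?B. real (totient g) * ((if int g dvd ?u a then 1 else 0) * (if int g dvd ?v b then 1 else 0)))"
      by (simp only: mult.assoc sum_product) (simp only: sum_distrib_left)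
    then show "real (totient g) * real (card {a \<in> ?B. int g dvd ?u a}) * real (card {b \<in> ?B. int g dvd ?v b})
        = (\<Sum>a\<in>?B. \<Sum>b\<in>?B. if int g dvd ?u a \<and> int g dvd ?v b then real (totient g) else 0)"
      by (simp only: ind card mult.assoc)
  qed
  also have "\<dots> = (\<Sum>a\<in>?B. \<Sum>g\<in>?D. \<Sum>b\<in>?B.
      if int g dvd ?u a \<and> int g dvd ?v b then real (totient g) else 0)"
    by (rule sum.swap)
  also have "\<dots> = (\<Sum>a\<in>?B. \<Sum>b\<in>?B. \<Sum>g\<in>?D.
      if int g dvd ?u a \<and> int g dvd ?v b then real (totient g) else 0)"
    by (intro sum.cong refl sum.swap)
  also have "\<dots> \<le> (\<Sum>a\<in>?B. \<Sum>b\<in>?B. replace_zero ((real n)\<^sup>2) (gcd (?u a) (?v b)))"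
    by (intro sum_mono pt)
  finally show ?thesis .
qed

lemma sum_abs_ge:
  fixes \<alpha> :: int
  assumes "\<Delta> \<ge> 1"
  shows "(\<Sum>a\<in>box (int n). replace_zero ((real n)\<^sup>2) (\<alpha> + int \<Delta> * a)) \<ge> (real n)\<^sup>2"
proof -
  have "(\<Sum>a\<in>box (int n). \<bar>\<alpha> + int \<Delta> * a\<bar>) \<ge> int n * int n"
  proof (induction n)
    case (Suc n)
    have eq: "{- int (Suc n)..int (Suc n)} = insert (int (Suc n)) (insert (- int (Suc n)) (box (int n)))"
      by auto
    have "int \<Delta> * int (Suc n) \<ge> 1 * int (Suc n)" using assms by (intro mult_right_mono) auto
    then have "\<bar>\<alpha> + int \<Delta> * int (Suc n)\<bar> + \<bar>\<alpha> + int \<Delta> * - int (Suc n)\<bar> \<ge> 2 * int (Suc n)"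
      by linarith
    moreover have "int (Suc n) * int (Suc n) = int n * int n + 2 * int n + 1" by (simp add: algebra_simps)
    ultimately show ?case using Suc unfolding eq by simp
  qed simp
  then have "real_of_int (\<Sum>a\<in>box (int n). \<bar>\<alpha> + int \<Delta> * a\<bar>) \<ge> real_of_int (int n * int n)"
    by (rule of_int_le_iff[THEN iffD2])
  then have "(real n)\<^sup>2 \<le> (\<Sum>a\<in>box (int n). real_of_int \<bar>\<alpha> + int \<Delta> * a\<bar>)"
    by (simp add: power2_eq_square)
  also have "\<dots> \<le> (\<Sum>a\<in>box (int n). replace_zero ((real n)\<^sup>2) (\<alpha> + int \<Delta> * a))"
  proof (intro sum_mono)
    show "real_of_int \<bar>u\<bar> \<le> replace_zero ((real n)\<^sup>2) u" for u
      by (cases "u = 0") (simp_all add: replace_zero_def)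
  qed
  finally show ?thesis .
qed

lemma sum_affine_le:
  fixes f :: "int \<Rightarrow> real"
  assumes "\<And>u. f u \<ge> 0" "\<Delta> \<noteq> 0" "\<bar>\<alpha>\<bar> + \<bar>\<Delta>\<bar> * M \<le> M'"
  shows "(\<Sum>a\<in>box M. f (\<alpha> + \<Delta> * a)) \<le> (\<Sum>u\<in>box M'. f u)"
proof -
  have "(\<Sum>a\<in>box M. f (\<alpha> + \<Delta> * a)) = (\<Sum>u\<in>(\<lambda>a. \<alpha> + \<Delta> * a) ` (box M). f u)"
    using assms(2) by (subst sum.reindex) (auto simp: inj_on_def)
  also have "\<dots> \<le> (\<Sum>u\<in>box M'. f u)"
  proof (intro sum_mono2)
    show "(\<lambda>a. \<alpha> + \<Delta> * a) ` (box M) \<subseteq> (box M')"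
    proof clarify
      fix a assume "a \<in> box M"
      then have "\<bar>\<Delta> * a\<bar> \<le> \<bar>\<Delta>\<bar> * M" unfolding abs_mult by (intro mult_left_mono) auto
      with assms(3) show "\<alpha> + \<Delta> * a \<in> box M'" by auto
    qed
  qed (use assms in auto)
  finally show ?thesis .
qed

lemma replace_zero_split:
  "replace_zero Z g = (if g = 0 then Z else 0) + real_of_int \<bar>g\<bar>"
  by (simp add: replace_zero_def)

lemma replace_zero_nonneg: "Z \<ge> 0 \<Longrightarrow> replace_zero Z g \<ge> 0"
  by (simp add: replace_zero_def)

lemma sum_abs_le:
  fixes \<alpha> :: int
  assumes "Z \<ge> 0" "\<Delta> \<noteq> 0" "\<bar>\<alpha>\<bar> + \<bar>\<Delta>\<bar> * M \<le> int N" "N \<ge> 1"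
  shows "(\<Sum>a\<in>box M. replace_zero Z (\<alpha> + \<Delta> * a)) \<le> Z + 3 * (real N)\<^sup>2"
proof -
  have "(\<Sum>a\<in>box M. replace_zero Z (\<alpha> + \<Delta> * a)) \<le> (\<Sum>u\<in>box (int N). replace_zero Z u)"
    by (intro sum_affine_le[where f = "replace_zero Z"] assms replace_zero_nonneg)
  also have "\<dots> = Z + (\<Sum>u\<in>box (int N). real_of_int \<bar>u\<bar>)"
    unfolding replace_zero_split sum.distrib by simp
  also have "\<dots> \<le> Z + (\<Sum>u\<in>box (int N). real N)"
    by (intro add_left_mono sum_mono) auto
  also have "\<dots> \<le> Z + 3 * (real N)\<^sup>2"
    using assms(4) by (simp add: power2_eq_square)
  finally show ?thesis .
qed

lemma sum_replace_gcd2_le: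
  fixes \<alpha> \<beta> :: int
  assumes "Z \<ge> 0" "\<Delta> \<noteq> 0" "\<bar>\<alpha>\<bar> + \<bar>\<Delta>\<bar> * M \<le> int N" "\<bar>\<beta>\<bar> + \<bar>\<Delta>\<bar> * M \<le> int N" "N \<ge> 1"
  shows "(\<Sum>a\<in>box M. \<Sum>b\<in>box M. replace_zero Z (gcd (\<alpha> + \<Delta> * a) (\<beta> + \<Delta> * b)))
    \<le> Z + 9 * (real N)\<^sup>2 * (1 + ln (real N))"
proof -
  let ?B = "box (int N)"
  have "(\<Sum>a\<in>box M. \<Sum>b\<in>box M. replace_zero Z (gcd (\<alpha> + \<Delta> * a) (\<beta> + \<Delta> * b)))
      \<le> (\<Sum>a\<in>box M. \<Sum>v\<in>?B. replace_zero Z (gcd (\<alpha> + \<Delta> * a) v))"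
    by (intro sum_mono sum_affine_le[where f = "\<lambda>v. replace_zero Z (gcd _ v)"] assms replace_zero_nonneg)
  also have "\<dots> \<le> (\<Sum>u\<in>?B. \<Sum>v\<in>?B. replace_zero Z (gcd u v))"
    by (intro sum_affine_le[where f = "\<lambda>u. \<Sum>v\<in>?B. replace_zero Z (gcd u v)"] assms
        replace_zero_nonneg sum_nonneg)
  also have "\<dots> = (\<Sum>u\<in>?B. \<Sum>v\<in>?B. if u = 0 \<and> v = 0 then Z else 0)
      + (\<Sum>u\<in>?B. \<Sum>v\<in>?B. real_of_int (gcd u v))"
    unfolding replace_zero_split by (simp add: sum.distrib)
  also have "(\<Sum>u\<in>?B. \<Sum>v\<in>?B. if u = 0 \<and> v = 0 then Z else 0) = (\<Sum>u\<in>?B. if u = 0 then Z else 0)"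
    by (intro sum.cong refl) auto
  also have "\<dots> = Z" by simp
  finally show ?thesis using sum_gcd2_le[OF assms(5)] by simp
qed

lemma sum_replace_gcd3_le:
  fixes \<alpha> \<beta> \<gamma> :: int
  assumes "Z \<ge> 0" "\<Delta> \<noteq> 0" "\<bar>\<alpha>\<bar> + \<bar>\<Delta>\<bar> * M \<le> int N" "\<bar>\<beta>\<bar> + \<bar>\<Delta>\<bar> * M \<le> int N"
    "\<bar>\<gamma>\<bar> + \<bar>\<Delta>\<bar> * M \<le> int N" "N \<ge> 1"
  shows "(\<Sum>a\<in>box M. \<Sum>b\<in>box M. \<Sum>c\<in>box M.
      replace_zero Z (gcd (\<alpha> + \<Delta> * a) (gcd (\<beta> + \<Delta> * b) (\<gamma> + \<Delta> * c))))
    \<le> Z + 54 * real N ^ 3"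
proof -
  let ?B = "box (int N)"
  have "(\<Sum>a\<in>box M. \<Sum>b\<in>box M. \<Sum>c\<in>box M.
        replace_zero Z (gcd (\<alpha> + \<Delta> * a) (gcd (\<beta> + \<Delta> * b) (\<gamma> + \<Delta> * c))))
      \<le> (\<Sum>a\<in>box M. \<Sum>b\<in>box M. \<Sum>w\<in>?B. replace_zero Z (gcd (\<alpha> + \<Delta> * a) (gcd (\<beta> + \<Delta> * b) w)))"
    by (intro sum_mono sum_affine_le[where f = "\<lambda>w. replace_zero Z (gcd _ (gcd _ w))"] assms replace_zero_nonneg)
  also have "\<dots> \<le> (\<Sum>a\<in>box M. \<Sum>v\<in>?B. \<Sum>w\<in>?B. replace_zero Z (gcd (\<alpha> + \<Delta> * a) (gcd v w)))"
    by (intro sum_mono sum_affine_le[where f = "\<lambda>v. \<Sum>w\<in>?B. replace_zero Z (gcd _ (gcd v w))"] assms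
        replace_zero_nonneg sum_nonneg)
  also have "\<dots> \<le> (\<Sum>u\<in>?B. \<Sum>v\<in>?B. \<Sum>w\<in>?B. replace_zero Z (gcd u (gcd v w)))"
    by (intro sum_affine_le[where f = "\<lambda>u. \<Sum>v\<in>?B. \<Sum>w\<in>?B. replace_zero Z (gcd u (gcd v w))"] assms
        replace_zero_nonneg sum_nonneg)
  also have "\<dots> = (\<Sum>u\<in>?B. \<Sum>v\<in>?B. \<Sum>w\<in>?B. if u = 0 \<and> v = 0 \<and> w = 0 then Z else 0)
      + (\<Sum>u\<in>?B. \<Sum>v\<in>?B. \<Sum>w\<in>?B. real_of_int (gcd u (gcd v w)))"
    unfolding replace_zero_split by (simp add: sum.distrib)
  also have "(\<Sum>u\<in>?B. \<Sum>v\<in>?B. \<Sum>w\<in>?B. if u = 0 \<and> v = 0 \<and> w = 0 then Z else 0)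
      = (\<Sum>u\<in>?B. \<Sum>v\<in>?B. if u = 0 \<and> v = 0 then Z else 0)"
    by (intro sum.cong refl) auto
  also have "\<dots> = (\<Sum>u\<in>?B. if u = 0 then Z else 0)"
    by (intro sum.cong refl) auto
  also have "\<dots> = Z" by simp
  finally show ?thesis using sum_gcd3_le[OF assms(6)] by simp
qed

lemma growth_precI:
  fixes f g :: "nat \<Rightarrow> real" and c n0 :: nat
  assumes mono: "mono_on {1..} g" and c: "c \<ge> 1"
    and le: "\<And>n. n \<ge> n0 \<Longrightarrow> n \<ge> 1 \<Longrightarrow> f n \<le> C * max 1 (g (c * n))"
  shows "growth_prec f g"
proof -
  have "finite (insert 1 (insert C (f ` {..<n0})))" by simp
  from bdd_above_finite[OF this] obtain B where B: "\<And>x. x \<in> insert 1 (insert C (f ` {..<n0})) \<Longrightarrow> x \<le> B"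
    by (auto simp: bdd_above_def)
  obtain D :: nat where D: "B \<le> real D" using real_arch_simple by blast
  define E where "E = max c D"
  have E: "E \<ge> 1" "1 \<le> real E" "C \<le> real E" "B \<le> real E"
    using c D B[of 1] B[of C] by (auto simp: E_def)
  have "max 1 (f n) \<le> real E * max 1 (g (E * n))" if n: "n \<ge> 1" for n
  proof -
    have m: "max 1 (g (c * n)) \<le> max 1 (g (E * n))"
      using mono n c by (intro max.mono order_refl) (auto simp: mono_on_def E_def Suc_le_eq)
    have 1: "real E * 1 \<le> real E * max 1 (g (E * n))" by (intro mult_left_mono) auto
    have "f n \<le> real E * max 1 (g (E * n))"
    proof (cases "n < n0")
      case True
      then have "f n \<le> B" using B by auto
      with 1 E show ?thesis by linarith
    next
      case False
      then have "f n \<le> C * max 1 (g (c * n))" using le n by simp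
      also have "\<dots> \<le> real E * max 1 (g (E * n))" using E m by (intro mult_mono) auto
      finally show ?thesis .
    qed
    with 1 E show ?thesis by (intro max.boundedI) linarith+
  qed
  with E show ?thesis unfolding growth_prec_def growth_prec_pos_def by blast
qed

section \<open>Heisenberg groups\<close>

locale heisenberg = group G for G :: "('a, 'b) monoid_scheme" (structure) +
  fixes c :: 'a and \<psi> :: "'a \<Rightarrow> 'a" and S :: "'a set" and m :: nat and s :: "nat \<Rightarrow> 'a"
  assumes c_carrier [simp, intro]: "c \<in> carrier G"
    and derived_eq: "derived G (carrier G) = range (\<lambda>z::int. c [^] z)"
    and c_inj: "\<And>y z :: int. c [^] y = c [^] z \<Longrightarrow> y = z"
    and c_central: "\<And>g. g \<in> carrier G \<Longrightarrow> c \<otimes> g = g \<otimes> c"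
    and psi_iso: "\<psi> \<in> iso G G"
    and S_carrier: "S \<subseteq> carrier G"
    and generates: "generate G S = carrier G"
    and S_eq: "s ` {..<m} = S"
begin

abbreviation cpow :: "int \<Rightarrow> 'a" where "cpow z \<equiv> c [^] z"

definition coset :: "'a \<Rightarrow> 'a set" where
  "coset g = derived G (carrier G) #> g"

abbreviation Ab where "Ab \<equiv> abelianization G"

lemma cpow_add: "cpow (y + z) = cpow y \<otimes> cpow z"
  by (rule int_pow_mult) simp

lemma cpow_commute: "g \<in> carrier G \<Longrightarrow> cpow z \<otimes> g = g \<otimes> cpow z"
proof -
  assume g: "g \<in> carrier G"
  have n: "c [^] (n::nat) \<otimes> g = g \<otimes> c [^] n" for n
  proof (induction n)
    case (Suc n)
    have "c [^] Suc n \<otimes> g = c [^] n \<otimes> (g \<otimes> c)" using g by (simp add: m_assoc c_central)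
    also have "\<dots> = (c [^] n \<otimes> g) \<otimes> c" using g by (simp add: m_assoc)
    also have "\<dots> = g \<otimes> c [^] Suc n" using g by (simp add: Suc m_assoc)
    finally show ?case .
  qed (use g in simp)
  have inv: "inv h \<otimes> g = g \<otimes> inv h" if "h \<in> carrier G" "h \<otimes> g = g \<otimes> h" for h
  proof -
    have "h \<otimes> (g \<otimes> inv h) = (g \<otimes> h) \<otimes> inv h" using that g by (simp add: m_assoc[symmetric])
    also have "\<dots> = h \<otimes> (inv h \<otimes> g)"
      using that(1) g by (simp add: m_assoc) (simp add: m_assoc[symmetric])
    finally show ?thesis
      using l_cancel[of h "g \<otimes> inv h" "inv h \<otimes> g"] that(1) g by simp
  qed
  show ?thesis
  proof (cases "z < 0")
    case True
    then show ?thesis unfolding int_pow_def2 using inv[OF _ n, of "nat (- z)"] by simp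
  next
    case False
    then show ?thesis unfolding int_pow_def2 using n[of "nat z"] by simp
  qed
qed

lemma cpow_mult_left: "g \<in> carrier G \<Longrightarrow> h \<in> carrier G \<Longrightarrow> (g \<otimes> cpow z) \<otimes> h = (g \<otimes> h) \<otimes> cpow z"
  by (simp add: m_assoc cpow_commute)

lemma cpow_mult_cpow: "g \<in> carrier G \<Longrightarrow> (g \<otimes> cpow y) \<otimes> cpow z = g \<otimes> cpow (y + z)"
  by (simp add: m_assoc cpow_add)

lemma mult_cpow_cancel: "g \<in> carrier G \<Longrightarrow> g \<otimes> cpow y = g \<otimes> cpow z \<longleftrightarrow> y = z"
  using c_inj[of y z] by auto

lemma mult_cpow_shift: "g \<in> carrier G \<Longrightarrow> h \<in> carrier G \<Longrightarrow>
    g \<otimes> cpow y = h \<otimes> cpow z \<longleftrightarrow> g = h \<otimes> cpow (z - y)"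
proof -
  assume gh: "g \<in> carrier G" "h \<in> carrier G"
  have "h \<otimes> cpow z = (h \<otimes> cpow (z - y)) \<otimes> cpow y" using gh by (simp add: cpow_mult_cpow)
  then show ?thesis using gh by simp
qed

lemma derived_normal: "derived G (carrier G) \<lhd> G"
  using derived_is_normal[OF normal_self] .

lemma comm_group_Ab: "comm_group Ab"
  unfolding abelianization_def by (rule derived_quot_is_comm_group)

sublocale Ab: comm_group Ab by (rule comm_group_Ab)

lemma coset_closed [simp]: "g \<in> carrier G \<Longrightarrow> coset g \<in> carrier Ab"
  by (auto simp: coset_def abelianization_def carrier_FactGroup)

lemma coset_surj: "C \<in> carrier Ab \<Longrightarrow> \<exists>g\<in>carrier G. C = coset g"
  by (auto simp: coset_def abelianization_def carrier_FactGroup)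

lemma coset_mult: "g \<in> carrier G \<Longrightarrow> h \<in> carrier G \<Longrightarrow> coset (g \<otimes> h) = coset g \<otimes>\<^bsub>Ab\<^esub> coset h"
  using normal.rcos_sum[OF derived_normal, of g h] by (simp add: coset_def abelianization_def)

lemma coset_hom: "coset \<in> hom G Ab"
  by (auto simp: hom_def coset_mult)

lemma coset_one [simp]: "coset \<one> = \<one>\<^bsub>Ab\<^esub>"
  using hom_one[OF coset_hom is_group Ab.is_group] .

lemma coset_inv: "g \<in> carrier G \<Longrightarrow> coset (inv g) = inv\<^bsub>Ab\<^esub> coset g"
  using group_hom.hom_inv[of G Ab coset] coset_hom by (simp add: group_hom_def group_hom_axioms_def)

lemma coset_eq_iff:
  assumes "g \<in> carrier G" "h \<in> carrier G"
  shows "coset g = coset h \<longleftrightarrow> (\<exists>z. h = g \<otimes> cpow z)"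
proof
  assume "coset g = coset h"
  moreover have "h \<in> coset h"
    unfolding coset_def by (rule rcos_self[OF assms(2) derived_is_subgroup]) auto
  ultimately have "h \<in> coset g" by simp
  then obtain z where "h = cpow z \<otimes> g"
    by (auto simp: coset_def r_coset_def derived_eq)
  then show "\<exists>z. h = g \<otimes> cpow z" using assms by (auto simp: cpow_commute)
next
  assume "\<exists>z. h = g \<otimes> cpow z"
  then obtain z where z: "h = cpow z \<otimes> g" using assms by (auto simp: cpow_commute)
  then have "h \<in> coset g" by (auto simp: coset_def r_coset_def derived_eq)
  then show "coset g = coset h"
    unfolding coset_def by (intro repr_independence) (use assms derived_is_subgroup in auto)
qed

lemma coset_cpow: "g \<in> carrier G \<Longrightarrow> coset (g \<otimes> cpow z) = coset g"
  using coset_eq_iff[of g "g \<otimes> cpow z"] by auto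

lemma coset_int_pow: "g \<in> carrier G \<Longrightarrow> coset (g [^] (k::int)) = coset g [^]\<^bsub>Ab\<^esub> k"
  using hom_int_pow[OF coset_hom _ is_group Ab.is_group] .

subsection \<open>The commutator form\<close>

definition \<omega> :: "'a \<Rightarrow> 'a \<Rightarrow> int" where
  "\<omega> g x = (THE z. g \<otimes> x = x \<otimes> g \<otimes> cpow z)"

lemma omega_eqI: "g \<in> carrier G \<Longrightarrow> x \<in> carrier G \<Longrightarrow> g \<otimes> x = x \<otimes> g \<otimes> cpow z \<Longrightarrow> \<omega> g x = z"
  unfolding \<omega>_def by (rule the_equality) (auto dest: c_inj)

lemma omega: "g \<in> carrier G \<Longrightarrow> x \<in> carrier G \<Longrightarrow> g \<otimes> x = x \<otimes> g \<otimes> cpow (\<omega> g x)"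
proof -
  assume gx: "g \<in> carrier G" "x \<in> carrier G"
  then have "coset (x \<otimes> g) = coset (g \<otimes> x)" by (simp add: coset_mult Ab.m_comm)
  then obtain z where "g \<otimes> x = x \<otimes> g \<otimes> cpow z" using gx by (auto simp: coset_eq_iff)
  with omega_eqI[OF gx this] show ?thesis by simp
qed

lemma omega_mult_left:
  assumes "g \<in> carrier G" "h \<in> carrier G" "x \<in> carrier G"
  shows "\<omega> (g \<otimes> h) x = \<omega> g x + \<omega> h x"
proof (rule omega_eqI)
  have "g \<otimes> h \<otimes> x = g \<otimes> (x \<otimes> h \<otimes> cpow (\<omega> h x))"
    using assms omega[of h x] by (simp add: m_assoc)
  also have "\<dots> = (g \<otimes> x) \<otimes> h \<otimes> cpow (\<omega> h x)" using assms by (simp add: m_assoc)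
  also have "(g \<otimes> x) \<otimes> h = x \<otimes> (g \<otimes> h) \<otimes> cpow (\<omega> g x)"
    using assms cpow_mult_left[of "x \<otimes> g" h "\<omega> g x"] omega[of g x] by (simp add: m_assoc)
  also have "\<dots> \<otimes> cpow (\<omega> h x) = x \<otimes> (g \<otimes> h) \<otimes> cpow (\<omega> g x + \<omega> h x)"
    using assms by (simp add: cpow_mult_cpow)
  finally show "g \<otimes> h \<otimes> x = x \<otimes> (g \<otimes> h) \<otimes> cpow (\<omega> g x + \<omega> h x)" .
qed (use assms in auto)

lemma omega_sym: "g \<in> carrier G \<Longrightarrow> x \<in> carrier G \<Longrightarrow> \<omega> g x = - \<omega> x g"
  using omega[of x g] by (intro omega_eqI) (auto simp: cpow_mult_cpow)

lemma omega_mult_right: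
  assumes "g \<in> carrier G" "x \<in> carrier G" "y \<in> carrier G"
  shows "\<omega> g (x \<otimes> y) = \<omega> g x + \<omega> g y"
  using assms omega_mult_left[of x y g] by (simp add: omega_sym[of g])

lemma omega_cpow_left: "x \<in> carrier G \<Longrightarrow> \<omega> (cpow z) x = 0"
  by (intro omega_eqI) (auto simp: cpow_commute)

lemma omega_coset_left:
  assumes "g \<in> carrier G" "h \<in> carrier G" "x \<in> carrier G" "coset g = coset h"
  shows "\<omega> g x = \<omega> h x"
  using assms by (auto simp: coset_eq_iff omega_mult_left omega_cpow_left)

lemma omega_coset_right:
  assumes "g \<in> carrier G" "h \<in> carrier G" "x \<in> carrier G" "coset g = coset h"
  shows "\<omega> x g = \<omega> x h"
  using omega_coset_left[OF assms] assms by (simp add: omega_sym[of x])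

lemma omega_int_pow: "g \<in> carrier G \<Longrightarrow> x \<in> carrier G \<Longrightarrow> \<omega> (g [^] (k::int)) x = k * \<omega> g x"
  using hom_int_pow[of "\<lambda>g. \<omega> g x" G integer_group g k]
  by (simp add: hom_def omega_mult_left)

subsection \<open>Collected words\<close>

primrec collect :: "(nat \<Rightarrow> 'a) \<Rightarrow> nat \<Rightarrow> ivec \<Rightarrow> 'a" where
  "collect t 0 v = \<one>"
| "collect t (Suc j) v = collect t j v \<otimes> t j [^] v j"

lemma collect_closed [simp]: "(\<And>j. j < n \<Longrightarrow> t j \<in> carrier G) \<Longrightarrow> collect t n v \<in> carrier G"
  by (induction n) auto

lemma omega_collect:
  assumes "\<And>j. j < n \<Longrightarrow> t j \<in> carrier G" "x \<in> carrier G"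
  shows "\<omega> (collect t n v) x = (\<Sum>j<n. v j * \<omega> (t j) x)"
  using assms(1)
proof (induction n)
  case 0
  then show ?case using omega_cpow_left[OF assms(2), of 0] by simp
next
  case (Suc n)
  then show ?case using assms(2) by (simp add: omega_mult_left omega_int_pow)
qed

lemma coset_collect_add:
  assumes "\<And>j. j < n \<Longrightarrow> t j \<in> carrier G"
  shows "coset (collect t n (u + v)) = coset (collect t n u) \<otimes>\<^bsub>Ab\<^esub> coset (collect t n v)"
  using assms
proof (induction n)
  case (Suc n)
  then show ?case
    by (simp add: coset_mult coset_int_pow vec_apply Ab.int_pow_mult Ab.m_ac)
qed simp

lemma collect_mult:
  assumes t: "\<And>j. j < n \<Longrightarrow> t j \<in> carrier G"
    and K: "\<And>i j. i < n \<Longrightarrow> j < n \<Longrightarrow> \<bar>\<omega> (t i) (t j)\<bar> \<le> K" "K \<ge> 0"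
  shows "\<exists>z. collect t n u \<otimes> collect t n v = collect t n (u + v) \<otimes> cpow z \<and>
    \<bar>z\<bar> \<le> K * vnorm n u * vnorm n v"
  using t K(1)
proof (induction n)
  case 0
  show ?case by (intro exI[of _ 0]) (auto simp: vnorm_def)
next
  case (Suc n)
  note t = Suc.prems(1)
  let ?a = "collect t n u" and ?b = "collect t n v" and ?ab = "collect t n (u + v)"
  have cl: "?a \<in> carrier G" "?b \<in> carrier G" "?ab \<in> carrier G" "t n \<in> carrier G"
    using t by auto
  obtain z where z: "?a \<otimes> ?b = ?ab \<otimes> cpow z" "\<bar>z\<bar> \<le> K * vnorm n u * vnorm n v"
    using Suc.IH[OF t] Suc.prems(2) by auto
  define w where "w = \<omega> (t n [^] u n) ?b"
  have "collect t (Suc n) u \<otimes> collect t (Suc n) v = ?a \<otimes> (t n [^] u n \<otimes> ?b) \<otimes> t n [^] v n"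
    using cl by (simp add: m_assoc)
  also have "\<dots> = ?a \<otimes> (?b \<otimes> t n [^] u n \<otimes> cpow w) \<otimes> t n [^] v n"
    using cl omega[of "t n [^] u n" ?b] by (simp add: w_def)
  also have "\<dots> = (?a \<otimes> ?b) \<otimes> (t n [^] u n \<otimes> t n [^] v n) \<otimes> cpow w"
    using cl by (simp add: m_assoc cpow_commute)
  also have "\<dots> = collect t (Suc n) (u + v) \<otimes> cpow (z + w)"
    using cl unfolding z(1)
    by (simp add: vec_apply int_pow_mult cpow_mult_left[of ?ab "_ \<otimes> _"] cpow_mult_cpow)
  finally have eq: "collect t (Suc n) u \<otimes> collect t (Suc n) v = collect t (Suc n) (u + v) \<otimes> cpow (z + w)" .
  have "\<omega> ?b (t n) = (\<Sum>j<n. v j * \<omega> (t j) (t n))" using t by (intro omega_collect) auto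
  also have "\<bar>\<dots>\<bar> \<le> (\<Sum>j<n. \<bar>v j\<bar> * K)"
    using Suc.prems(2) by (intro order_trans[OF sum_abs] sum_mono) (auto simp: abs_mult intro!: mult_left_mono)
  also have "\<dots> = K * vnorm n v" by (simp add: vnorm_def sum_distrib_left mult.commute)
  finally have "\<bar>w\<bar> \<le> \<bar>u n\<bar> * (K * vnorm n v)"
    using cl by (simp add: w_def omega_int_pow omega_sym[of "t n"] abs_mult mult_left_mono)
  then have "\<bar>z + w\<bar> \<le> K * (vnorm n u + \<bar>u n\<bar>) * vnorm n v"
    using z(2) by (simp add: algebra_simps)
  also have "\<dots> \<le> K * vnorm (Suc n) u * vnorm (Suc n) v"
    using K(2) by (intro mult_mono) (auto simp: vnorm_def intro!: mult_nonneg_nonneg sum_nonneg)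
  finally show ?case using eq by blast
qed

lemma s_carrier [simp]: "j < m \<Longrightarrow> s j \<in> carrier G"
  using S_eq S_carrier by auto

abbreviation P :: "ivec \<Rightarrow> 'a" where "P \<equiv> collect s m"

definition ab :: "ivec \<Rightarrow> 'a set" where "ab v = coset (P v)"

definition W :: "ivec \<Rightarrow> ivec \<Rightarrow> int" where "W u v = \<omega> (P u) (P v)"

lemma ab_closed [simp]: "ab v \<in> carrier Ab"
  by (simp add: ab_def)

lemma ab_add: "ab (u + v) = ab u \<otimes>\<^bsub>Ab\<^esub> ab v"
  by (simp add: ab_def coset_collect_add)

lemma W_add_left: "W (u + v) w = W u w + W v w"
proof -
  have "coset (P (u + v)) = coset (P u \<otimes> P v)" by (simp add: coset_mult coset_collect_add)
  then have "W (u + v) w = \<omega> (P u \<otimes> P v) (P w)" unfolding W_def by (intro omega_coset_left) auto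
  then show ?thesis by (simp add: W_def omega_mult_left)
qed

lemma W_sym: "W u v = - W v u"
  unfolding W_def by (rule omega_sym) auto

lemma W_add_right: "W u (v + w) = W u v + W u w"
  using W_add_left[of v w u] by (simp add: W_sym[of u])

lemma W_lincomb_left: "W (lincomb I a x) w = (\<Sum>i\<in>I. a i * W (x i) w)"
  by (rule additive_lincomb[OF add_subgroup_UNIV]) (auto simp: W_add_left)

lemma W_lincomb_right: "W u (lincomb I a x) = (\<Sum>i\<in>I. a i * W u (x i))"
  by (rule additive_lincomb[OF add_subgroup_UNIV]) (auto simp: W_add_right)

end

lemma finite_int_bound:
  fixes f :: "'t \<Rightarrow> int"
  assumes "finite A"
  obtains C where "C \<ge> 0" "\<And>a. a \<in> A \<Longrightarrow> f a \<le> C"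
proof -
  have "f a \<le> Max (insert 0 (f ` A))" if "a \<in> A" for a
    using assms that by (intro Max_ge) auto
  moreover have "0 \<le> Max (insert 0 (f ` A))" using assms by (intro Max_ge) auto
  ultimately show thesis using that by blast
qed

context heisenberg
begin

lemma mult_cpow_mult_cpow:
  assumes "g \<in> carrier G" "h \<in> carrier G"
  shows "(g \<otimes> cpow y) \<otimes> (h \<otimes> cpow z) = (g \<otimes> h) \<otimes> cpow (y + z)"
proof -
  have "(g \<otimes> cpow y) \<otimes> (h \<otimes> cpow z) = ((g \<otimes> cpow y) \<otimes> h) \<otimes> cpow z"
    using assms by (intro m_assoc[symmetric]) auto
  then show ?thesis using assms by (simp add: cpow_mult_left[OF assms] cpow_mult_cpow)
qed

subsection \<open>Balls\<close>

definition letters :: "'a set" where "letters = S \<union> m_inv G ` S"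

definition ball :: "nat \<Rightarrow> 'a set" where
  "ball n = {g. \<exists>ws. length ws \<le> n \<and> set ws \<subseteq> letters \<and> foldr (\<otimes>) ws \<one> = g}"

lemma letters_carrier: "letters \<subseteq> carrier G"
  using S_carrier by (auto simp: letters_def)

lemma letters_inv: "x \<in> letters \<Longrightarrow> inv x \<in> letters"
  using S_carrier by (auto simp: letters_def)

lemma finite_letters: "finite letters"
  using S_eq by (auto simp: letters_def)

lemma foldr_closed: "set ws \<subseteq> letters \<Longrightarrow> foldr (\<otimes>) ws \<one> \<in> carrier G"
  using letters_carrier by (induction ws) auto

lemma foldr_append_mult: "set ws \<subseteq> letters \<Longrightarrow> set us \<subseteq> letters \<Longrightarrow>
    foldr (\<otimes>) (ws @ us) \<one> = foldr (\<otimes>) ws \<one> \<otimes> foldr (\<otimes>) us \<one>"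
proof (induction ws)
  case (Cons a ws)
  then have "a \<in> carrier G" "foldr (\<otimes>) ws \<one> \<in> carrier G" "foldr (\<otimes>) us \<one> \<in> carrier G"
    using letters_carrier foldr_closed by auto
  with Cons show ?case by (simp add: m_assoc)
qed (simp add: foldr_closed)

lemma ball_carrier: "g \<in> ball n \<Longrightarrow> g \<in> carrier G"
  using foldr_closed by (auto simp: ball_def)

lemma ball_mono: "a \<le> b \<Longrightarrow> ball a \<subseteq> ball b"
  unfolding ball_def using order_trans by blast

lemma one_in_ball [simp]: "\<one> \<in> ball n"
  unfolding ball_def by (auto intro!: exI[of _ "[]"])

lemma letter_in_ball: "x \<in> letters \<Longrightarrow> x \<in> ball 1"
  unfolding ball_def using letters_carrier by (auto intro!: exI[of _ "[x]"])

lemma ball_mult: "g \<in> ball a \<Longrightarrow> h \<in> ball b \<Longrightarrow> g \<otimes> h \<in> ball (a + b)"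
proof -
  assume "g \<in> ball a" "h \<in> ball b"
  then obtain ws us where "length ws \<le> a" "set ws \<subseteq> letters" "foldr (\<otimes>) ws \<one> = g"
    "length us \<le> b" "set us \<subseteq> letters" "foldr (\<otimes>) us \<one> = h"
    by (auto simp: ball_def)
  then show ?thesis
    unfolding ball_def using foldr_append_mult[of ws us]
    by (intro CollectI exI[of _ "ws @ us"]) (simp del: foldr_append)
qed

lemma ball_cases:
  assumes "g \<in> ball (Suc n)"
  obtains "g = \<one>" | x h where "x \<in> letters" "h \<in> ball n" "g = x \<otimes> h"
proof -
  from assms obtain ws where ws: "length ws \<le> Suc n" "set ws \<subseteq> letters" "foldr (\<otimes>) ws \<one> = g"
    by (auto simp: ball_def)
  show thesis
  proof (cases ws)
    case Nil
    with ws that(1) show thesis by simp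
  next
    case (Cons x us)
    with ws have "foldr (\<otimes>) us \<one> \<in> ball n" by (auto simp: ball_def)
    with ws Cons that(2)[of x "foldr (\<otimes>) us \<one>"] show thesis by auto
  qed
qed

lemma ball_induct [consumes 1, case_names one mult]:
  assumes "g \<in> ball n"
    and "\<And>n. Q n \<one>"
    and "\<And>n x h. x \<in> letters \<Longrightarrow> h \<in> ball n \<Longrightarrow> Q n h \<Longrightarrow> Q (Suc n) (x \<otimes> h)"
  shows "Q n g"
  using assms(1)
proof (induction n arbitrary: g)
  case 0
  then show ?case using assms(2) by (auto simp: ball_def)
next
  case (Suc n)
  from Suc.prems show ?case by (cases rule: ball_cases) (use assms Suc.IH in auto)
qed

lemma ball_inv: "g \<in> ball n \<Longrightarrow> inv g \<in> ball n"
proof (induction rule: ball_induct)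
  case (mult n x h)
  then have "inv h \<otimes> inv x \<in> ball (n + 1)"
    by (intro ball_mult letter_in_ball letters_inv)
  moreover have "inv (x \<otimes> h) = inv h \<otimes> inv x"
    using mult letters_carrier ball_carrier by (intro inv_mult_group) auto
  ultimately show ?case by simp
qed simp

lemma ball_nat_pow: "g \<in> ball a \<Longrightarrow> g [^] (k::nat) \<in> ball (a * k)"
proof (induction k)
  case (Suc k)
  then have "g [^] k \<otimes> g \<in> ball (a * k + a)" by (intro ball_mult) auto
  then show ?case by (simp add: add.commute)
qed simp

lemma ball_int_pow:
  assumes g: "g \<in> ball a"
  shows "g [^] (k::int) \<in> ball (a * nat \<bar>k\<bar>)"
proof (cases "k < 0")
  case True
  then have "inv (g [^] nat (- k)) \<in> ball (a * nat \<bar>k\<bar>)"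
    using ball_inv[OF ball_nat_pow[OF g, of "nat (- k)"]] by simp
  with True show ?thesis unfolding int_pow_def2 by simp
next
  case False
  then have "g [^] nat k \<in> ball (a * nat \<bar>k\<bar>)"
    using ball_nat_pow[OF g, of "nat k"] by simp
  with False show ?thesis unfolding int_pow_def2 by simp
qed

lemma ball_collect:
  assumes "\<And>j. j < n \<Longrightarrow> t j \<in> ball a"
  shows "collect t n v \<in> ball (a * nat (vnorm n v))"
  using assms
proof (induction n)
  case (Suc n)
  have "collect t n v \<in> ball (a * nat (vnorm n v))"
    by (rule Suc.IH) (rule Suc.prems, simp)
  moreover have "t n [^] v n \<in> ball (a * nat \<bar>v n\<bar>)"
    by (rule ball_int_pow) (rule Suc.prems, simp)
  ultimately have "collect t n v \<otimes> t n [^] v n \<in> ball (a * nat (vnorm n v) + a * nat \<bar>v n\<bar>)"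
    by (rule ball_mult)
  moreover have "vnorm (Suc n) v = vnorm n v + \<bar>v n\<bar>" by (simp add: vnorm_def)
  ultimately show ?case
    by (simp add: nat_add_distrib distrib_left)
qed simp

lemma s_in_ball: "j < m \<Longrightarrow> s j \<in> ball 1"
  using S_eq by (intro letter_in_ball) (auto simp: letters_def)

lemma ball_P: "P v \<in> ball (nat (vnorm m v))"
  using ball_collect[of m s 1 v] s_in_ball by simp

lemma in_some_ball: "g \<in> carrier G \<Longrightarrow> \<exists>n. g \<in> ball n"
proof -
  assume "g \<in> carrier G"
  then have "g \<in> generate G S" by (simp add: generates)
  then show ?thesis
  proof (induction rule: generate.induct)
    case one
    show ?case by (intro exI[of _ 0]) simp
  next
    case (incl h)
    then show ?case by (intro exI[of _ 1] letter_in_ball) (auto simp: letters_def)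
  next
    case (inv h)
    then show ?case by (intro exI[of _ 1] letter_in_ball) (auto simp: letters_def)
  next
    case (eng h1 h2)
    then show ?case using ball_mult by blast
  qed
qed

lemma word_norm_le_iff: "g \<in> carrier G \<Longrightarrow> word_norm G S g \<le> n \<longleftrightarrow> g \<in> ball n"
proof -
  assume g: "g \<in> carrier G"
  define Q where "Q = (\<lambda>k. \<exists>ws. length ws = k \<and> set ws \<subseteq> letters \<and> foldr (\<otimes>) ws \<one> = g)"
  have eq: "word_norm G S g = (LEAST k. Q k)"
    by (simp add: word_norm_def Q_def letters_def)
  have ball: "g \<in> ball n \<longleftrightarrow> (\<exists>k\<le>n. Q k)" for n
    by (auto simp: ball_def Q_def)
  then obtain k where "Q k" using in_some_ball[OF g] by blast
  then have "Q (LEAST k. Q k)" by (rule LeastI)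
  then show ?thesis
    unfolding eq ball using Least_le[of Q] by (metis le_trans)
qed

lemma finite_ball: "finite (ball n)"
proof -
  have "ball n \<subseteq> (\<lambda>ws. foldr (\<otimes>) ws \<one>) ` {ws. set ws \<subseteq> letters \<and> length ws \<le> n}"
    by (auto simp: ball_def)
  then show ?thesis
    by (rule finite_subset) (intro finite_imageI finite_lists_length_le finite_letters)
qed

lemma collect_unit: "(\<And>j. j < n \<Longrightarrow> t j \<in> carrier G) \<Longrightarrow> i < n \<Longrightarrow>
    collect t n (\<lambda>j. if j = i then k else 0) = t i [^] k"
proof -
  have 0: "collect t l (\<lambda>j. if j = i then k else 0) = \<one>" if "l \<le> i" for l
    using that by (induction l) auto
  assume "\<And>j. j < n \<Longrightarrow> t j \<in> carrier G" "i < n"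
  then show ?thesis
  proof (induction n)
    case (Suc n)
    then show ?case using 0[of n] by (cases "i = n") auto
  qed simp
qed

lemma letter_coset: "x \<in> letters \<Longrightarrow> \<exists>v. coset x = ab v \<and> vnorm m v \<le> 1"
proof -
  have *: "\<exists>v. coset (s j [^] k) = ab v \<and> vnorm m v \<le> 1" if "j < m" "\<bar>k\<bar> \<le> 1" for j and k :: int
  proof -
    define v :: ivec where "v = (\<lambda>i. if i = j then k else 0)"
    have "ab v = coset (s j [^] k)" using that by (simp add: ab_def v_def collect_unit)
    moreover have "vnorm m v = \<bar>k\<bar>"
      using that by (simp add: vnorm_def v_def if_distrib cong: if_cong)
    ultimately show ?thesis using that by (intro exI[of _ v]) simp
  qed
  assume "x \<in> letters"
  then consider j where "j < m" "x = s j" | j where "j < m" "x = inv (s j)"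
    using S_eq unfolding letters_def by blast
  then show ?thesis
  proof cases
    case 1
    then show ?thesis using *[of j 1] by simp
  next
    case 2
    then show ?thesis using *[of j "-1"] by (simp add: int_pow_neg)
  qed
qed

lemma ab_zero: "ab 0 = \<one>\<^bsub>Ab\<^esub>"
  and ab_diff: "ab (u - v) = ab u \<otimes>\<^bsub>Ab\<^esub> inv\<^bsub>Ab\<^esub> ab v"
  and ab_smul: "ab (smul k v) = ab v [^]\<^bsub>Ab\<^esub> k"
  using ivec_hom[OF Ab.is_group add_subgroup_UNIV, of ab] by (auto simp: ab_add)

lemma ball_coset: "g \<in> ball n \<Longrightarrow> \<exists>v. coset g = ab v \<and> vnorm m v \<le> int n"
proof (induction rule: ball_induct)
  case (one n)
  have "vnorm m 0 = 0" by (simp add: vnorm_def vec_apply)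
  then show ?case using ab_zero by (intro exI[of _ 0]) simp
next
  case (mult n x h)
  obtain u where "coset x = ab u" "vnorm m u \<le> 1" using letter_coset[OF mult(1)] by blast
  moreover obtain v where "coset h = ab v" "vnorm m v \<le> int n" using mult by blast
  moreover have "x \<in> carrier G" "h \<in> carrier G" using mult letters_carrier ball_carrier by auto
  ultimately show ?case
    using vnorm_add[of m u v] by (intro exI[of _ "u + v"]) (simp add: ab_add coset_mult)
qed

lemma ab_surj: "g \<in> carrier G \<Longrightarrow> \<exists>v. coset g = ab v"
  using in_some_ball ball_coset by blast

lemma omega_ball_bound:
  obtains C where "C \<ge> 0" "\<And>n g x. g \<in> ball n \<Longrightarrow> x \<in> letters \<Longrightarrow> \<bar>\<omega> g x\<bar> \<le> C * int n"
proof -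
  obtain C where "C \<ge> 0" and C: "\<And>q. q \<in> letters \<times> letters \<Longrightarrow> \<bar>\<omega> (fst q) (snd q)\<bar> \<le> C"
    using finite_int_bound[of "letters \<times> letters" "\<lambda>q. \<bar>\<omega> (fst q) (snd q)\<bar>"] finite_letters by blast
  have "\<bar>\<omega> g x\<bar> \<le> C * int n" if "g \<in> ball n" "x \<in> letters" for g x n
    using that(1)
  proof (induction rule: ball_induct)
    case (one n)
    show ?case using omega_cpow_left[of x 0] that(2) letters_carrier \<open>C \<ge> 0\<close> by auto
  next
    case (mult n y h)
    have "\<bar>\<omega> y x\<bar> \<le> C" using C[of "(y, x)"] mult that(2) by simp
    moreover have "y \<in> carrier G" "h \<in> carrier G" "x \<in> carrier G"
      using mult letters_carrier ball_carrier that(2) by auto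
    ultimately show ?case using mult by (simp add: omega_mult_left algebra_simps)
  qed
  with \<open>C \<ge> 0\<close> show thesis using that by blast
qed

lemma mult_nat_pow:
  "\<exists>k::int. k \<ge> 0 \<and> (\<forall>g\<in>carrier G. \<forall>h\<in>carrier G.
    (g \<otimes> h) [^] (n::nat) = g [^] n \<otimes> h [^] n \<otimes> cpow (k * \<omega> h g))"
proof (induction n)
  case 0
  show ?case by (intro exI[of _ 0]) auto
next
  case (Suc n)
  then obtain k :: int where k: "k \<ge> 0" "\<And>g h. g \<in> carrier G \<Longrightarrow> h \<in> carrier G \<Longrightarrow>
      (g \<otimes> h) [^] n = g [^] n \<otimes> h [^] n \<otimes> cpow (k * \<omega> h g)" by blast
  have "(g \<otimes> h) [^] Suc n = g [^] Suc n \<otimes> h [^] Suc n \<otimes> cpow ((k + int n) * \<omega> h g)"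
    if gh: "g \<in> carrier G" "h \<in> carrier G" for g h
  proof -
    have w: "\<omega> (h [^] n) g = int n * \<omega> h g"
      using gh omega_int_pow[of h g "int n"] by (simp add: int_pow_int)
    have "(g \<otimes> h) [^] Suc n = (g [^] n \<otimes> h [^] n) \<otimes> (g \<otimes> h) \<otimes> cpow (k * \<omega> h g)"
      using gh k(2)[OF gh] by (simp add: m_assoc cpow_commute)
    also have "(g [^] n \<otimes> h [^] n) \<otimes> (g \<otimes> h) = g [^] n \<otimes> (h [^] n \<otimes> g) \<otimes> h"
      using gh by (simp add: m_assoc)
    also have "h [^] n \<otimes> g = g \<otimes> h [^] n \<otimes> cpow (int n * \<omega> h g)"
      using gh omega[of "h [^] n" g] by (simp add: w)
    also have "g [^] n \<otimes> (g \<otimes> h [^] n \<otimes> cpow (int n * \<omega> h g)) \<otimes> h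
        = (g [^] n \<otimes> g) \<otimes> (h [^] n \<otimes> h) \<otimes> cpow (int n * \<omega> h g)"
      using gh by (simp add: m_assoc cpow_commute)
    finally show ?thesis
      using gh by (simp add: cpow_mult_cpow distrib_right add.commute)
  qed
  with k(1) show ?case by (intro exI[of _ "k + int n"]) auto
qed

definition LV :: "ivec set" where "LV = {v. ab v = \<one>\<^bsub>Ab\<^esub>}"

lemma LV_subgroup: "add_subgroup LV"
  by (auto simp: LV_def add_subgroup_def ab_zero ab_diff)

lemma LV_bound: "(\<forall>j<m. v j = 0) \<Longrightarrow> v \<in> LV"
proof -
  have "collect s n v = \<one>" if "\<forall>j<n. v j = 0" for n v using that by (induction n) auto
  then show "(\<forall>j<m. v j = 0) \<Longrightarrow> ?thesis" by (simp add: LV_def ab_def)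
qed

lemma ab_eq_iff: "ab u = ab v \<longleftrightarrow> u - v \<in> LV"
proof
  assume "u - v \<in> LV"
  then have "ab ((u - v) + v) = ab v" unfolding ab_add by (simp add: LV_def)
  then show "ab u = ab v" by simp
next
  assume "ab u = ab v"
  then show "u - v \<in> LV" by (simp add: LV_def ab_diff)
qed

lemma coset_collect_lincomb:
  "coset (collect (\<lambda>i. P (x i)) p a) = ab (lincomb {..<p} a x)"
proof (induction p)
  case 0
  then show ?case by (simp add: lincomb_def ab_zero)
next
  case (Suc p)
  have "lincomb {..<Suc p} a x = lincomb {..<p} a x + smul (a p) (x p)"
    by (simp add: lincomb_def)
  with Suc show ?case
    by (simp add: coset_mult coset_int_pow ab_add ab_smul) (simp add: ab_def)
qed

text \<open>Quadratic distortion of the derived subgroup. A fixed power of every element has coordinates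
  with respect to a rational basis of the abelianization; these are unique, unlike the exponents of
  the generators.\<close>

lemma center_distortion:
  obtains C where "C \<ge> 1" "\<And>n z. cpow z \<in> ball n \<Longrightarrow> \<bar>z\<bar> \<le> C * int n ^ 2"
proof -
  obtain p and x :: "nat \<Rightarrow> ivec" where x: "rational_basis LV UNIV {..<p} x"
    using rational_basis_exists[OF LV_subgroup LV_bound add_subgroup_UNIV] by blast
  then have ind: "indep_mod LV {..<p} x" and sp: "spans_mod LV UNIV {..<p} x"
    by (auto simp: rational_basis_def)
  define t where "t = (\<lambda>i. P (x i))"
  have t: "t i \<in> carrier G" for i by (simp add: t_def)
  have "\<exists>v. \<forall>y\<in>letters. coset y = ab (v y)" using letter_coset by metis
  then obtain v where v: "\<And>y. y \<in> letters \<Longrightarrow> coset y = ab (v y)" by blast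
  obtain N0 A where N0: "N0 > 0"
    and A: "\<And>y. y \<in> letters \<Longrightarrow> smul N0 (v y) - lincomb {..<p} (A y) x \<in> LV"
    using spans_mod_common[OF LV_subgroup sp finite_letters, of v] by auto
  define N where "N = nat N0"
  have N: "N > 0" "N0 = int N" using N0 by (auto simp: N_def)
  have "\<exists>z. y [^] N = collect t p (A y) \<otimes> cpow z" if y: "y \<in> letters" for y
  proof -
    have yc: "y \<in> carrier G" using y letters_carrier by auto
    have "coset (collect t p (A y)) = ab (smul N0 (v y))"
      unfolding t_def coset_collect_lincomb using A[OF y] by (simp add: ab_eq_iff[symmetric])
    also have "\<dots> = coset (y [^] N)"
      using yc by (simp add: ab_smul v[OF y, symmetric] coset_int_pow[symmetric] N(2)) (simp add: int_pow_int)
    finally show ?thesis using yc t by (subst (asm) coset_eq_iff) auto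
  qed
  then obtain zl where zl: "\<And>y. y \<in> letters \<Longrightarrow> y [^] N = collect t p (A y) \<otimes> cpow (zl y)"
    by metis
  obtain C0 where C0: "C0 \<ge> 0" "\<And>n g x. g \<in> ball n \<Longrightarrow> x \<in> letters \<Longrightarrow> \<bar>\<omega> g x\<bar> \<le> C0 * int n"
    using omega_ball_bound by blast
  obtain k :: int where k: "k \<ge> 0" "\<And>g h. g \<in> carrier G \<Longrightarrow> h \<in> carrier G \<Longrightarrow>
      (g \<otimes> h) [^] N = g [^] N \<otimes> h [^] N \<otimes> cpow (k * \<omega> h g)"
    using mult_nat_pow[of N] by blast
  obtain C1 where C10: "C1 \<ge> 0" and C1: "\<And>y. y \<in> letters \<Longrightarrow> vnorm p (A y) + \<bar>zl y\<bar> \<le> C1"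
    using finite_int_bound[of letters "\<lambda>y. vnorm p (A y) + \<bar>zl y\<bar>"] finite_letters by blast
  obtain K where K0: "K \<ge> 0"
    and K': "\<And>q. q \<in> {..<p} \<times> {..<p} \<Longrightarrow> \<bar>\<omega> (t (fst q)) (t (snd q))\<bar> \<le> K"
    using finite_int_bound[of "{..<p} \<times> {..<p}" "\<lambda>q. \<bar>\<omega> (t (fst q)) (t (snd q))\<bar>"] by blast
  have K: "\<bar>\<omega> (t i) (t j)\<bar> \<le> K" if "i < p" "j < p" for i j
    using K'[of "(i, j)"] that by simp
  define D where "D = K * C1 * C1 + C1 + k * C0"
  have D0: "D \<ge> 0" using K0 C10 k(1) C0(1) by (auto simp: D_def)
  have main: "\<exists>a z. g [^] N = collect t p a \<otimes> cpow z \<and> vnorm p a \<le> C1 * int n \<and> \<bar>z\<bar> \<le> D * int n ^ 2"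
    if "g \<in> ball n" for g n
    using that
  proof (induction rule: ball_induct)
    case (one n)
    have "collect t p 0 = \<one>" by (induction p) (auto simp: vec_apply)
    moreover have "vnorm p 0 = 0" by (simp add: vnorm_def vec_apply)
    ultimately show ?case
      using C10 D0 by (intro exI[of _ "0::ivec"] exI[of _ "0::int"]) simp
  next
    case (mult n y h)
    then obtain a z where az: "h [^] N = collect t p a \<otimes> cpow z" "vnorm p a \<le> C1 * int n"
      "\<bar>z\<bar> \<le> D * int n ^ 2" by blast
    have cl: "y \<in> carrier G" "h \<in> carrier G" using mult(1,2) letters_carrier ball_carrier by auto
    have clt: "collect t p b \<in> carrier G" for b by (simp add: t)
    obtain q where q: "collect t p (A y) \<otimes> collect t p a = collect t p (A y + a) \<otimes> cpow q"
      "\<bar>q\<bar> \<le> K * vnorm p (A y) * vnorm p a"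
      using collect_mult[of p t K "A y" a] t K K0 by auto
    have "(y \<otimes> h) [^] N = (collect t p (A y) \<otimes> cpow (zl y)) \<otimes> (collect t p a \<otimes> cpow z)
        \<otimes> cpow (k * \<omega> h y)"
      using k(2)[OF cl] zl[OF mult(1)] az(1) by simp
    also have "\<dots> = (collect t p (A y) \<otimes> collect t p a) \<otimes> cpow (zl y + z + k * \<omega> h y)"
      using clt by (simp add: mult_cpow_mult_cpow cpow_mult_cpow)
    also have "\<dots> = collect t p (A y + a) \<otimes> cpow (q + (zl y + z + k * \<omega> h y))"
      unfolding q(1) using clt by (simp add: cpow_mult_cpow)
    finally have 1: "(y \<otimes> h) [^] N = collect t p (A y + a) \<otimes> cpow (q + (zl y + z + k * \<omega> h y))" .
    note Cy = C1[OF mult(1)]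
    have 2: "vnorm p (A y + a) \<le> C1 * int (Suc n)"
      using vnorm_add[of p "A y" a] Cy az(2) by (simp add: distrib_left)
    have "\<bar>q\<bar> \<le> K * C1 * (C1 * int n)"
      using q(2) Cy az(2) K0 C10 by (elim order_trans) (intro mult_mono, auto)
    moreover have "\<bar>zl y\<bar> \<le> C1" using Cy by (smt (verit) vnorm_nonneg)
    moreover have "\<bar>k * \<omega> h y\<bar> \<le> k * (C0 * int n)"
      unfolding abs_mult using C0(2)[OF mult(2,1)] k(1) by (intro mult_mono) auto
    ultimately have "\<bar>q + (zl y + z + k * \<omega> h y)\<bar> \<le> K * C1 * (C1 * int n) + C1 + k * (C0 * int n) + D * int n ^ 2"
      using az(3) by linarith
    also have "\<dots> \<le> D * int (Suc n) ^ 2"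
    proof -
      have "K * C1 * (C1 * int n) \<le> K * C1 * C1 * (2 * int n + 1)"
        using K0 C10 by (simp add: algebra_simps)
      moreover have "C1 \<le> C1 * (2 * int n + 1)" using C10 by (simp add: algebra_simps)
      moreover have "k * (C0 * int n) \<le> k * C0 * (2 * int n + 1)"
        using k(1) C0(1) by (simp add: algebra_simps)
      ultimately have "K * C1 * (C1 * int n) + C1 + k * (C0 * int n) \<le> D * (2 * int n + 1)"
        unfolding D_def distrib_right by linarith
      moreover have "D * int (Suc n) ^ 2 = D * int n ^ 2 + D * (2 * int n + 1)"
        by (simp add: power2_eq_square algebra_simps)
      ultimately show ?thesis by linarith
    qed
    finally show ?case using 1 2 by blast
  qed
  have "\<bar>z\<bar> \<le> (D + 1) * int n ^ 2" if z: "cpow z \<in> ball n" for z n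
  proof -
    obtain a y where ay: "cpow z [^] N = collect t p a \<otimes> cpow y" "\<bar>y\<bar> \<le> D * int n ^ 2"
      using main[OF z] by blast
    have zN: "cpow z [^] N = cpow (z * int N)"
      using int_pow_pow[of c z "int N"] by (simp add: int_pow_int)
    have "coset (collect t p a) = coset (collect t p a \<otimes> cpow y)" using t by (simp add: coset_cpow)
    also have "\<dots> = coset (\<one> \<otimes> cpow (z * int N))"
      unfolding ay(1)[symmetric] zN by simp
    also have "\<dots> = \<one>\<^bsub>Ab\<^esub>" by (subst coset_cpow) auto
    finally have "lincomb {..<p} a x \<in> LV" by (simp add: t_def coset_collect_lincomb LV_def)
    then have "\<forall>i<p. a i = 0" using ind by (auto simp: indep_mod_def)
    moreover have "collect t q a = \<one>" if "\<forall>i<q. a i = 0" for q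
      using that by (induction q) auto
    ultimately have "collect t p a = \<one>" by blast
    with ay(1) zN have "cpow (z * int N) = cpow y" by simp
    then have "y = z * int N" using c_inj by blast
    then have "\<bar>y\<bar> = \<bar>z\<bar> * int N" by (simp add: abs_mult)
    moreover have "\<bar>z\<bar> * 1 \<le> \<bar>z\<bar> * int N" using N by (intro mult_left_mono) auto
    moreover have "(D + 1) * int n ^ 2 = D * int n ^ 2 + int n ^ 2" by (simp add: distrib_right)
    moreover have "int n ^ 2 \<ge> 0" by simp
    ultimately show ?thesis using ay(2) by linarith
  qed
  with D0 show thesis by (intro that[of "D + 1"]) auto
qed

subsection \<open>Twisted conjugacy\<close>

lemma psi_hom: "group_hom G G \<psi>"
  using psi_iso by (auto simp: group_hom_def group_hom_axioms_def iso_def is_group)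

lemma psi_closed [simp]: "g \<in> carrier G \<Longrightarrow> \<psi> g \<in> carrier G"
  by (rule group_hom.hom_closed[OF psi_hom])

lemma psi_mult: "g \<in> carrier G \<Longrightarrow> h \<in> carrier G \<Longrightarrow> \<psi> (g \<otimes> h) = \<psi> g \<otimes> \<psi> h"
  by (rule group_hom.hom_mult[OF psi_hom])

lemma psi_inv: "g \<in> carrier G \<Longrightarrow> \<psi> (inv g) = inv (\<psi> g)"
  by (rule group_hom.hom_inv[OF psi_hom])

lemma psi_one: "\<psi> \<one> = \<one>"
  by (rule group_hom.hom_one[OF psi_hom])

lemma psi_ball_bound: obtains C where "\<And>n g. g \<in> ball n \<Longrightarrow> \<psi> g \<in> ball (C * n)"
proof -
  have "\<forall>x\<in>letters. \<exists>n. \<psi> x \<in> ball n" using in_some_ball letters_carrier by auto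
  then obtain f where f: "\<And>x. x \<in> letters \<Longrightarrow> \<psi> x \<in> ball (f x)" by metis
  define C where "C = Max (insert 0 (f ` letters))"
  have le: "f x \<le> C" if "x \<in> letters" for x
    unfolding C_def using that finite_letters by (intro Max_ge) auto
  have "\<psi> g \<in> ball (C * n)" if "g \<in> ball n" for n g
    using that
  proof (induction rule: ball_induct)
    case (one n)
    show ?case by (simp add: psi_one)
  next
    case (mult n x h)
    have cl: "x \<in> carrier G" "h \<in> carrier G" using mult(1,2) letters_carrier ball_carrier by auto
    have "\<psi> x \<in> ball C" using f[OF mult(1)] ball_mono[OF le[OF mult(1)]] by blast
    from ball_mult[OF this mult(3)] show ?case by (simp add: psi_mult cl)
  qed
  then show thesis by (rule that)
qed

definition \<epsilon> :: int where "\<epsilon> = (THE e. \<psi> c = cpow e)"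

lemma psi_int_pow: "g \<in> carrier G \<Longrightarrow> \<psi> (g [^] (k::int)) = \<psi> g [^] k"
  by (rule group_hom.hom_int_pow[OF psi_hom])

lemma psi_c: "\<psi> c = cpow \<epsilon>" and eps_cases: "\<epsilon> = 1 \<or> \<epsilon> = -1"
proof -
  let ?D = "derived G (carrier G)"
  have "\<psi> ` carrier G = carrier G" using psi_iso by (simp add: iso_def bij_betw_def)
  then have D: "\<psi> ` ?D = ?D" using group_hom.derived_img[OF psi_hom, of "carrier G"] by simp
  have cD: "c \<in> ?D" unfolding derived_eq by (rule range_eqI[of _ _ 1]) simp
  then have "\<psi> c \<in> ?D" using D by blast
  then obtain e where e: "\<psi> c = cpow e" by (auto simp: derived_eq)
  then have eps: "\<epsilon> = e" unfolding \<epsilon>_def using c_inj by auto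
  from cD D obtain d where "d \<in> ?D" "c = \<psi> d" by blast
  from \<open>d \<in> ?D\<close> obtain f where "d = cpow f" unfolding derived_eq by blast
  with \<open>c = \<psi> d\<close> have "c = \<psi> (cpow f)" by simp
  then have "cpow 1 = cpow (e * f)" by (simp add: psi_int_pow e int_pow_pow)
  then have "e * f = 1" using c_inj by simp
  then show "\<psi> c = cpow \<epsilon>" "\<epsilon> = 1 \<or> \<epsilon> = -1" using e eps by (auto simp: zmult_eq_1_iff)
qed

lemma psi_cpow: "\<psi> (cpow z) = cpow (\<epsilon> * z)"
  by (simp add: psi_int_pow psi_c int_pow_pow)

lemma coset_psi_cong:
  assumes "g \<in> carrier G" "h \<in> carrier G" "coset g = coset h"
  shows "coset (\<psi> g) = coset (\<psi> h)"
proof -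
  obtain z where "h = g \<otimes> cpow z" using assms by (auto simp: coset_eq_iff)
  then show ?thesis using assms by (simp add: psi_mult psi_cpow coset_cpow)
qed

lemma coset_cpow_one: "coset (cpow z) = \<one>\<^bsub>Ab\<^esub>"
  using coset_cpow[of \<one> z] by simp

lemma omega_psi:
  assumes "g \<in> carrier G" "x \<in> carrier G"
  shows "\<omega> (\<psi> g) (\<psi> x) = \<epsilon> * \<omega> g x"
proof (rule omega_eqI)
  have "\<psi> (g \<otimes> x) = \<psi> (x \<otimes> g \<otimes> cpow (\<omega> g x))" using omega[OF assms] by simp
  then show "\<psi> g \<otimes> \<psi> x = \<psi> x \<otimes> \<psi> g \<otimes> cpow (\<epsilon> * \<omega> g x)"
    using assms by (simp add: psi_mult psi_cpow)
qed (use assms in auto)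

definition fixed :: "'a \<Rightarrow> bool" where
  "fixed g \<longleftrightarrow> g \<in> carrier G \<and> coset (\<psi> g) = coset g"

definition \<tau> :: "'a \<Rightarrow> int" where
  "\<tau> g = (THE t. g = \<psi> g \<otimes> cpow t)"

lemma fixed_tauI:
  assumes "g \<in> carrier G" "g = \<psi> g \<otimes> cpow t"
  shows "fixed g" and "\<tau> g = t"
proof -
  show "fixed g" using assms by (auto simp: fixed_def coset_eq_iff)
  have "y = t" if "g = \<psi> g \<otimes> cpow y" for y
  proof -
    have "\<psi> g \<otimes> cpow y = \<psi> g \<otimes> cpow t" using that assms(2) by metis
    then show ?thesis using assms(1) mult_cpow_cancel by simp
  qed
  with assms(2) show "\<tau> g = t" unfolding \<tau>_def by (intro the_equality)
qed

lemma tau: "fixed g \<Longrightarrow> g = \<psi> g \<otimes> cpow (\<tau> g)"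
proof -
  assume g: "fixed g"
  then have gc: "g \<in> carrier G" by (simp add: fixed_def)
  obtain t where t: "g = \<psi> g \<otimes> cpow t" using g gc by (auto simp: fixed_def coset_eq_iff)
  from fixed_tauI(2)[OF gc t] show ?thesis using t by simp
qed

lemma fixed_carrier: "fixed g \<Longrightarrow> g \<in> carrier G"
  by (simp add: fixed_def)

lemma tau_mult_cpow:
  assumes g: "fixed g"
  shows "fixed (g \<otimes> cpow t)" and "\<tau> (g \<otimes> cpow t) = \<tau> g + (1 - \<epsilon>) * t"
proof -
  have cl: "g \<in> carrier G" using assms fixed_carrier by auto
  have "g \<otimes> cpow t = (\<psi> g \<otimes> cpow (\<tau> g)) \<otimes> cpow t" using tau[OF g] by simp
  also have "\<dots> = (\<psi> g \<otimes> cpow (\<epsilon> * t)) \<otimes> cpow (\<tau> g + (1 - \<epsilon>) * t)"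
    using cl by (simp add: cpow_mult_cpow algebra_simps)
  also have "\<psi> g \<otimes> cpow (\<epsilon> * t) = \<psi> (g \<otimes> cpow t)" using cl by (simp add: psi_mult psi_cpow)
  finally have "g \<otimes> cpow t = \<psi> (g \<otimes> cpow t) \<otimes> cpow (\<tau> g + (1 - \<epsilon>) * t)" .
  with fixed_tauI[of "g \<otimes> cpow t"] cl
  show "fixed (g \<otimes> cpow t)" "\<tau> (g \<otimes> cpow t) = \<tau> g + (1 - \<epsilon>) * t" by auto
qed

abbreviation tconj :: "'a \<Rightarrow> 'a \<Rightarrow> bool" where "tconj \<equiv> twisted_conj G \<psi>"

abbreviation tclass :: "'a \<Rightarrow> 'a set" where "tclass \<equiv> twisted_class G \<psi>"

lemma tconj_refl: "x \<in> carrier G \<Longrightarrow> tconj x x"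
  unfolding twisted_conj_def by (intro bexI[of _ \<one>]) (auto simp: psi_one)

lemma tconj_trans:
  assumes "tconj x y" "tconj y z" "x \<in> carrier G"
  shows "tconj x z"
proof -
  obtain g h where gh: "g \<in> carrier G" "g \<otimes> x \<otimes> inv (\<psi> g) = y" "h \<in> carrier G" "h \<otimes> y \<otimes> inv (\<psi> h) = z"
    using assms by (auto simp: twisted_conj_def)
  have "(h \<otimes> g) \<otimes> x \<otimes> inv (\<psi> (h \<otimes> g)) = h \<otimes> (g \<otimes> x \<otimes> inv (\<psi> g)) \<otimes> inv (\<psi> h)"
    using gh(1,3) assms(3) by (simp add: psi_mult inv_mult_group m_assoc)
  also have "\<dots> = z" using gh by simp
  finally show ?thesis unfolding twisted_conj_def using gh(1,3) by blast
qed

lemma tconj_sym: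
  assumes "tconj x y" "x \<in> carrier G"
  shows "tconj y x"
proof -
  obtain g where g: "g \<in> carrier G" "y = g \<otimes> x \<otimes> inv (\<psi> g)"
    using assms by (auto simp: twisted_conj_def)
  have "inv g \<otimes> (g \<otimes> a) = a" if "a \<in> carrier G" for a
    using g(1) that by (simp add: m_assoc[symmetric])
  then have "inv g \<otimes> y \<otimes> inv (\<psi> (inv g)) = x"
    unfolding g(2) using g(1) assms(2) by (simp add: psi_inv m_assoc)
  then show ?thesis unfolding twisted_conj_def using g(1) by (intro bexI[of _ "inv g"]) auto
qed

lemma tclass_eq_iff:
  assumes "x \<in> carrier G" "y \<in> carrier G"
  shows "tclass x = tclass y \<longleftrightarrow> tconj x y"
proof
  assume "tclass x = tclass y"
  moreover have "y \<in> tclass y" using assms tconj_refl by (simp add: twisted_class_def)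
  ultimately have "y \<in> tclass x" by simp
  then show "tconj x y" by (simp add: twisted_class_def)
next
  assume xy: "tconj x y"
  have yx: "tconj y x" using tconj_sym[OF xy assms(1)] .
  show "tclass x = tclass y"
    unfolding twisted_class_def
    using tconj_trans[OF xy _ assms(1)] tconj_trans[OF yx _ assms(2)] by blast
qed

lemma tconj_cpow_iff:
  assumes x: "x \<in> carrier G"
  shows "tconj x (x \<otimes> cpow z) \<longleftrightarrow> (\<exists>g. fixed g \<and> z = \<tau> g + \<omega> g x)"
proof -
  have key: "g \<otimes> x \<otimes> inv (\<psi> g) = x \<otimes> cpow z \<longleftrightarrow> g = \<psi> g \<otimes> cpow (z - \<omega> g x)"
    if g: "g \<in> carrier G" for g
  proof -
    have "g \<otimes> x = x \<otimes> (g \<otimes> cpow (\<omega> g x))"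
      using omega[OF g x] x g by (simp add: m_assoc)
    then have "g \<otimes> x \<otimes> inv (\<psi> g) = x \<otimes> cpow z \<longleftrightarrow> x \<otimes> (g \<otimes> cpow (\<omega> g x)) = x \<otimes> cpow z \<otimes> \<psi> g"
      using x g by (metis inv_solve_right int_pow_closed m_closed psi_closed c_carrier)
    also have "x \<otimes> cpow z \<otimes> \<psi> g = x \<otimes> (\<psi> g \<otimes> cpow z)"
      using x g by (simp add: m_assoc cpow_commute)
    also have "x \<otimes> (g \<otimes> cpow (\<omega> g x)) = x \<otimes> (\<psi> g \<otimes> cpow z) \<longleftrightarrow> g \<otimes> cpow (\<omega> g x) = \<psi> g \<otimes> cpow z"
      using x g by simp
    also have "\<dots> \<longleftrightarrow> g = \<psi> g \<otimes> cpow (z - \<omega> g x)"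
      by (rule mult_cpow_shift) (use g in auto)
    finally show ?thesis .
  qed
  show ?thesis
  proof
    assume "tconj x (x \<otimes> cpow z)"
    then obtain g where g: "g \<in> carrier G" "g = \<psi> g \<otimes> cpow (z - \<omega> g x)"
      unfolding twisted_conj_def using key by blast
    from fixed_tauI[OF this] show "\<exists>g. fixed g \<and> z = \<tau> g + \<omega> g x" by (intro exI[of _ g]) simp
  next
    assume "\<exists>g. fixed g \<and> z = \<tau> g + \<omega> g x"
    then obtain g where g: "fixed g" "z = \<tau> g + \<omega> g x" by blast
    with key[of g] tau[of g] have "g \<otimes> x \<otimes> inv (\<psi> g) = x \<otimes> cpow z"
      by (simp add: fixed_carrier)
    then show "tconj x (x \<otimes> cpow z)" unfolding twisted_conj_def using g fixed_carrier by blast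
  qed
qed

definition periods :: "'a \<Rightarrow> int set" where "periods x = {z. tconj x (x \<otimes> cpow z)}"

lemma tconj_mult_cpow:
  assumes "x \<in> carrier G" "y \<in> carrier G"
  shows "tconj (x \<otimes> cpow z) (y \<otimes> cpow z) \<longleftrightarrow> tconj x y"
proof -
  have "g \<otimes> (x \<otimes> cpow z) \<otimes> inv (\<psi> g) = (g \<otimes> x \<otimes> inv (\<psi> g)) \<otimes> cpow z" if "g \<in> carrier G" for g
    using that assms by (simp add: m_assoc cpow_commute)
  then show ?thesis
    unfolding twisted_conj_def using assms by (metis inv_closed m_closed psi_closed r_cancel int_pow_closed c_carrier)
qed

lemma tclass_cpow_iff:
  assumes "x \<in> carrier G"
  shows "tclass (x \<otimes> cpow y) = tclass (x \<otimes> cpow z) \<longleftrightarrow> z - y \<in> periods x"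
proof -
  have "x \<otimes> cpow z = x \<otimes> cpow (z - y) \<otimes> cpow y" using assms by (simp add: cpow_mult_cpow)
  then show ?thesis
    using tconj_mult_cpow[of x "x \<otimes> cpow (z - y)" y] assms
    by (simp add: tclass_eq_iff periods_def)
qed

lemma periods_zero: "x \<in> carrier G \<Longrightarrow> 0 \<in> periods x"
  by (simp add: periods_def tconj_refl)

lemma periods_diff:
  assumes x: "x \<in> carrier G" and "y \<in> periods x" "z \<in> periods x"
  shows "y - z \<in> periods x"
proof -
  have "tclass (x \<otimes> cpow 0) = tclass (x \<otimes> cpow y)" "tclass (x \<otimes> cpow 0) = tclass (x \<otimes> cpow z)"
    unfolding tclass_cpow_iff[OF x] using assms by auto
  then have "tclass (x \<otimes> cpow z) = tclass (x \<otimes> cpow y)" by simp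
  then show ?thesis unfolding tclass_cpow_iff[OF x] .
qed

lemma periods_mult:
  assumes x: "x \<in> carrier G" and z: "z \<in> periods x"
  shows "k * z \<in> periods x"
proof -
  have m: "- y \<in> periods x" if "y \<in> periods x" for y
    using periods_diff[OF x periods_zero[OF x] that] by simp
  have n: "int n * z \<in> periods x" for n
  proof (induction n)
    case (Suc n)
    from periods_diff[OF x z m[OF Suc]] show ?case by (simp add: algebra_simps)
  qed (simp add: periods_zero x)
  show ?thesis using n[of "nat k"] m[OF n[of "nat (- k)"]] by (cases "k \<ge> 0") auto
qed

lemma periods_gcd:
  assumes x: "x \<in> carrier G" and "y \<in> periods x" "z \<in> periods x"
  shows "gcd y z \<in> periods x"
proof -
  obtain a b where "a * y + b * z = gcd y z" using bezout_int by blast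
  moreover have "a * y - (- b) * z \<in> periods x"
    by (intro periods_diff periods_mult assms)
  ultimately show ?thesis by simp
qed

lemma card_tclass_le:
  assumes x: "x \<in> carrier G" and d: "d \<in> periods x" and Z: "Z \<ge> 0"
  shows "real (card ((\<lambda>z. tclass (x \<otimes> cpow z)) ` {-Z..Z})) \<le> (if d = 0 then 2 * of_int Z + 1 else of_int \<bar>d\<bar>)"
proof (cases "d = 0")
  case True
  have "card ((\<lambda>z. tclass (x \<otimes> cpow z)) ` {-Z..Z}) \<le> card {-Z..Z}" by (rule card_image_le) simp
  then show ?thesis using True Z by simp
next
  case False
  have "(\<lambda>z. tclass (x \<otimes> cpow z)) ` {-Z..Z} \<subseteq> (\<lambda>z. tclass (x \<otimes> cpow z)) ` {0..<\<bar>d\<bar>}"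
  proof (rule image_subsetI)
    fix z
    have "z mod \<bar>d\<bar> - z = (- (sgn d * (z div \<bar>d\<bar>))) * d"
      by (simp add: minus_div_mult_eq_mod[symmetric] abs_sgn algebra_simps)
    then have "z mod \<bar>d\<bar> - z \<in> periods x" using periods_mult[OF x d] by metis
    then have "tclass (x \<otimes> cpow z) = tclass (x \<otimes> cpow (z mod \<bar>d\<bar>))"
      using tclass_cpow_iff[OF x] by blast
    moreover have "z mod \<bar>d\<bar> \<in> {0..<\<bar>d\<bar>}" using False by auto
    ultimately show "tclass (x \<otimes> cpow z) \<in> (\<lambda>z. tclass (x \<otimes> cpow z)) ` {0..<\<bar>d\<bar>}" by blast
  qed
  then have "card ((\<lambda>z. tclass (x \<otimes> cpow z)) ` {-Z..Z}) \<le> card {0..<\<bar>d\<bar>}"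
    by (rule surj_card_le[rotated]) simp
  then have "real (card ((\<lambda>z. tclass (x \<otimes> cpow z)) ` {-Z..Z})) \<le> real (nat \<bar>d\<bar>)" by simp
  then show ?thesis using False by simp
qed

lemma card_tclass_ge:
  assumes x: "x \<in> carrier G" and D: "\<And>z. z \<in> periods x \<Longrightarrow> d dvd \<Delta> * z" and "\<Delta> \<noteq> 0" "w \<noteq> 0"
    and E: "E \<ge> 1" "\<bar>\<Delta> * w\<bar> \<le> E" "\<bar>d\<bar> \<le> E * Z" and Z: "Z \<ge> 0"
  shows "real (card ((\<lambda>z. tclass (x \<otimes> cpow (w * z))) ` {0..Z})) \<ge>
    (if d = 0 then of_int Z else of_int \<bar>d\<bar>) / of_int E"
proof -
  have inj: "inj_on (\<lambda>z. tclass (x \<otimes> cpow (w * z))) {0..Y}"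
    if Y: "d = 0 \<or> \<bar>\<Delta> * w\<bar> * Y < \<bar>d\<bar>" for Y
  proof (rule inj_onI)
    fix a b assume ab: "a \<in> {0..Y}" "b \<in> {0..Y}"
      "tclass (x \<otimes> cpow (w * a)) = tclass (x \<otimes> cpow (w * b))"
    then have "d dvd \<Delta> * (w * b - w * a)" using D by (simp add: tclass_cpow_iff[OF x])
    then have dvd: "d dvd (\<Delta> * w) * (b - a)" by (simp add: algebra_simps)
    have "(\<Delta> * w) * (b - a) = 0"
    proof (rule ccontr)
      assume nz: "(\<Delta> * w) * (b - a) \<noteq> 0"
      with dvd have "\<bar>d\<bar> \<le> \<bar>(\<Delta> * w) * (b - a)\<bar>" by (metis dvd_imp_le_int)
      also have "\<dots> \<le> \<bar>\<Delta> * w\<bar> * Y" unfolding abs_mult[of "\<Delta> * w"] using ab by (intro mult_left_mono) auto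
      finally show False using Y nz dvd by auto
    qed
    then show "a = b" using \<open>\<Delta> \<noteq> 0\<close> \<open>w \<noteq> 0\<close> by simp
  qed
  define Y where "Y = (if d = 0 then Z else min Z ((\<bar>d\<bar> - 1) div \<bar>\<Delta> * w\<bar>))"
  have dw: "\<bar>\<Delta> * w\<bar> \<ge> 1" using \<open>\<Delta> \<noteq> 0\<close> \<open>w \<noteq> 0\<close> by (metis abs_ge_zero mult_eq_0_iff int_one_le_iff_zero_less zero_less_abs_iff)
  have Y0: "Y \<ge> 0"
  proof (cases "d = 0")
    case False
    then have "0 \<le> (\<bar>d\<bar> - 1) div \<bar>\<Delta> * w\<bar>" using dw by (subst pos_imp_zdiv_nonneg_iff) linarith+
    then show ?thesis using Z unfolding Y_def by simp
  qed (use Z in \<open>simp add: Y_def\<close>)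
  have "d = 0 \<or> \<bar>\<Delta> * w\<bar> * Y < \<bar>d\<bar>"
  proof (cases "d = 0")
    case False
    have "\<bar>\<Delta> * w\<bar> * Y \<le> \<bar>\<Delta> * w\<bar> * ((\<bar>d\<bar> - 1) div \<bar>\<Delta> * w\<bar>)"
      using False by (intro mult_left_mono) (auto simp: Y_def)
    also have "\<dots> \<le> \<bar>d\<bar> - 1" using dw by (metis mult.commute pos_mod_sign div_mult_mod_eq le_add_same_cancel1 zero_less_one order_less_le_trans)
    finally show ?thesis by simp
  qed simp
  note inj = inj[OF this]
  have "nat (Y + 1) = card ((\<lambda>z. tclass (x \<otimes> cpow (w * z))) ` {0..Y})"
    using card_image[OF inj] by simp
  also have "\<dots> \<le> card ((\<lambda>z. tclass (x \<otimes> cpow (w * z))) ` {0..Z})"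
    by (intro card_mono image_mono) (auto simp: Y_def)
  finally have card: "real_of_int (Y + 1) \<le> real (card ((\<lambda>z. tclass (x \<otimes> cpow (w * z))) ` {0..Z}))"
    using Y0 by simp
  have "(if d = 0 then Z else \<bar>d\<bar>) \<le> E * (Y + 1)"
  proof (cases "d = 0")
    case True
    have "Z \<le> 1 * (Z + 1)" by simp
    also have "\<dots> \<le> E * (Z + 1)" using E Z by (intro mult_right_mono) auto
    finally show ?thesis using True by (simp add: Y_def)
  next
    case False
    show ?thesis
    proof (cases "Z \<le> (\<bar>d\<bar> - 1) div \<bar>\<Delta> * w\<bar>")
      case True
      then have "E * Z \<le> E * (Y + 1)" using E by (intro mult_left_mono) (auto simp: Y_def)
      then show ?thesis using E(3) False by simp
    next
      case nle: False
      then have Y: "Y = (\<bar>d\<bar> - 1) div \<bar>\<Delta> * w\<bar>" using False by (simp add: Y_def)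
      have "\<bar>d\<bar> - 1 < \<bar>\<Delta> * w\<bar> * (Y + 1)"
        unfolding Y distrib_left mult_1_right
        using dw pos_mod_bound[of "\<bar>\<Delta> * w\<bar>" "\<bar>d\<bar> - 1"] mult_div_mod_eq[of "\<bar>\<Delta> * w\<bar>" "\<bar>d\<bar> - 1"]
        by linarith
      also have "\<dots> \<le> E * (Y + 1)" using E Y0 by (intro mult_right_mono) auto
      finally show ?thesis using False by simp
    qed
  qed
  then have "real_of_int (if d = 0 then Z else \<bar>d\<bar>) \<le> of_int E * of_int (Y + 1)"
    by (metis of_int_le_iff of_int_mult)
  then have "(if d = 0 then of_int Z else of_int \<bar>d\<bar>) / real_of_int E \<le> real_of_int (Y + 1)"
    using E(1) by (simp add: divide_le_eq mult.commute split: if_splits)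
  with card show ?thesis by linarith
qed

subsection \<open>Lifting to exponent vectors\<close>

definition twist :: "ivec \<Rightarrow> 'a set" where "twist u = coset (P u \<otimes> inv (\<psi> (P u)))"

definition HV :: "ivec set" where "HV = {v. \<exists>u. ab v = twist u}"

definition KV :: "ivec set" where "KV = {v. fixed (P v)}"

definition \<tau>V :: "ivec \<Rightarrow> int" where "\<tau>V v = \<tau> (P v)"

lemma P_add: "\<exists>z. P (u + v) = P u \<otimes> P v \<otimes> cpow z"
  using coset_eq_iff[of "P u \<otimes> P v" "P (u + v)"] by (simp add: coset_mult coset_collect_add)

lemma coset_psi_P_add: "coset (\<psi> (P (u + v))) = coset (\<psi> (P u)) \<otimes>\<^bsub>Ab\<^esub> coset (\<psi> (P v))"
proof -
  obtain z where "P (u + v) = P u \<otimes> P v \<otimes> cpow z" using P_add by blast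
  then show ?thesis by (simp add: psi_mult psi_cpow coset_cpow_one coset_mult)
qed

lemma twist_eq: "twist u = ab u \<otimes>\<^bsub>Ab\<^esub> inv\<^bsub>Ab\<^esub> coset (\<psi> (P u))"
  by (simp add: twist_def coset_mult coset_inv ab_def)

lemma twist_closed [simp]: "twist u \<in> carrier Ab"
  by (simp add: twist_def)

lemma twist_add: "twist (u + v) = twist u \<otimes>\<^bsub>Ab\<^esub> twist v"
  unfolding twist_eq coset_psi_P_add ab_add by (simp add: Ab.inv_mult Ab.m_ac)

lemma twist_zero: "twist 0 = \<one>\<^bsub>Ab\<^esub>"
  and twist_diff: "twist (u - v) = twist u \<otimes>\<^bsub>Ab\<^esub> inv\<^bsub>Ab\<^esub> twist v"
  and twist_smul: "twist (smul k v) = twist v [^]\<^bsub>Ab\<^esub> k"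
  using ivec_hom[OF Ab.is_group add_subgroup_UNIV, of twist] by (auto simp: twist_add)

lemma twist_coset:
  assumes "g \<in> carrier G" "coset g = ab u"
  shows "coset (g \<otimes> inv (\<psi> g)) = twist u"
  using assms coset_psi_cong[of g "P u"] by (simp add: twist_eq coset_mult coset_inv ab_def)

lemma HV_subgroup: "add_subgroup HV"
  unfolding add_subgroup_def HV_def
  by (auto simp: ab_diff ab_zero intro: exI[of _ "_ - _"] exI[of _ 0] simp flip: twist_diff twist_zero)

lemma LV_sub_HV: "LV \<subseteq> HV"
  by (auto simp: LV_def HV_def intro: exI[of _ 0] simp flip: twist_zero)

lemma KV_subgroup: "add_subgroup KV"
proof -
  have "v \<in> KV \<longleftrightarrow> coset (\<psi> (P v)) = ab v" for v
    by (simp add: KV_def fixed_def ab_def)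
  moreover have "coset (\<psi> (P v)) = ab v \<longleftrightarrow> twist v = \<one>\<^bsub>Ab\<^esub>" for v
    by (auto simp: twist_eq Ab.inv_equality Ab.inv_solve_right')
  ultimately show ?thesis
    by (auto simp: add_subgroup_def twist_zero twist_diff)
qed

lemma periods_P_iff:
  assumes "\<epsilon> = 1"
  shows "z \<in> periods (P v) \<longleftrightarrow> (\<exists>u\<in>KV. z = \<tau>V u + W u v)"
proof
  assume "z \<in> periods (P v)"
  then obtain g where g: "fixed g" "z = \<tau> g + \<omega> g (P v)"
    by (auto simp: periods_def tconj_cpow_iff)
  obtain u where u: "coset g = ab u" using ab_surj fixed_carrier g(1) by blast
  then obtain t where t: "P u = g \<otimes> cpow t" using g(1) fixed_carrier by (auto simp: ab_def coset_eq_iff)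
  have "u \<in> KV" "\<tau>V u = \<tau> g" using tau_mult_cpow[OF g(1), of t] assms by (auto simp: KV_def \<tau>V_def t)
  moreover have "W u v = \<omega> g (P v)"
    unfolding W_def using u g(1) fixed_carrier by (intro omega_coset_left) (auto simp: ab_def)
  ultimately show "\<exists>u\<in>KV. z = \<tau>V u + W u v"
    using g(2) by (intro bexI[of _ u]) simp_all
next
  assume "\<exists>u\<in>KV. z = \<tau>V u + W u v"
  then show "z \<in> periods (P v)" by (auto simp: periods_def tconj_cpow_iff KV_def \<tau>V_def W_def)
qed

lemma two_in_periods:
  assumes "\<epsilon> = -1" "x \<in> carrier G"
  shows "2 \<in> periods x"
proof -
  have "fixed (cpow 1)" "\<tau> (cpow 1) = 2"
  proof -
    have "cpow 1 = \<psi> (cpow 1) \<otimes> cpow 2"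
      unfolding psi_cpow cpow_add[symmetric] using assms(1) by simp
    with fixed_tauI[of "cpow 1" 2] show "fixed (cpow 1)" "\<tau> (cpow 1) = 2" by auto
  qed
  then show ?thesis
    unfolding periods_def tconj_cpow_iff[OF assms(2)] mem_Collect_eq
    by (intro exI[of _ "cpow 1"]) (simp add: omega_cpow_left[OF assms(2)] del: int_pow_1)
qed

lemma W_KV_HV:
  assumes "\<epsilon> = 1" "u \<in> KV" "v \<in> HV"
  shows "W u v = 0"
proof -
  obtain w where w: "ab v = twist w" using assms by (auto simp: HV_def)
  let ?g = "P u" and ?h = "P w"
  have inv: "\<omega> ?g (inv (\<psi> ?h)) = - \<omega> ?g (\<psi> ?h)"
    using omega_mult_right[of ?g "\<psi> ?h" "inv (\<psi> ?h)"] omega_cpow_left[of ?g 0] omega_sym[of ?g \<one>] by simp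
  have "W u v = \<omega> ?g (?h \<otimes> inv (\<psi> ?h))"
    unfolding W_def using w by (intro omega_coset_right) (auto simp: ab_def twist_def)
  also have "\<dots> = \<omega> ?g ?h - \<omega> ?g (\<psi> ?h)" by (simp add: omega_mult_right inv)
  also have "\<omega> ?g (\<psi> ?h) = \<omega> (\<psi> ?g) (\<psi> ?h)"
    using assms(2) by (intro omega_coset_left) (auto simp: KV_def fixed_def)
  also have "\<dots> = \<omega> ?g ?h" using assms(1) by (simp add: omega_psi)
  finally show ?thesis by simp
qed

lemma id_minus_coset:
  assumes "g \<in> carrier G"
  shows "id_minus Ab (induced_ab \<psi>) (coset g) = coset (g \<otimes> inv (\<psi> g))"
  using assms induced_ab_coset[OF is_group psi_iso assms]
  by (simp add: id_minus_def coset_mult coset_inv) (simp add: coset_def)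

lemma rank_diff:
  assumes y: "rational_basis HV UNIV {..<k} y"
  shows "int (torsion_free_rank Ab) - int (endo_rank Ab (id_minus Ab (induced_ab \<psi>))) = int k"
proof -
  let ?f = "id_minus Ab (induced_ab \<psi>)"
  obtain p u where u: "rational_basis LV HV {..<p::nat} u"
    using rational_basis_exists[OF LV_subgroup LV_bound HV_subgroup] by blast
  have "torsion_free_rank Ab = card {..<k + p}"
  proof (rule torsion_free_rank_eq[where f = ab])
    show "comm_group Ab" by (rule comm_group_Ab)
    show "range ab = carrier Ab" using ab_surj coset_surj by (force simp: image_iff)
    show "rational_basis LV UNIV {..<k + p} (\<lambda>i. if i < k then y i else u (i - k))"
      by (rule rational_basis_append[OF LV_subgroup HV_subgroup LV_sub_HV subset_UNIV u y])
  qed (auto simp: add_subgroup_UNIV ab_add LV_def)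
  moreover have "endo_rank Ab ?f = card {..<p}"
    unfolding endo_rank_def
  proof (rule torsion_free_rank_eq[where f = ab])
    have img: "?f ` carrier Ab = range twist"
    proof (intro equalityI image_subsetI)
      fix C assume "C \<in> carrier Ab"
      then obtain g where g: "g \<in> carrier G" "C = coset g" using coset_surj by blast
      with ab_surj[of g] show "?f C \<in> range twist" by (auto simp: id_minus_coset twist_coset)
    next
      fix u
      have "twist u = ?f (coset (P u))" by (simp add: id_minus_coset twist_def)
      then show "twist u \<in> ?f ` carrier Ab" by simp
    qed
    have sub: "subgroup (?f ` carrier Ab) Ab"
      unfolding img
    proof (rule Ab.subgroupI)
      show "inv\<^bsub>Ab\<^esub> a \<in> range twist" if "a \<in> range twist" for a
        using that twist_diff[of 0] by (auto simp: twist_zero intro: range_eqI[of _ _ "0 - _"])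
      show "a \<otimes>\<^bsub>Ab\<^esub> b \<in> range twist" if "a \<in> range twist" "b \<in> range twist" for a b
        using that by (auto simp flip: twist_add)
    qed auto
    show "comm_group (Ab\<lparr>carrier := ?f ` carrier Ab\<rparr>)"
      using Ab.subgroup_imp_group[OF sub] subgroup.subset[OF sub]
      by (intro group.group_comm_groupI) (auto intro!: Ab.m_comm)
    show "ab ` HV = carrier (Ab\<lparr>carrier := ?f ` carrier Ab\<rparr>)"
    proof -
      have "twist w \<in> ab ` HV" for w
      proof -
        obtain v where "twist w = ab v" using ab_surj[of "P w \<otimes> inv (\<psi> (P w))"] by (auto simp: twist_def)
        then show ?thesis by (auto simp: HV_def)
      qed
      then show ?thesis by (auto simp: img HV_def)
    qed
    show "LV = {v \<in> HV. ab v = \<one>\<^bsub>Ab\<lparr>carrier := ?f ` carrier Ab\<rparr>\<^esub>}"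
      using LV_sub_HV by (auto simp: LV_def)
    show "rational_basis LV HV {..<p} u" by (rule u)
  qed (auto simp: HV_subgroup ab_add)
  ultimately show ?thesis by simp
qed

subsection \<open>Counting classes\<close>

abbreviation gr :: "nat \<Rightarrow> nat" where "gr n \<equiv> twisted_growth G S \<psi> n"

abbreviation fibre :: "ivec \<Rightarrow> int \<Rightarrow> 'a set set" where
  "fibre v Z \<equiv> (\<lambda>z. tclass (P v \<otimes> cpow z)) ` box Z"

abbreviation cfibre :: "ivec \<Rightarrow> int \<Rightarrow> nat \<Rightarrow> 'a set set" where
  "cfibre v w n \<equiv> (\<lambda>z. tclass (P v \<otimes> cpow (w * z))) ` {0..int n ^ 2}"

lemma twisted_growth_eq: "gr n = card (tclass ` ball n)"
proof -
  have "{tclass g | g. g \<in> carrier G \<and> word_norm G S g \<le> n} = tclass ` ball n"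
    using word_norm_le_iff ball_carrier by auto
  then show ?thesis by (simp add: twisted_growth_def)
qed

lemma twisted_growth_mono: "a \<le> b \<Longrightarrow> gr a \<le> gr b"
  unfolding twisted_growth_eq
  by (intro card_mono image_mono finite_imageI finite_ball ball_mono)

lemma ab_twist_lincomb:
  fixes p :: nat
  assumes "\<And>i. i < p \<Longrightarrow> ab (u i) = twist (\<eta> i)"
  shows "ab (lincomb {..<p} a u) = twist (lincomb {..<p} a \<eta>)"
  using assms
proof (induction p)
  case 0
  then show ?case by (simp add: lincomb_def ab_zero twist_zero)
next
  case (Suc p)
  have eq: "lincomb {..<Suc p} a x = lincomb {..<p} a x + smul (a p) (x p)" for x :: "nat \<Rightarrow> ivec"
    by (simp add: lincomb_def)
  have "ab (lincomb {..<p} a u) = twist (lincomb {..<p} a \<eta>)" by (rule Suc.IH) (simp add: Suc.prems)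
  then show ?case unfolding eq ab_add twist_add by (simp add: ab_smul twist_smul Suc.prems)
qed

lemma tclass_twist:
  assumes g: "g \<in> carrier G" and h: "h \<in> carrier G"
  shows "tclass (inv h \<otimes> g \<otimes> \<psi> h) = tclass g"
proof -
  have "tconj g (inv h \<otimes> g \<otimes> \<psi> h)"
    unfolding twisted_conj_def using g h by (intro bexI[of _ "inv h"]) (auto simp: psi_inv)
  then show ?thesis using g h by (simp add: tclass_eq_iff[symmetric])
qed

lemma vnorm_lincomb_bound:
  fixes x :: "nat \<Rightarrow> ivec"
  obtains C where "C \<ge> 0" "\<And>a M. (\<And>i. i < p \<Longrightarrow> \<bar>a i\<bar> \<le> M) \<Longrightarrow> vnorm m (lincomb {..<p} a x) \<le> C * M"
proof
  show "(\<Sum>i<p. vnorm m (x i)) \<ge> 0" by (intro sum_nonneg) simp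
  show "vnorm m (lincomb {..<p} a x) \<le> (\<Sum>i<p. vnorm m (x i)) * M" if "\<And>i. i < p \<Longrightarrow> \<bar>a i\<bar> \<le> M" for a M
  proof -
    have "(\<Sum>i<p. \<bar>a i\<bar> * vnorm m (x i)) \<le> (\<Sum>i<p. M * vnorm m (x i))"
      using that by (intro sum_mono mult_right_mono) auto
    then show ?thesis
      using vnorm_lincomb[of m "{..<p}" a x] by (simp add: sum_distrib_left mult.commute)
  qed
qed

text \<open>Every class meeting a ball has a representative \<open>P (w + \<Sum>b\<^sub>i y\<^sub>i) c\<^sup>z\<close> with \<open>w\<close> in a finite set:
  the component in the image of \<open>id - \<psi>\<close> is removed by a twisted conjugation with an element of
  linearly bounded norm.\<close>

lemma twisted_growth_le:
  fixes k :: nat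
  assumes y: "rational_basis HV UNIV {..<k} y"
  obtains T C where "finite T" "C \<ge> 1" "\<And>n. n \<ge> 1 \<Longrightarrow> gr n \<le>
    (\<Sum>w\<in>T. \<Sum>b\<in>cube k (C * int n).
       card (fibre (w + lincomb {..<k} b y) (C * int n ^ 2)))"
proof -
  obtain p u where u: "rational_basis LV HV {..<p::nat} u"
    using rational_basis_exists[OF LV_subgroup LV_bound HV_subgroup] by blast
  let ?x = "\<lambda>i. if i < k then y i else u (i - k)"
  have x: "rational_basis LV UNIV {..<k + p} ?x"
    by (rule rational_basis_append[OF LV_subgroup HV_subgroup LV_sub_HV subset_UNIV u y])
  obtain T C0 where T: "finite T" "C0 \<ge> 0" and rep: "\<And>v. \<exists>w\<in>T. \<exists>a.
      (\<forall>i\<in>{..<k + p}. \<bar>a i\<bar> \<le> C0 * vnorm m v) \<and> v - (w + lincomb {..<k + p} a ?x) \<in> LV"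
    using rational_basis_remainder[OF LV_subgroup LV_bound x] by blast
  have "\<forall>i<p. \<exists>\<eta>. ab (u i) = twist \<eta>" using u by (auto simp: rational_basis_def HV_def)
  then obtain \<eta> where \<eta>: "\<And>i. i < p \<Longrightarrow> ab (u i) = twist (\<eta> i)" by metis
  obtain C1 where C1: "C1 \<ge> 0"
    "\<And>a M. (\<And>i. i < p \<Longrightarrow> \<bar>a i\<bar> \<le> M) \<Longrightarrow> vnorm m (lincomb {..<p} a \<eta>) \<le> C1 * M"
    using vnorm_lincomb_bound by blast
  obtain C2 where C2: "C2 \<ge> 0"
    "\<And>a M. (\<And>i. i < k \<Longrightarrow> \<bar>a i\<bar> \<le> M) \<Longrightarrow> vnorm m (lincomb {..<k} a y) \<le> C2 * M"
    using vnorm_lincomb_bound by blast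
  obtain C3 where C3: "C3 \<ge> 0" "\<And>w. w \<in> T \<Longrightarrow> vnorm m w \<le> C3"
    using finite_int_bound[OF T(1)] by blast
  obtain C4 where C4: "\<And>n g. g \<in> ball n \<Longrightarrow> \<psi> g \<in> ball (C4 * n)" using psi_ball_bound by blast
  obtain C5 where C5: "C5 \<ge> 1" "\<And>n z. cpow z \<in> ball n \<Longrightarrow> \<bar>z\<bar> \<le> C5 * int n ^ 2"
    using center_distortion by blast
  define D where "D = nat (C3 + C2 * C0 + C1 * C0 + 1) + C4 * nat (C1 * C0)"
  define C where "C = C0 + C5 * int D ^ 2 + 1"
  have C: "C \<ge> 1" "C0 \<le> C" "C5 * int D ^ 2 \<le> C" using T(2) C5(1) by (auto simp: C_def)
  let ?B = "\<lambda>n. cube k (C * int n)"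
  let ?Z = "\<lambda>n. (box (C * int n ^ 2))"
  let ?F = "\<lambda>n w b. (\<lambda>z. tclass (P (w + lincomb {..<k} b y) \<otimes> cpow z)) ` ?Z n"
  have sub: "tclass g \<in> (\<Union>w\<in>T. \<Union>b\<in>?B n. ?F n w b)" if g: "g \<in> ball n" and n: "n \<ge> 1" for g n
  proof -
    have gc: "g \<in> carrier G" using g ball_carrier by auto
    obtain v where v: "coset g = ab v" "vnorm m v \<le> int n" using ball_coset[OF g] by blast
    obtain w a where w: "w \<in> T" and a: "\<And>i. i < k + p \<Longrightarrow> \<bar>a i\<bar> \<le> C0 * vnorm m v"
      and dec: "v - (w + lincomb {..<k + p} a ?x) \<in> LV"
      using rep[of v] by auto
    have an: "\<bar>a i\<bar> \<le> C0 * int n" if "i < k + p" for i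
      using a[OF that] mult_left_mono[OF v(2) T(2)] by linarith
    define b where "b = restrict a {..<k}"
    have split: "lincomb {..<k + p} a ?x = lincomb {..<k} b y + lincomb {..<p} (\<lambda>i. a (k + i)) u"
      unfolding lincomb_def sum_lessThan_add by (simp add: b_def)
    define h where "h = P (lincomb {..<p} (\<lambda>i. a (k + i)) \<eta>)"
    have hc: "h \<in> carrier G" by (simp add: h_def)
    have vh: "vnorm m (lincomb {..<p} (\<lambda>i. a (k + i)) \<eta>) \<le> C1 * (C0 * int n)"
      using an by (intro C1(2)) simp
    have hb: "h \<in> ball (nat (C1 * C0) * n)"
    proof -
      have "nat (vnorm m (lincomb {..<p} (\<lambda>i. a (k + i)) \<eta>)) \<le> nat (C1 * C0 * int n)"
        using vh by (intro nat_mono) (simp add: mult.assoc)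
      also have "\<dots> = nat (C1 * C0) * n"
        using C1(1) T(2) by (subst nat_mult_distrib) auto
      finally show ?thesis unfolding h_def using ball_P ball_mono by blast
    qed
    define g' where "g' = inv h \<otimes> g \<otimes> \<psi> h"
    have g'c: "g' \<in> carrier G" using gc hc by (simp add: g'_def)
    define x0 where "x0 = P (w + lincomb {..<k} b y)"
    have x0c: "x0 \<in> carrier G" by (simp add: x0_def)
    have "coset g' = coset g \<otimes>\<^bsub>Ab\<^esub> inv\<^bsub>Ab\<^esub> coset (h \<otimes> inv (\<psi> h))"
      using gc hc by (simp add: g'_def coset_mult coset_inv Ab.inv_mult Ab.m_ac)
    also have "coset (h \<otimes> inv (\<psi> h)) = ab (lincomb {..<p} (\<lambda>i. a (k + i)) u)"
      using ab_twist_lincomb[of p u \<eta>] \<eta> by (simp add: h_def twist_def)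
    also have "coset g \<otimes>\<^bsub>Ab\<^esub> inv\<^bsub>Ab\<^esub> ab (lincomb {..<p} (\<lambda>i. a (k + i)) u) = coset x0"
      unfolding v(1) ab_diff[symmetric] x0_def ab_def[symmetric] ab_eq_iff
      using dec unfolding split by (simp add: algebra_simps)
    finally obtain z where z: "g' = x0 \<otimes> cpow z"
      using x0c g'c by (metis coset_eq_iff)
    have "x0 \<in> ball (nat (C3 + C2 * C0) * n)"
    proof -
      have "vnorm m (w + lincomb {..<k} b y) \<le> C3 + C2 * (C0 * int n)"
      proof -
        have "vnorm m (lincomb {..<k} b y) \<le> C2 * (C0 * int n)"
          using an by (intro C2(2)) (simp add: b_def)
        with C3(2)[OF w] vnorm_add[of m w "lincomb {..<k} b y"] show ?thesis by linarith
      qed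
      also have "\<dots> \<le> (C3 + C2 * C0) * int n"
        using mult_left_mono[of 1 "int n" C3] n C3(1) by (simp add: algebra_simps)
      finally have "nat (vnorm m (w + lincomb {..<k} b y)) \<le> nat ((C3 + C2 * C0) * int n)"
        by (intro nat_mono) simp
      also have "\<dots> = nat (C3 + C2 * C0) * n"
        using C3(1) C2(1) T(2) by (subst nat_mult_distrib) auto
      finally show ?thesis unfolding x0_def using ball_P ball_mono by blast
    qed
    then have "inv x0 \<otimes> (inv h \<otimes> g \<otimes> \<psi> h) \<in>
        ball (nat (C3 + C2 * C0) * n + (nat (C1 * C0) * n + n + C4 * (nat (C1 * C0) * n)))"
      by (intro ball_mult ball_inv hb g C4)
    also have "inv x0 \<otimes> (inv h \<otimes> g \<otimes> \<psi> h) = cpow z"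
      unfolding g'_def[symmetric] z using x0c by (simp add: m_assoc[symmetric])
    also have "nat (C3 + C2 * C0) * n + (nat (C1 * C0) * n + n + C4 * (nat (C1 * C0) * n)) = D * n"
    proof -
      have "nat (C3 + C2 * C0 + C1 * C0 + 1) = nat (C3 + C2 * C0) + nat (C1 * C0) + 1"
        using C1(1) C2(1) C3(1) T(2) by (simp add: nat_add_distrib)
      then show ?thesis by (simp add: D_def algebra_simps)
    qed
    finally have "cpow z \<in> ball (D * n)" .
    from C5(2)[OF this] have "\<bar>z\<bar> \<le> (C5 * int D ^ 2) * int n ^ 2" by (simp add: power_mult_distrib)
    moreover have "(C5 * int D ^ 2) * int n ^ 2 \<le> C * int n ^ 2"
      using C by (intro mult_right_mono) auto
    ultimately have zZ: "z \<in> ?Z n" by auto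
    have "b \<in> ?B n"
    proof (rule PiE_I)
      fix i assume i: "i \<in> {..<k}"
      have "C0 * int n \<le> C * int n" using C by (intro mult_right_mono) auto
      then have "\<bar>a i\<bar> \<le> C * int n" using an[of i] i by auto
      then show "b i \<in> box (C * int n)" using i by (auto simp: b_def)
    qed (auto simp: b_def)
    moreover have "tclass g = tclass (x0 \<otimes> cpow z)"
      using tclass_twist[OF gc hc] by (simp add: z[symmetric] g'_def)
    ultimately show ?thesis using w zZ unfolding x0_def by blast
  qed
  have "gr n \<le> (\<Sum>w\<in>T. \<Sum>b\<in>?B n. card (?F n w b))" if n: "n \<ge> 1" for n
  proof -
    have finB: "finite (?B n)" by (intro finite_PiE) auto
    have "gr n \<le> card (\<Union>w\<in>T. \<Union>b\<in>?B n. ?F n w b)"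
      unfolding twisted_growth_eq using sub n T(1) finB by (intro card_mono) auto
    also have "\<dots> \<le> (\<Sum>w\<in>T. card (\<Union>b\<in>?B n. ?F n w b))" by (rule card_UN_le[OF T(1)])
    also have "\<dots> \<le> (\<Sum>w\<in>T. \<Sum>b\<in>?B n. card (?F n w b))" by (intro sum_mono card_UN_le finB)
    finally show ?thesis by simp
  qed
  with T(1) C(1) show thesis by (intro that) auto
qed

lemma nontrivial_commutator: "\<exists>i<m. \<exists>j<m. \<omega> (s i) (s j) \<noteq> 0"
proof (rule ccontr)
  assume "\<not> ?thesis"
  then have zero: "\<omega> (s i) (s j) = 0" if "i < m" "j < m" for i j using that by blast
  have "W u v = 0" for u v
  proof -
    have "\<omega> (s i) (P v) = 0" if "i < m" for i
      using omega_sym[of "s i" "P v"] omega_collect[of m s "s i" v] zero that by simp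
    then show ?thesis unfolding W_def by (subst omega_collect) auto
  qed
  then have "\<omega> g h = 0" if "g \<in> carrier G" "h \<in> carrier G" for g h
  proof -
    obtain u v where "coset g = ab u" "coset h = ab v" using ab_surj \<open>g \<in> carrier G\<close> \<open>h \<in> carrier G\<close> by metis
    then have "\<omega> g h = W u v"
      unfolding W_def using that omega_coset_left[of g "P u" h] omega_coset_right[of h "P v" "P u"]
      by (simp add: ab_def)
    with \<open>\<And>u v. W u v = 0\<close> show ?thesis by simp
  qed
  then have "g \<otimes> h = h \<otimes> g" if "g \<in> carrier G" "h \<in> carrier G" for g h
    using omega[of g h] that by simp
  then have "comm_group G" by (rule group_comm_groupI)
  then have "derived G (carrier G) = {\<one>}" by (rule comm_group.derived_eq_singleton) simp
  then have "cpow 1 = cpow 0" using derived_eq by (metis int_pow_0 rangeI singletonD)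
  then have "(1::int) = 0" by (rule c_inj)
  then show False by simp
qed

lemma center_in_ball:
  obtains w where "w \<noteq> 0" "\<And>n z. z \<in> {0..int n ^ 2} \<Longrightarrow> cpow (w * z) \<in> ball (8 * n)"
proof -
  obtain i j where ij: "i < m" "j < m" "\<omega> (s i) (s j) \<noteq> 0" using nontrivial_commutator by blast
  define w where "w = \<omega> (s i) (s j)"
  have comm: "cpow (w * (a * b)) \<in> ball (2 * (nat \<bar>a\<bar> + nat \<bar>b\<bar>))" for a b
  proof -
    let ?g = "s i [^] a" and ?x = "s j [^] b"
    have cl: "?g \<in> carrier G" "?x \<in> carrier G" using ij by auto
    have gb: "?g \<in> ball (nat \<bar>a\<bar>)" "?x \<in> ball (nat \<bar>b\<bar>)"
      using ball_int_pow[OF s_in_ball[OF ij(1)], of a] ball_int_pow[OF s_in_ball[OF ij(2)], of b] by auto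
    have "\<omega> ?g ?x = w * (a * b)"
      using ij omega_int_pow[of "s i" ?x a] omega_int_pow[of "s j" "s i" b] omega_sym[of "s i" ?x]
        omega_sym[of "s j" "s i"] by (simp add: w_def)
    then have "?g \<otimes> ?x = ?x \<otimes> ?g \<otimes> cpow (w * (a * b))" using omega[OF cl] by simp
    then have "inv (?x \<otimes> ?g) \<otimes> (?g \<otimes> ?x) = inv (?x \<otimes> ?g) \<otimes> (?x \<otimes> ?g \<otimes> cpow (w * (a * b)))"
      by simp
    also have "\<dots> = (inv (?x \<otimes> ?g) \<otimes> (?x \<otimes> ?g)) \<otimes> cpow (w * (a * b))"
      by (rule m_assoc[symmetric]) (use cl in auto)
    also have "\<dots> = cpow (w * (a * b))" using cl by simp
    finally have "cpow (w * (a * b)) = inv (?x \<otimes> ?g) \<otimes> (?g \<otimes> ?x)" ..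
    moreover have "inv (?x \<otimes> ?g) \<otimes> (?g \<otimes> ?x) \<in> ball ((nat \<bar>b\<bar> + nat \<bar>a\<bar>) + (nat \<bar>a\<bar> + nat \<bar>b\<bar>))"
      by (intro ball_mult ball_inv gb)
    moreover have "(nat \<bar>b\<bar> + nat \<bar>a\<bar>) + (nat \<bar>a\<bar> + nat \<bar>b\<bar>) = 2 * (nat \<bar>a\<bar> + nat \<bar>b\<bar>)"
      by simp
    ultimately show ?thesis by metis
  qed
  have "cpow (w * z) \<in> ball (8 * n)" if z: "z \<in> {0..int n ^ 2}" for n z
  proof (cases "n = 0")
    case True
    then show ?thesis using z by simp
  next
    case False
    define a where "a = z div int n"
    define b where "b = z mod int n"
    have z_eq: "z = a * int n + b" by (simp add: a_def b_def)
    have b: "0 \<le> b" "b \<le> int n" using False by (auto simp: b_def less_imp_le)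
    have "a \<le> int n ^ 2 div int n" unfolding a_def using z False by (intro zdiv_mono1) auto
    then have a: "0 \<le> a" "a \<le> int n"
      using z False by (auto simp: a_def power2_eq_square pos_imp_zdiv_nonneg_iff)
    have "cpow (w * (a * int n)) \<otimes> cpow (w * (b * 1)) \<in>
        ball (2 * (nat \<bar>a\<bar> + nat \<bar>int n\<bar>) + 2 * (nat \<bar>b\<bar> + nat \<bar>1\<bar>))"
      by (intro ball_mult comm)
    moreover have "cpow (w * (a * int n)) \<otimes> cpow (w * (b * 1)) = cpow (w * z)"
      by (simp add: z_eq cpow_add[symmetric] distrib_left)
    moreover have "2 * (nat \<bar>a\<bar> + nat \<bar>int n\<bar>) + 2 * (nat \<bar>b\<bar> + nat \<bar>1\<bar>) \<le> 8 * n"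
      using a b False by simp
    ultimately show ?thesis using ball_mono by (metis subsetD)
  qed
  with ij(3) show thesis by (intro that[of w]) (auto simp: w_def)
qed

lemma tclass_eq_HV:
  assumes "tclass (P u \<otimes> cpow y) = tclass (P v \<otimes> cpow z)"
  shows "v - u \<in> HV"
proof -
  obtain g where g: "g \<in> carrier G" "g \<otimes> (P u \<otimes> cpow y) \<otimes> inv (\<psi> g) = P v \<otimes> cpow z"
    using assms by (auto simp: tclass_eq_iff twisted_conj_def)
  obtain t where t: "coset g = ab t" using ab_surj[OF g(1)] by blast
  have "ab v = coset (P v \<otimes> cpow z)" by (simp add: coset_cpow ab_def)
  also have "\<dots> = coset (g \<otimes> inv (\<psi> g)) \<otimes>\<^bsub>Ab\<^esub> ab u"
    unfolding g(2)[symmetric] using g(1) by (simp add: coset_mult coset_cpow_one ab_def Ab.m_ac)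
  finally have "ab v = twist t \<otimes>\<^bsub>Ab\<^esub> ab u" by (simp add: twist_coset[OF g(1) t])
  then have "ab (v - u) = twist t" by (simp add: ab_diff Ab.m_assoc)
  then show ?thesis by (auto simp: HV_def)
qed

lemma twisted_growth_ge:
  fixes k :: nat
  assumes y: "rational_basis HV UNIV {..<k} y"
  obtains w C where "w \<noteq> 0" "C \<ge> 1" "\<And>n.
    (\<Sum>b\<in>cube k (int n).
       card (cfibre (lincomb {..<k} b y) w n))
    \<le> gr (C * n)"
proof -
  obtain w where w: "w \<noteq> 0" "\<And>n z. z \<in> {0..int n ^ 2} \<Longrightarrow> cpow (w * z) \<in> ball (8 * n)"
    using center_in_ball by blast
  obtain C2 where C2: "C2 \<ge> 0"
    "\<And>a M. (\<And>i. i < k \<Longrightarrow> \<bar>a i\<bar> \<le> M) \<Longrightarrow> vnorm m (lincomb {..<k} a y) \<le> C2 * M"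
    using vnorm_lincomb_bound by blast
  define C where "C = nat C2 + 8"
  let ?B = "\<lambda>n. cube k (int n)"
  let ?F = "\<lambda>n b. cfibre (lincomb {..<k} b y) w n"
  have "(\<Sum>b\<in>?B n. card (?F n b)) \<le> gr (C * n)" for n
  proof -
    have "?F n b \<subseteq> tclass ` ball (C * n)" if b: "b \<in> ?B n" for b
    proof (rule image_subsetI)
      fix z assume z: "z \<in> {0..int n ^ 2}"
      have "\<bar>b i\<bar> \<le> int n" if "i < k" for i
        using PiE_mem[OF b, of i] that by auto
      then have "vnorm m (lincomb {..<k} b y) \<le> C2 * int n" by (rule C2(2))
      then have "nat (vnorm m (lincomb {..<k} b y)) \<le> nat (C2 * int n)" by (rule nat_mono)
      also have "\<dots> = nat C2 * n" using C2(1) by (simp add: nat_mult_distrib)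
      finally have "P (lincomb {..<k} b y) \<in> ball (nat C2 * n)" using ball_P ball_mono by blast
      from ball_mult[OF this w(2)[OF z]]
      have "P (lincomb {..<k} b y) \<otimes> cpow (w * z) \<in> ball (C * n)"
        by (simp add: C_def distrib_right)
      then show "tclass (P (lincomb {..<k} b y) \<otimes> cpow (w * z)) \<in> tclass ` ball (C * n)" by simp
    qed
    then have sub: "(\<Union>b\<in>?B n. ?F n b) \<subseteq> tclass ` ball (C * n)" by blast
    have "a = b" if ab: "a \<in> ?B n" "b \<in> ?B n" and ne: "?F n a \<inter> ?F n b \<noteq> {}" for a b
    proof -
      obtain z z' where "tclass (P (lincomb {..<k} a y) \<otimes> cpow (w * z)) = tclass (P (lincomb {..<k} b y) \<otimes> cpow (w * z'))"
        using ne by auto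
      from tclass_eq_HV[OF this] have "lincomb {..<k} (\<lambda>i. b i - a i) y \<in> HV" by (simp add: lincomb_diff)
      then have "\<forall>i\<in>{..<k}. b i - a i = 0" using y unfolding rational_basis_def indep_mod_def by blast
      then show ?thesis using PiE_ext[OF ab] by auto
    qed
    then have "card (\<Union>b\<in>?B n. ?F n b) = (\<Sum>b\<in>?B n. card (?F n b))"
      by (intro card_UN_disjoint finite_PiE) auto
    then show ?thesis
      unfolding twisted_growth_eq using card_mono[OF _ sub] finite_ball by simp
  qed
  with w(1) show thesis by (intro that[of w C]) (auto simp: C_def)
qed

subsection \<open>A biorthogonal system for the commutator form\<close>

definition biorthogonal :: "nat \<Rightarrow> int \<Rightarrow> (nat \<Rightarrow> ivec) \<Rightarrow> (nat \<Rightarrow> ivec) \<Rightarrow> bool" where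
  "biorthogonal r \<Delta> g x \<longleftrightarrow> \<Delta> > 0 \<and> (\<forall>i<r. g i \<in> KV) \<and>
     (\<forall>i<r. \<forall>j<r. W (g i) (x j) = (if i = j then \<Delta> else 0))"

lemma W_add_simps:
  "W (u - v) w = W u w - W v w" "W w (u - v) = W w u - W w v"
  "W (smul k u) w = k * W u w" "W w (smul k u) = k * W w u"
proof -
  show "W (u - v) w = W u w - W v w" for u v w using W_add_left[of "u - v" v w] by simp
  show "W w (u - v) = W w u - W w v" for u v w using W_add_right[of w "u - v" v] by simp
  show "W (smul k u) w = k * W u w" for u w
    using W_lincomb_left[of "{()}" "\<lambda>_. k" "\<lambda>_. u" w] by (simp add: lincomb_def)
  then show "W w (smul k u) = k * W w u" by (simp add: W_sym[of w])
qed

text \<open>Gram-Schmidt: a pair \<open>u, v\<close> violating the conclusion would, after orthogonalisation, extend the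
  system.\<close>

lemma biorthogonal_maximal:
  assumes bi: "biorthogonal r \<Delta> g x"
    and max: "\<And>\<Delta>' g' x'. \<not> biorthogonal (Suc r) \<Delta>' g' x'"
    and u: "u \<in> KV"
  shows "\<Delta> * W u v = (\<Sum>j<r. W u (x j) * W (g j) v)"
proof (rule ccontr)
  assume ne: "\<Delta> * W u v \<noteq> (\<Sum>j<r. W u (x j) * W (g j) v)"
  have \<Delta>: "\<Delta> > 0" and gK: "\<And>i. i < r \<Longrightarrow> g i \<in> KV"
    and W: "\<And>i j. i < r \<Longrightarrow> j < r \<Longrightarrow> W (g i) (x j) = (if i = j then \<Delta> else 0)"
    using bi by (auto simp: biorthogonal_def)
  define x' where "x' = smul \<Delta> v - lincomb {..<r} (\<lambda>j. W (g j) v) x"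
  define g' where "g' = smul \<Delta> u - lincomb {..<r} (\<lambda>j. W u (x j)) g"
  have gx': "W (g i) x' = 0" if "i < r" for i
  proof -
    have "(\<Sum>j<r. W (g j) v * W (g i) (x j)) = (\<Sum>j<r. if j = i then W (g i) v * \<Delta> else 0)"
      using W that by (intro sum.cong) auto
    then show ?thesis using that by (simp add: x'_def W_add_simps W_lincomb_right)
  qed
  have g'x: "W g' (x j) = 0" if "j < r" for j
  proof -
    have "(\<Sum>i<r. W u (x i) * W (g i) (x j)) = (\<Sum>i<r. if i = j then W u (x j) * \<Delta> else 0)"
      using W that by (intro sum.cong) auto
    then show ?thesis using that by (simp add: g'_def W_add_simps W_lincomb_left)
  qed
  define D where "D = W g' x'"
  have "(\<Sum>j<r. W u (x j) * W (g j) x') = 0" using gx' by simp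
  then have "D = \<Delta> * W u x'" by (simp add: D_def g'_def W_add_simps W_lincomb_left)
  also have "W u x' = \<Delta> * W u v - (\<Sum>j<r. W u (x j) * W (g j) v)"
    by (simp add: x'_def W_add_simps W_lincomb_right mult.commute)
  finally have "D \<noteq> 0" using ne \<Delta> by simp
  let ?g = "\<lambda>i. if i < r then g i else g'"
  let ?x = "\<lambda>j. if j < r then smul \<bar>D\<bar> (x j) else smul (\<Delta> * sgn D) x'"
  have "g' \<in> KV"
    unfolding g'_def using gK u
    by (intro add_subgroup_diff add_subgroup_smul add_subgroup_lincomb KV_subgroup) auto
  moreover have "D * sgn D = \<bar>D\<bar>" by (simp add: abs_sgn)
  ultimately have "biorthogonal (Suc r) (\<Delta> * \<bar>D\<bar>) ?g ?x"
    unfolding biorthogonal_def using gK W gx' g'x \<Delta> \<open>D \<noteq> 0\<close>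
    by (auto simp: W_add_simps less_Suc_eq D_def[symmetric] mult.commute)
  with max show False by blast
qed

lemma biorthogonal_exists:
  assumes eps: "\<epsilon> = 1"
  obtains r q \<Delta> g y where "biorthogonal r \<Delta> g y"
    "rational_basis HV UNIV {..<r + q} y"
    "\<And>u i. u \<in> KV \<Longrightarrow> r \<le> i \<Longrightarrow> i < r + q \<Longrightarrow> W u (y i) = 0"
    "\<And>u v. u \<in> KV \<Longrightarrow> \<Delta> * W u v = (\<Sum>j<r. W u (y j) * W (g j) v)"
proof -
  obtain k and e :: "nat \<Rightarrow> ivec" where e: "rational_basis HV UNIV {..<k} e"
    using rational_basis_exists[OF HV_subgroup _ add_subgroup_UNIV, of m] LV_bound LV_sub_HV by blast
  define N where "N = {v. \<forall>u\<in>KV. W u v = 0}"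
  have N: "add_subgroup N"
    unfolding add_subgroup_def N_def using W_add_simps(4)[of _ 0 0] by (auto simp: W_add_simps)
  have HN: "HV \<subseteq> N" using W_KV_HV[OF eps] by (auto simp: N_def)
  have indep: "indep_mod N {..<r} x" if bi: "biorthogonal r \<Delta> g x" for r \<Delta> g x
    unfolding indep_mod_def
  proof (intro allI impI ballI)
    fix a i assume a: "lincomb {..<r} a x \<in> N" and i: "i \<in> {..<r}"
    have "(\<Sum>j<r. a j * W (g i) (x j)) = (\<Sum>j<r. if j = i then a i * \<Delta> else 0)"
      using bi i by (intro sum.cong) (auto simp: biorthogonal_def)
    then have "W (g i) (lincomb {..<r} a x) = a i * \<Delta>" using i by (simp add: W_lincomb_right)
    then show "a i = 0" using a bi i by (auto simp: N_def biorthogonal_def)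
  qed
  have bound: "r \<le> k" if bi: "biorthogonal r \<Delta> g x" for r \<Delta> g x
  proof -
    have "indep_mod HV {..<r} x" using indep[OF bi] HN by (auto simp: indep_mod_def)
    moreover have "spans_mod HV UNIV {..<k} e" using e by (simp add: rational_basis_def)
    ultimately show ?thesis
      using indep_mod_card_le[OF HV_subgroup, of UNIV "{..<k}" e "{..<r}" x] by simp
  qed
  define Q where "Q = (\<lambda>r. \<exists>\<Delta> g x. biorthogonal r \<Delta> g x)"
  have "Q 0" unfolding Q_def biorthogonal_def by (intro exI[of _ 1]) auto
  moreover have "\<forall>r. Q r \<longrightarrow> r \<le> k" unfolding Q_def using bound by blast
  ultimately obtain r where r: "Q r" "\<And>r'. Q r' \<Longrightarrow> r' \<le> r"
    using Nat.ex_has_greatest_nat[of Q 0 k] by blast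
  then obtain \<Delta> g x where bi: "biorthogonal r \<Delta> g x" unfolding Q_def by blast
  have max: "\<not> biorthogonal (Suc r) \<Delta>' g' x'" for \<Delta>' g' x'
    using r(2)[of "Suc r"] unfolding Q_def by auto
  note maximal = biorthogonal_maximal[OF bi max]
  have "spans_mod N UNIV {..<r} x"
    unfolding spans_mod_def
  proof
    fix v :: ivec
    have "smul \<Delta> v - lincomb {..<r} (\<lambda>j. W (g j) v) x \<in> N"
      using maximal by (auto simp: N_def W_add_simps W_lincomb_right mult.commute)
    then show "\<exists>N'>0. \<exists>a. smul N' v - lincomb {..<r} a x \<in> N"
      using bi by (auto simp: biorthogonal_def)
  qed
  then have x: "rational_basis N UNIV {..<r} x"
    using indep[OF bi] by (simp add: rational_basis_def)
  obtain q and n :: "nat \<Rightarrow> ivec" where n: "rational_basis HV N {..<q} n"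
    using rational_basis_exists[OF HV_subgroup _ N, of m] LV_bound LV_sub_HV by blast
  let ?y = "\<lambda>i. if i < r then x i else n (i - r)"
  show thesis
  proof (rule that[of r \<Delta> g ?y q])
    show "biorthogonal r \<Delta> g ?y" using bi by (simp add: biorthogonal_def)
    show "rational_basis HV UNIV {..<r + q} ?y"
      by (rule rational_basis_append[OF HV_subgroup N HN subset_UNIV n x])
    show "W u (?y i) = 0" if "u \<in> KV" "r \<le> i" "i < r + q" for u i
    proof -
      have "n (i - r) \<in> N" using n that by (auto simp: rational_basis_def)
      then show ?thesis using that by (simp add: N_def)
    qed
    show "\<Delta> * W u v = (\<Sum>j<r. W u (?y j) * W (g j) v)" if "u \<in> KV" for u v
      using maximal[OF that, of v] by simp
  qed
qed

end

section \<open>The growth of the number of twisted classes\<close>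

lemma sum_PiE_insert:
  assumes "a \<notin> A"
  shows "(\<Sum>b\<in>Pi\<^sub>E (insert a A) B. f b) = (\<Sum>t\<in>B a. \<Sum>b\<in>Pi\<^sub>E A B. f (b(a := t)))"
proof -
  have "(\<Sum>b\<in>Pi\<^sub>E (insert a A) B. f b) = (\<Sum>(t, b)\<in>B a \<times> Pi\<^sub>E A B. f (b(a := t)))"
    unfolding PiE_insert_eq
    by (subst sum.reindex[OF inj_combinator[OF assms]]) (auto intro!: sum.cong)
  then show ?thesis by (simp add: sum.cartesian_product)
qed

lemma sum_PiE_1:
  fixes f :: "int \<Rightarrow> real"
  assumes "k \<ge> 1"
  shows "(\<Sum>b\<in>Pi\<^sub>E {..<k} (\<lambda>_. B). f (b 0)) = real (card B) ^ (k - 1) * (\<Sum>t\<in>B. f t)"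
proof -
  have "{..<k} = insert 0 {1..<k}" using assms by auto
  then show ?thesis by (simp add: sum_PiE_insert card_PiE sum_distrib_left)
qed

lemma sum_PiE_2:
  fixes f :: "int \<Rightarrow> int \<Rightarrow> real"
  assumes "k \<ge> 2"
  shows "(\<Sum>b\<in>Pi\<^sub>E {..<k} (\<lambda>_. B). f (b 0) (b 1)) = real (card B) ^ (k - 2) * (\<Sum>t\<in>B. \<Sum>u\<in>B. f t u)"
proof -
  have "{..<k} = insert 0 (insert 1 {2..<k})" using assms by auto
  then show ?thesis by (simp add: sum_PiE_insert card_PiE sum_distrib_left)
qed

lemma sum_PiE_3:
  fixes f :: "int \<Rightarrow> int \<Rightarrow> int \<Rightarrow> real"
  assumes "k \<ge> 3"
  shows "(\<Sum>b\<in>Pi\<^sub>E {..<k} (\<lambda>_. B). f (b 0) (b 1) (b 2))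
    = real (card B) ^ (k - 3) * (\<Sum>t\<in>B. \<Sum>u\<in>B. \<Sum>v\<in>B. f t u v)"
proof -
  have "{..<k} = insert 0 (insert 1 (insert 2 {3..<k}))" using assms by auto
  then show ?thesis by (simp add: sum_PiE_insert card_PiE sum_distrib_left)
qed

lemma abs_gcd_le: "\<bar>gcd a b\<bar> \<le> \<bar>a\<bar> + \<bar>b :: int\<bar>"
proof (cases "a = 0")
  case False
  then have "gcd a b \<le> \<bar>a\<bar>" by (intro zdvd_imp_le) auto
  then show ?thesis by simp
qed simp

lemma mono_on_power_times:
  assumes "\<And>a b :: nat. 1 \<le> a \<Longrightarrow> a \<le> b \<Longrightarrow> d a \<le> d b" "\<And>a. a \<ge> 1 \<Longrightarrow> d a \<ge> 0"
  shows "mono_on {1..} (\<lambda>n. real n ^ k * d n)"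
  using assms by (intro mono_onI mult_mono power_mono) auto

context heisenberg
begin

lemma periods_sum: "x \<in> carrier G \<Longrightarrow> (\<And>i. i \<in> I \<Longrightarrow> f i \<in> periods x) \<Longrightarrow> (\<Sum>i\<in>I. a i * f i) \<in> periods x"
proof (induction I rule: infinite_finite_induct)
  case (insert i I)
  have "a i * f i - (- 1) * (\<Sum>i\<in>I. a i * f i) \<in> periods x"
    using insert by (intro periods_diff periods_mult) auto
  then show ?case using insert by simp
qed (auto simp: periods_zero)

lemma growth_equivI:
  fixes d :: "nat \<Rightarrow> real"
  assumes mono: "\<And>a b :: nat. 1 \<le> a \<Longrightarrow> a \<le> b \<Longrightarrow> d a \<le> d b" and pos: "\<And>a. a \<ge> 1 \<Longrightarrow> d a \<ge> 0"
    and upper: "\<And>n. n \<ge> M \<Longrightarrow> n \<ge> 1 \<Longrightarrow> real (gr n) \<le> K * (real n ^ k * d n)"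
    and "K \<ge> 0"
    and lower: "\<And>n. n \<ge> N \<Longrightarrow> n \<ge> 1 \<Longrightarrow> real n ^ k * d n \<le> L * real (gr (C * n))"
    and "C \<ge> 1" "L \<ge> 0"
  shows "growth_equiv (\<lambda>n. real (gr n)) (\<lambda>n. real n ^ k * d n)"
  unfolding growth_equiv_def
proof
  show "growth_prec (\<lambda>n. real (gr n)) (\<lambda>n. real n ^ k * d n)"
  proof (rule growth_precI[of _ 1 M _ K])
    show "real (gr n) \<le> K * max 1 (real (1 * n) ^ k * d (1 * n))"
      if "n \<ge> M" "n \<ge> 1" for n
      using upper[OF that] \<open>K \<ge> 0\<close> by (elim order_trans) (auto intro: mult_left_mono)
    show "mono_on {1..} (\<lambda>n. real n ^ k * d n)"
      by (rule mono_on_power_times) (use mono pos in auto)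
  qed simp
  show "growth_prec (\<lambda>n. real n ^ k * d n) (\<lambda>n. real (gr n))"
  proof (rule growth_precI[of _ C N _ L])
    show "real n ^ k * d n \<le> L * max 1 (real (gr (C * n)))"
      if "n \<ge> N" "n \<ge> 1" for n
      using lower[OF that] \<open>L \<ge> 0\<close> by (elim order_trans) (auto intro: mult_left_mono)
  qed (use \<open>C \<ge> 1\<close> in \<open>auto intro!: mono_onI twisted_growth_mono\<close>)
qed

lemma fibre_upper_sum:
  fixes k :: nat
  assumes T: "finite T" and le: "\<And>w. w \<in> T \<Longrightarrow>
    (\<Sum>b\<in>cube k (C * int n). real (U w b)) \<le> M"
    and gr: "gr n \<le> (\<Sum>w\<in>T. \<Sum>b\<in>cube k (C * int n). U w b)"
  shows "real (gr n) \<le> real (card T) * M"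
proof -
  have "real (gr n) \<le> (\<Sum>w\<in>T. \<Sum>b\<in>cube k (C * int n). real (U w b))"
    using gr by (simp flip: of_nat_sum)
  also have "\<dots> \<le> (\<Sum>w\<in>T. M)" by (intro sum_mono le)
  finally show ?thesis by simp
qed

lemma card_box_le: "C \<ge> 1 \<Longrightarrow> n \<ge> 1 \<Longrightarrow> real (card (box (C * int n))) \<le> 3 * of_int C * real n"
proof -
  assume "C \<ge> 1" "n \<ge> 1"
  then have "1 * 1 \<le> C * int n" by (intro mult_mono) auto
  then have "int (card (box (C * int n))) \<le> 3 * C * int n" by simp
  then have "real_of_int (int (card (box (C * int n)))) \<le> real_of_int (3 * C * int n)"
    by (rule of_int_le_iff[THEN iffD2])
  then show ?thesis by (simp only: of_int_of_nat_eq of_int_mult of_int_numeral)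
qed

lemma card_box_ge: "real (card (box (int n))) \<ge> real n"
  by simp

lemma central_range_le:
  assumes "C \<ge> 1" "n \<ge> 1"
  shows "2 * real_of_int (C * int n ^ 2) + 1 \<le> 3 * of_int C * (real n)\<^sup>2"
proof -
  have "1 * 1 \<le> C * int n ^ 2" using assms by (intro mult_mono) auto
  then have "real_of_int 1 \<le> real_of_int (C * int n ^ 2)" by (subst of_int_le_iff) simp
  then show ?thesis by simp
qed

lemma card_box_le_growth:
  fixes f :: "'u \<Rightarrow> int \<Rightarrow> 'a set"
  assumes "(\<Sum>b\<in>B. card (f b ` {0..int n ^ 2})) \<le> N"
  shows "card B \<le> N"
proof -
  have "card B = (\<Sum>b\<in>B. 1)" by simp
  also have "\<dots> \<le> (\<Sum>b\<in>B. card (f b ` {0..int n ^ 2}))"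
  proof (intro sum_mono)
    fix b
    have "card (f b ` {0..int n ^ 2}) > 0" by (subst card_gt_0_iff) auto
    then show "1 \<le> card (f b ` {0..int n ^ 2})" by simp
  qed
  finally show ?thesis using assms by simp
qed

lemma growth_bounded:
  fixes k :: nat
  assumes y: "rational_basis HV UNIV {..<k} y"
    and d: "\<And>v. \<exists>d\<in>periods (P v). d \<noteq> 0 \<and> \<bar>d\<bar> \<le> d0"
  shows "growth_equiv (\<lambda>n. real (gr n)) (\<lambda>n. real n ^ k * 1)"
proof -
  obtain T C where T: "finite T" "C \<ge> 1" and up: "\<And>n. n \<ge> 1 \<Longrightarrow> gr n \<le>
    (\<Sum>w\<in>T. \<Sum>b\<in>cube k (C * int n).
       card (fibre (w + lincomb {..<k} b y) (C * int n ^ 2)))"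
    using twisted_growth_le[OF y] by blast
  obtain c' C' where lo: "c' \<noteq> 0" "C' \<ge> 1" "\<And>n.
    (\<Sum>b\<in>cube k (int n).
       card (cfibre (lincomb {..<k} b y) c' n))
    \<le> gr (C' * n)"
    using twisted_growth_ge[OF y] by blast
  have d0: "d0 \<ge> 0" using d[of 0] by force
  show ?thesis
  proof (rule growth_equivI[where d = "\<lambda>_. 1" and L = 1 and C = C' and N = 1 and M = 1
        and K = "real (card T) * ((3 * of_int C) ^ k * of_int d0)"])
    fix n :: nat assume n: "n \<ge> 1"
    have "real (gr n) \<le> real (card T) * ((3 * of_int C * real n) ^ k * of_int d0)"
    proof (rule fibre_upper_sum[OF T(1) _ up[OF n]])
      fix w assume "w \<in> T"
      have "real (card (fibre v (C * int n ^ 2))) \<le> of_int d0" for v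
      proof -
        obtain e where e: "e \<in> periods (P v)" "e \<noteq> 0" "\<bar>e\<bar> \<le> d0" using d by blast
        have "real (card (fibre v (C * int n ^ 2))) \<le> of_int \<bar>e\<bar>"
          using card_tclass_le[of "P v" e "C * int n ^ 2"] e T(2) by simp
        also have "\<dots> \<le> of_int d0" using e(3) by (subst of_int_le_iff)
        finally show ?thesis by simp
      qed
      then have "(\<Sum>b\<in>cube k (C * int n).
          real (card (fibre (w + lincomb {..<k} b y) (C * int n ^ 2))))
          \<le> (\<Sum>b\<in>cube k (C * int n). real_of_int d0)"
        by (intro sum_mono)
      also have "\<dots> = real (card (box (C * int n))) ^ k * of_int d0"
        by (simp add: card_PiE)
      also have "\<dots> \<le> (3 * of_int C * real n) ^ k * of_int d0"
        using card_box_le[OF T(2) n] d0 by (intro mult_right_mono power_mono) auto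
      finally show "(\<Sum>b\<in>cube k (C * int n).
          real (card (fibre (w + lincomb {..<k} b y) (C * int n ^ 2))))
          \<le> (3 * of_int C * real n) ^ k * of_int d0" by simp
    qed
    then show "real (gr n) \<le> real (card T) * ((3 * of_int C) ^ k * of_int d0) * (real n ^ k * 1)"
      by (simp add: power_mult_distrib algebra_simps)
    have "real n ^ k \<le> real (card (cube k (int n)))"
      using card_box_ge[of n] by (simp add: card_PiE power_mono)
    also have "\<dots> \<le> real (gr (C' * n))"
      using card_box_le_growth[OF lo(3)] by simp
    finally show "real n ^ k * 1 \<le> 1 * real (gr (C' * n))" by simp
  qed (use T(2) d0 lo(2) in auto)
qed

lemma growth_compatible:
  assumes eps: "\<epsilon> = 1" and bi: "biorthogonal r \<Delta> g y"
    and y: "rational_basis HV UNIV {..<r + q} y"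
    and y0: "\<And>u i. u \<in> KV \<Longrightarrow> r \<le> i \<Longrightarrow> i < r + q \<Longrightarrow> W u (y i) = 0"
    and form: "\<And>u v. u \<in> KV \<Longrightarrow> \<Delta> * W u v = (\<Sum>j<r. W u (y j) * W (g j) v)"
    and comp: "\<And>u. u \<in> KV \<Longrightarrow> \<Delta> * \<tau>V u = (\<Sum>j<r. W u (y j) * \<tau>V (g j))"
  shows "\<exists>d \<in> {\<lambda>n. real n ^ 2, \<lambda>n. real n, \<lambda>n. ln (real n), \<lambda>n. 1 :: real}.
    growth_equiv (\<lambda>n. real (gr n)) (\<lambda>n. real n ^ (r + q) * d n)"
proof -
  have \<Delta>: "\<Delta> > 0" and gK: "\<And>j. j < r \<Longrightarrow> g j \<in> KV"
    and Wg: "\<And>i j. i < r \<Longrightarrow> j < r \<Longrightarrow> W (g i) (y j) = (if i = j then \<Delta> else 0)"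
    using bi by (auto simp: biorthogonal_def)
  define k where "k = r + q"
  note y = y[folded k_def]
  define p where "p = (\<lambda>j v. \<tau>V (g j) + W (g j) v)"
  have p_period: "p j v \<in> periods (P v)" if "j < r" for j v
    using gK[OF that] by (auto simp: periods_P_iff[OF eps] p_def)
  have p_lin: "p j (w + lincomb {..<k} b y) = p j w + \<Delta> * b j" if j: "j < r" for j w b
  proof -
    have "(\<Sum>i<k. b i * W (g j) (y i)) = (\<Sum>i<k. if i = j then \<Delta> * b j else 0)"
    proof (intro sum.cong refl)
      fix i assume "i \<in> {..<k}"
      then show "b i * W (g j) (y i) = (if i = j then \<Delta> * b j else 0)"
        using Wg[OF j, of i] y0[OF gK[OF j], of i] j by (cases "i < r") (auto simp: k_def)
    qed
    also have "\<dots> = \<Delta> * b j" using j by (simp add: k_def)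
    finally show ?thesis by (simp add: p_def W_add_right W_lincomb_right)
  qed
  have dvd_period: "d dvd \<Delta> * z" if z: "z \<in> periods (P v)" and d: "\<And>j. j < r \<Longrightarrow> d dvd p j v" for d z v
  proof -
    obtain u where u: "u \<in> KV" "z = \<tau>V u + W u v" using z by (auto simp: periods_P_iff[OF eps])
    have "\<Delta> * z = (\<Sum>j<r. W u (y j) * p j v)"
      unfolding u(2) distrib_left form[OF u(1)] comp[OF u(1)] p_def by (simp add: sum.distrib)
    then show ?thesis using d by (auto intro!: dvd_sum)
  qed
  obtain T C where T: "finite T" and C: "C \<ge> 1" and up: "\<And>n. n \<ge> 1 \<Longrightarrow> gr n \<le>
    (\<Sum>w\<in>T. \<Sum>b\<in>cube k (C * int n).
       card (fibre (w + lincomb {..<k} b y) (C * int n ^ 2)))"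
    using twisted_growth_le[OF y] by blast
  obtain c' C' where c': "c' \<noteq> 0" and C': "C' \<ge> 1" and lo: "\<And>n.
    (\<Sum>b\<in>cube k (int n).
       card (cfibre (lincomb {..<k} b y) c' n))
    \<le> gr (C' * n)"
    using twisted_growth_ge[OF y] by blast
  have "finite ({..<r} \<times> insert 0 T)" using T by simp
  then obtain A where A: "A \<ge> 0"
    and A': "\<And>q. q \<in> {..<r} \<times> insert 0 T \<Longrightarrow> \<bar>p (fst q) (snd q)\<bar> \<le> A"
    using finite_int_bound[of "{..<r} \<times> insert 0 T" "\<lambda>q. \<bar>p (fst q) (snd q)\<bar>"] by blast
  have Ap: "\<bar>p j w\<bar> \<le> A" if "j < r" "w \<in> insert 0 T" for j w
    using A'[of "(j, w)"] that by simp
  let ?B = "\<lambda>n. cube k (C * int n)"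
  let ?Z = "\<lambda>n. 2 * real_of_int (C * int n ^ 2) + 1"
  let ?c = "3 * real_of_int C"
  have upper: "real (gr n) \<le> real (card T) * M"
    if n: "n \<ge> 1" and D: "\<And>v. D v \<in> periods (P v)"
      and M: "\<And>w. w \<in> T \<Longrightarrow> (\<Sum>b\<in>?B n. replace_zero (?Z n) (D (w + lincomb {..<k} b y))) \<le> M" for n D M
  proof (rule fibre_upper_sum[OF T _ up[OF n]])
    fix w assume w: "w \<in> T"
    have "real (card (fibre v (C * int n ^ 2))) \<le> replace_zero (?Z n) (D v)" for v
      unfolding replace_zero_def by (rule card_tclass_le) (use D C in auto)
    then have "(\<Sum>b\<in>?B n. real (card (fibre (w + lincomb {..<k} b y) (C * int n ^ 2))))
        \<le> (\<Sum>b\<in>?B n. replace_zero (?Z n) (D (w + lincomb {..<k} b y)))"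
      by (intro sum_mono)
    with M[OF w] show "(\<Sum>b\<in>?B n. real (card (fibre (w + lincomb {..<k} b y) (C * int n ^ 2)))) \<le> M"
      by linarith
  qed
  define E where "E = nat (A + \<Delta> * C)"
  have "1 * 1 \<le> \<Delta> * C" using \<Delta> C by (intro mult_mono) auto
  then have E: "E \<ge> 1" "int E = A + \<Delta> * C" using A by (auto simp: E_def)
  have E_bound: "\<bar>p j w\<bar> + \<bar>\<Delta>\<bar> * (C * int n) \<le> int (E * n)" if "j < r" "w \<in> insert 0 T" "n \<ge> 1" for j w n
  proof -
    have "A * 1 \<le> A * int n" using A that(3) by (intro mult_left_mono) auto
    then have "\<bar>p j w\<bar> \<le> A * int n" using Ap[OF that(1,2)] by linarith
    moreover have "int (E * n) = A * int n + \<Delta> * (C * int n)" by (simp add: E(2) distrib_right)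
    ultimately show ?thesis using \<Delta> by simp
  qed
  have EN: "E * n \<ge> 1" if "n \<ge> 1" for n using E(1) that by simp
  define F where "F = 2 * (A + \<Delta>) + \<bar>\<Delta> * c'\<bar> + 1"
  have F: "F \<ge> 1" "\<bar>\<Delta> * c'\<bar> \<le> F" using A \<Delta> by (auto simp: F_def)
  have p_le: "\<bar>p j 0 + \<Delta> * b j\<bar> \<le> (A + \<Delta>) * int n ^ 2"
    if "j < r" "\<bar>b j\<bar> \<le> int n" "n \<ge> 1" for j b n
  proof -
    have "1 * int n \<le> int n * int n" using that(3) by (intro mult_right_mono) auto
    then have n2: "int n \<le> int n ^ 2" by (simp add: power2_eq_square)
    then have n2': "1 \<le> int n ^ 2" using that(3) by linarith
    have "\<bar>\<Delta> * b j\<bar> \<le> \<Delta> * int n ^ 2"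
      unfolding abs_mult using \<Delta> order_trans[OF that(2) n2] by (intro mult_mono) auto
    moreover have "\<bar>p j 0\<bar> \<le> A * int n ^ 2"
      using Ap[of j 0] that(1) mult_left_mono[OF n2' A] by simp
    ultimately show ?thesis by (simp add: distrib_right)
  qed
  have lower: "(\<Sum>b\<in>cube k (int n). replace_zero ((real n)\<^sup>2) (D b))
      \<le> of_int F * real (gr (C' * n))"
    if D: "\<And>b j. j < r \<Longrightarrow> D b dvd p j (lincomb {..<k} b y)"
      and D2: "\<And>b. b \<in> cube k (int n) \<Longrightarrow> \<bar>D b\<bar> \<le> F * int n ^ 2" for n D
  proof -
    have "(\<Sum>b\<in>cube k (int n). replace_zero ((real n)\<^sup>2) (D b) / of_int F)
      \<le> (\<Sum>b\<in>cube k (int n).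
       real (card (cfibre (lincomb {..<k} b y) c' n)))"
    proof (intro sum_mono)
      fix b assume b: "b \<in> cube k (int n)"
      have "(if D b = 0 then of_int (int n ^ 2) else of_int \<bar>D b\<bar>) / real_of_int F
         \<le> real (card (cfibre (lincomb {..<k} b y) c' n))"
      proof (rule card_tclass_ge[of _ _ \<Delta>])
        show "D b dvd \<Delta> * z" if "z \<in> periods (P (lincomb {..<k} b y))" for z
          using that D by (rule dvd_period)
        show "\<bar>D b\<bar> \<le> F * int n ^ 2" by (rule D2[OF b])
      qed (use \<Delta> c' F in auto)
      moreover have "replace_zero ((real n)\<^sup>2) (D b) = (if D b = 0 then of_int (int n ^ 2) else of_int \<bar>D b\<bar>)"
        by (simp add: replace_zero_def)
      ultimately show "replace_zero ((real n)\<^sup>2) (D b) / of_int F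
         \<le> real (card (cfibre (lincomb {..<k} b y) c' n))"
        by (simp only:)
    qed
    also have "\<dots> \<le> real (gr (C' * n))"
      using lo[of n] by (simp flip: of_nat_sum)
    finally show ?thesis
      using F(1) by (simp add: sum_divide_distrib[symmetric] divide_le_eq mult.commute)
  qed
  have box: "\<bar>b j\<bar> \<le> int n" if "b \<in> cube k (int n)" "j < r" for b j n
    using PiE_mem[OF that(1), of j] that(2) by (auto simp: k_def)
  have p0: "p j (lincomb {..<k} b y) = p j 0 + \<Delta> * b j" if "j < r" for j b
    using p_lin[OF that, of 0 b] by simp
  have card_le: "real (card (box (C * int n))) ^ e \<le> ?c ^ e * real n ^ e" if "n \<ge> 1" for n e
    unfolding power_mult_distrib[symmetric] using card_box_le[OF C that] by (intro power_mono) auto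
  have Zle: "?Z n \<le> ?c * (real n)\<^sup>2" if "n \<ge> 1" for n by (rule central_range_le[OF C that])
  have Z0: "?Z n \<ge> 0" for n using C by simp
  have \<Delta>nat: "\<Delta> = int (nat \<Delta>)" "nat \<Delta> \<ge> 1" using \<Delta> by auto
  consider "r = 0" | "r = 1" | "r = 2" | "r \<ge> 3" by linarith
  then have "\<exists>d \<in> {\<lambda>n. real n ^ 2, \<lambda>n. real n, \<lambda>n. ln (real n), \<lambda>n. 1 :: real}.
    growth_equiv (\<lambda>n. real (gr n)) (\<lambda>n. real n ^ k * d n)"
  proof cases
    case 1
    have "growth_equiv (\<lambda>n. real (gr n)) (\<lambda>n. real n ^ k * real n ^ 2)"
    proof (rule growth_equivI[where M = 1 and N = 1 and C = C' and L = "of_int F"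
          and K = "real (card T) * (?c ^ k * ?c)"])
      fix n :: nat assume n: "n \<ge> 1"
      have "real (gr n) \<le> real (card T) * (?c ^ k * real n ^ k * (?c * (real n)\<^sup>2))"
      proof (rule upper[OF n, of "\<lambda>_. 0"])
        have "(\<Sum>b\<in>?B n. replace_zero (?Z n) 0) = real (card (box (C * int n))) ^ k * ?Z n"
          by (simp add: card_PiE replace_zero_def)
        also have "\<dots> \<le> ?c ^ k * real n ^ k * (?c * (real n)\<^sup>2)"
          using C by (intro mult_mono card_le n Zle Z0) auto
        finally show "(\<Sum>b\<in>?B n. replace_zero (?Z n) 0) \<le> ?c ^ k * real n ^ k * (?c * (real n)\<^sup>2)"
          by simp
      qed (simp add: periods_zero)
      then show "real (gr n)
          \<le> real (card T) * (?c ^ k * ?c) * (real n ^ k * real n ^ 2)"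
        by (simp add: algebra_simps)
      have "real n ^ k * real n ^ 2 \<le> real (card (box (int n))) ^ k * real n ^ 2"
        using card_box_ge by (intro mult_right_mono power_mono) auto
      also have "\<dots> = (\<Sum>b\<in>cube k (int n). replace_zero ((real n)\<^sup>2) 0)"
        by (simp add: card_PiE replace_zero_def)
      also have "\<dots> \<le> of_int F * real (gr (C' * n))"
        by (rule lower) (use 1 F in auto)
      finally show "real n ^ k * real n ^ 2 \<le> of_int F * real (gr (C' * n))" by simp
    qed (use C F C' in \<open>auto intro: power_mono\<close>)
    then show ?thesis by (intro bexI[of _ "\<lambda>n. real n ^ 2"]) auto
  next
    case 2
    then obtain k' where k': "k = Suc k'" by (auto simp: k_def)
    have "growth_equiv (\<lambda>n. real (gr n)) (\<lambda>n. real n ^ k * real n)"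
    proof (rule growth_equivI[where M = 1 and N = 1 and C = C' and L = "of_int F"
          and K = "real (card T) * (?c ^ k' * (?c + 3 * (real E)\<^sup>2))"])
      fix n :: nat assume n: "n \<ge> 1"
      have "real (gr n) \<le> real (card T) *
          (?c ^ k' * real n ^ k' * (?c * (real n)\<^sup>2 + 3 * (real (E * n))\<^sup>2))"
      proof (rule upper[OF n, of "p 0"])
        fix w assume w: "w \<in> T"
        have "(\<Sum>b\<in>?B n. replace_zero (?Z n) (p 0 (w + lincomb {..<k} b y)))
            = (\<Sum>b\<in>?B n. replace_zero (?Z n) (p 0 w + \<Delta> * b 0))"
          using p_lin[of 0 w] 2 by simp
        also have "\<dots> = real (card (box (C * int n))) ^ k' *
            (\<Sum>t\<in>box (C * int n). replace_zero (?Z n) (p 0 w + \<Delta> * t))"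
          using sum_PiE_1[of k "\<lambda>t. replace_zero (?Z n) (p 0 w + \<Delta> * t)" "box (C * int n)"]
          by (simp add: k')
        also have "\<dots> \<le> ?c ^ k' * real n ^ k' * (?Z n + 3 * (real (E * n))\<^sup>2)"
          using C \<Delta> w 2
          by (intro mult_mono card_le n sum_abs_le Z0 E_bound EN sum_nonneg replace_zero_nonneg) auto
        also have "\<dots> \<le> ?c ^ k' * real n ^ k' * (?c * (real n)\<^sup>2 + 3 * (real (E * n))\<^sup>2)"
          using C by (intro mult_left_mono add_right_mono Zle n) auto
        finally show "(\<Sum>b\<in>?B n. replace_zero (?Z n) (p 0 (w + lincomb {..<k} b y)))
          \<le> ?c ^ k' * real n ^ k' * (?c * (real n)\<^sup>2 + 3 * (real (E * n))\<^sup>2)" by simp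
      qed (use p_period 2 in simp)
      then show "real (gr n) \<le> real (card T) * (?c ^ k' *
          (?c + 3 * (real E)\<^sup>2)) * (real n ^ k * real n)"
        by (simp add: k' algebra_simps power2_eq_square)
      have "real n ^ k * real n = real n ^ k' * (real n)\<^sup>2" by (simp add: k' power2_eq_square)
      also have "\<dots> \<le> real (card (box (int n))) ^ k' *
          (\<Sum>t\<in>box (int n). replace_zero ((real n)\<^sup>2) (p 0 0 + \<Delta> * t))"
        using card_box_ge sum_abs_ge[of "nat \<Delta>" n "p 0 0"] \<Delta>nat
        by (intro mult_mono power_mono) auto
      also have "\<dots> = (\<Sum>b\<in>cube k (int n). replace_zero ((real n)\<^sup>2) (p 0 0 + \<Delta> * b 0))"
        using sum_PiE_1[of k "\<lambda>t. replace_zero ((real n)\<^sup>2) (p 0 0 + \<Delta> * t)" "box (int n)"] by (simp add: k')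
      also have "\<dots> \<le> of_int F * real (gr (C' * n))"
      proof (rule lower)
        show "p 0 0 + \<Delta> * b 0 dvd p j (lincomb {..<k} b y)" if "j < r" for b j
          using that 2 p0[of 0 b] by simp
        show "\<bar>p 0 0 + \<Delta> * b 0\<bar> \<le> F * int n ^ 2" if b: "b \<in> cube k (int n)" for b
        proof -
          have "(A + \<Delta>) * int n ^ 2 \<le> F * int n ^ 2" using A \<Delta> by (intro mult_right_mono) (auto simp: F_def)
          moreover have "\<bar>p 0 0 + \<Delta> * b 0\<bar> \<le> (A + \<Delta>) * int n ^ 2"
            by (rule p_le) (use box[OF b, of 0] 2 n in auto)
          ultimately show ?thesis by linarith
        qed
      qed
      finally show "real n ^ k * real n \<le> of_int F * real (gr (C' * n))" by simp
    qed (use C F C' in auto)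
    then show ?thesis by (intro bexI[of _ "\<lambda>n. real n"]) auto
  next
    case 3
    then obtain k' where k': "k = Suc (Suc k')" by (auto simp: k_def numeral_2_eq_2)
    have r: "0 < r" "1 < r" using 3 by auto
    define D where "D = (\<lambda>v. gcd (p 0 v) (p 1 v))"
    have "growth_equiv (\<lambda>n. real (gr n)) (\<lambda>n. real n ^ k * ln (real n))"
    proof (rule growth_equivI[where M = 3 and N = "(nat \<Delta>)\<^sup>2" and C = C' and L = "of_int F * (32 * real (nat \<Delta>))"
          and K = "real (card T) * (?c ^ k' * (?c + 9 * (real E)\<^sup>2 * (2 + ln (real E))))"])
      fix n :: nat assume n3: "n \<ge> 3" and n: "n \<ge> 1"
      have "exp 1 \<le> real n" using exp_le n3 by simp
      then have ln: "1 \<le> ln (real n)" using n by (simp add: ln_ge_iff)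
      have lnE: "ln (real E) \<ge> 0" using E by simp
      have "real (gr n) \<le> real (card T) *
          (?c ^ k' * real n ^ k' * ((?c + 9 * (real E)\<^sup>2 * (2 + ln (real E))) * ((real n)\<^sup>2 * ln (real n))))"
      proof (rule upper[OF n, of D])
        show "D v \<in> periods (P v)" for v
          unfolding D_def using r by (intro periods_gcd p_period) auto
        fix w assume w: "w \<in> T"
        have "(\<Sum>b\<in>?B n. replace_zero (?Z n) (D (w + lincomb {..<k} b y)))
            = (\<Sum>b\<in>?B n. replace_zero (?Z n) (gcd (p 0 w + \<Delta> * b 0) (p 1 w + \<Delta> * b 1)))"
          unfolding D_def p_lin[OF r(1)] p_lin[OF r(2)] ..
        also have "\<dots> = real (card (box (C * int n))) ^ k' *
            (\<Sum>t\<in>box (C * int n). \<Sum>u\<in>box (C * int n).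
               replace_zero (?Z n) (gcd (p 0 w + \<Delta> * t) (p 1 w + \<Delta> * u)))"
          using sum_PiE_2[of k "\<lambda>t u. replace_zero (?Z n) (gcd (p 0 w + \<Delta> * t) (p 1 w + \<Delta> * u))" "box (C * int n)"]
          by (simp add: k')
        also have "\<dots> \<le> ?c ^ k' * real n ^ k' * (?Z n + 9 * (real (E * n))\<^sup>2 * (1 + ln (real (E * n))))"
          using C \<Delta> w r
          by (intro mult_mono card_le n sum_replace_gcd2_le Z0 E_bound EN sum_nonneg replace_zero_nonneg) auto
        also have "\<dots> \<le> ?c ^ k' * real n ^ k' *
            ((?c + 9 * (real E)\<^sup>2 * (2 + ln (real E))) * ((real n)\<^sup>2 * ln (real n)))"
        proof (intro mult_left_mono)
          have "?Z n \<le> ?c * (real n)\<^sup>2 * 1" using Zle[OF n] by simp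
          also have "\<dots> \<le> ?c * (real n)\<^sup>2 * ln (real n)"
            using C ln by (intro mult_left_mono) auto
          finally have 1: "?Z n \<le> ?c * (real n)\<^sup>2 * ln (real n)" by simp
          have "1 + ln (real (E * n)) = 1 + ln (real E) * 1 + ln (real n)"
            using E(1) n by (simp add: ln_mult)
          also have "\<dots> \<le> ln (real n) + ln (real E) * ln (real n) + ln (real n)"
            using ln lnE by (intro add_mono mult_left_mono) auto
          finally have "1 + ln (real (E * n)) \<le> (2 + ln (real E)) * ln (real n)" by (simp add: algebra_simps)
          then have "9 * (real (E * n))\<^sup>2 * (1 + ln (real (E * n))) \<le> 9 * (real (E * n))\<^sup>2 * ((2 + ln (real E)) * ln (real n))"
            by (intro mult_left_mono) auto
          with 1 show "?Z n + 9 * (real (E * n))\<^sup>2 * (1 + ln (real (E * n)))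
              \<le> (?c + 9 * (real E)\<^sup>2 * (2 + ln (real E))) * ((real n)\<^sup>2 * ln (real n))"
            by (simp add: power_mult_distrib algebra_simps)
        qed (use C in auto)
        finally show "(\<Sum>b\<in>?B n. replace_zero (?Z n) (D (w + lincomb {..<k} b y)))
          \<le> ?c ^ k' * real n ^ k' *
            ((?c + 9 * (real E)\<^sup>2 * (2 + ln (real E))) * ((real n)\<^sup>2 * ln (real n)))" by simp
      qed
      then show "real (gr n) \<le> real (card T) * (?c ^ k' *
          (?c + 9 * (real E)\<^sup>2 * (2 + ln (real E)))) * (real n ^ k * ln (real n))"
        by (simp add: k' power2_eq_square mult_ac)
    next
      fix n :: nat assume n\<Delta>: "n \<ge> (nat \<Delta>)\<^sup>2" and n: "n \<ge> 1"
      let ?s = "\<Sum>t\<in>box (int n). \<Sum>u\<in>box (int n).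
            replace_zero ((real n)\<^sup>2) (gcd (p 0 0 + \<Delta> * t) (p 1 0 + \<Delta> * u))"
      have "(real n)\<^sup>2 * ln (real n) \<le> 32 * real (nat \<Delta>) * ?s"
        using sum_gcd2_ge[OF \<Delta>nat(2) n\<Delta>, of "p 0 0" "p 1 0"] \<Delta>
        by (simp add: divide_le_eq mult.commute)
      moreover have "real n ^ k * ln (real n) = real n ^ k' * ((real n)\<^sup>2 * ln (real n))"
        by (simp add: k' power2_eq_square)
      ultimately have "real n ^ k * ln (real n) \<le> real n ^ k' * (32 * real (nat \<Delta>) * ?s)"
        by (metis mult_left_mono of_nat_0_le_iff zero_le_power)
      also have "\<dots> \<le> real (card (box (int n))) ^ k' * (32 * real (nat \<Delta>) * ?s)"
        using card_box_ge by (intro mult_right_mono power_mono) (auto intro!: mult_nonneg_nonneg sum_nonneg replace_zero_nonneg)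
      also have "\<dots> = 32 * real (nat \<Delta>) * (real (card (box (int n))) ^ k' * ?s)" by simp
      also have "real (card (box (int n))) ^ k' * ?s = (\<Sum>b\<in>cube k (int n).
          replace_zero ((real n)\<^sup>2) (gcd (p 0 0 + \<Delta> * b 0) (p 1 0 + \<Delta> * b 1)))"
        using sum_PiE_2[of k "\<lambda>t u. replace_zero ((real n)\<^sup>2) (gcd (p 0 0 + \<Delta> * t) (p 1 0 + \<Delta> * u))" "box (int n)"]
        by (simp add: k')
      also have "32 * real (nat \<Delta>) * \<dots> \<le> 32 * real (nat \<Delta>) * (of_int F * real (gr (C' * n)))"
      proof (intro mult_left_mono lower)
        show "gcd (p 0 0 + \<Delta> * b 0) (p 1 0 + \<Delta> * b 1) dvd p j (lincomb {..<k} b y)" if "j < r" for b j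
        proof -
          have "j = 0 \<or> j = 1" using that 3 by auto
          then show ?thesis using p0[OF r(1), of b] p0[OF r(2), of b] by auto
        qed
        show "\<bar>gcd (p 0 0 + \<Delta> * b 0) (p 1 0 + \<Delta> * b 1)\<bar> \<le> F * int n ^ 2"
          if b: "b \<in> cube k (int n)" for b
        proof -
          have "\<bar>p 0 0 + \<Delta> * b 0\<bar> + \<bar>p 1 0 + \<Delta> * b 1\<bar> \<le> 2 * (A + \<Delta>) * int n ^ 2"
            using p_le[of 0 b n, OF r(1) box[OF b r(1)] n] p_le[of 1 b n, OF r(2) box[OF b r(2)] n] by linarith
          also have "\<dots> \<le> F * int n ^ 2" by (intro mult_right_mono) (auto simp: F_def)
          finally have "\<bar>p 0 0 + \<Delta> * b 0\<bar> + \<bar>p 1 0 + \<Delta> * b 1\<bar> \<le> F * int n ^ 2" by simp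
          then show ?thesis using abs_gcd_le[of "p 0 0 + \<Delta> * b 0" "p 1 0 + \<Delta> * b 1"] by linarith
        qed
      qed auto
      finally show "real n ^ k * ln (real n) \<le> of_int F * (32 * real (nat \<Delta>)) * real (gr (C' * n))"
        by (simp add: mult_ac)
    qed (use C F C' E in auto)
    then show ?thesis by (intro bexI[of _ "\<lambda>n. ln (real n)"]) auto
  next
    case 4
    define k' where "k' = k - 3"
    have k': "k = k' + 3" using 4 by (simp add: k'_def k_def)
    have r: "0 < r" "1 < r" "2 < r" using 4 by auto
    define D where "D = (\<lambda>v. gcd (p 0 v) (gcd (p 1 v) (p 2 v)))"
    have "growth_equiv (\<lambda>n. real (gr n)) (\<lambda>n. real n ^ k * 1)"
    proof (rule growth_equivI[where d = "\<lambda>_. 1" and M = 1 and N = 1 and C = C' and L = 1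
          and K = "real (card T) * (?c ^ k' * (?c + 54 * real E ^ 3))"])
      fix n :: nat assume n: "n \<ge> 1"
      have "real (gr n) \<le> real (card T) *
          (?c ^ k' * real n ^ k' * ((?c + 54 * real E ^ 3) * real n ^ 3))"
      proof (rule upper[OF n, of D])
        show "D v \<in> periods (P v)" for v
          unfolding D_def using r by (intro periods_gcd p_period) auto
        fix w assume w: "w \<in> T"
        have "(\<Sum>b\<in>?B n. replace_zero (?Z n) (D (w + lincomb {..<k} b y)))
            = (\<Sum>b\<in>?B n. replace_zero (?Z n) (gcd (p 0 w + \<Delta> * b 0) (gcd (p 1 w + \<Delta> * b 1) (p 2 w + \<Delta> * b 2))))"
          unfolding D_def p_lin[OF r(1)] p_lin[OF r(2)] p_lin[OF r(3)] ..
        also have "\<dots> = real (card (box (C * int n))) ^ k' *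
            (\<Sum>t\<in>box (C * int n). \<Sum>u\<in>box (C * int n). \<Sum>v\<in>box (C * int n).
               replace_zero (?Z n) (gcd (p 0 w + \<Delta> * t) (gcd (p 1 w + \<Delta> * u) (p 2 w + \<Delta> * v))))"
          using sum_PiE_3[of k "\<lambda>t u v. replace_zero (?Z n) (gcd (p 0 w + \<Delta> * t) (gcd (p 1 w + \<Delta> * u) (p 2 w + \<Delta> * v)))" "box (C * int n)"]
          by (simp add: k')
        also have "\<dots> \<le> ?c ^ k' * real n ^ k' * (?Z n + 54 * real (E * n) ^ 3)"
          using C \<Delta> w r
          by (intro mult_mono card_le n sum_replace_gcd3_le Z0 E_bound EN sum_nonneg replace_zero_nonneg) auto
        also have "\<dots> \<le> ?c ^ k' * real n ^ k' * ((?c + 54 * real E ^ 3) * real n ^ 3)"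
        proof (intro mult_left_mono)
          have "(real n)\<^sup>2 * 1 \<le> (real n)\<^sup>2 * real n" using n by (intro mult_left_mono) auto
          then have "(real n)\<^sup>2 \<le> real n ^ 3" by (simp add: power2_eq_square power3_eq_cube)
          then have "?c * (real n)\<^sup>2 \<le> ?c * real n ^ 3"
            using C by (intro mult_left_mono) auto
          then show "?Z n + 54 * real (E * n) ^ 3 \<le> (?c + 54 * real E ^ 3) * real n ^ 3"
            using Zle[OF n] by (simp add: power_mult_distrib algebra_simps)
        qed (use C in auto)
        finally show "(\<Sum>b\<in>?B n. replace_zero (?Z n) (D (w + lincomb {..<k} b y)))
          \<le> ?c ^ k' * real n ^ k' * ((?c + 54 * real E ^ 3) * real n ^ 3)" by simp
      qed
      then show "real (gr n) \<le> real (card T) * (?c ^ k' *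
          (?c + 54 * real E ^ 3)) * (real n ^ k * 1)"
        by (simp add: k' power_add mult_ac)
      have "real n ^ k \<le> real (card (cube k (int n)))"
        using card_box_ge[of n] by (simp add: card_PiE power_mono)
      also have "\<dots> \<le> real (gr (C' * n))"
        using card_box_le_growth[OF lo] by simp
      finally show "real n ^ k * 1 \<le> 1 * real (gr (C' * n))" by simp
    qed (use C C' in auto)
    then show ?thesis by (intro bexI[of _ "\<lambda>n. 1"]) auto
  qed
  then show ?thesis by (simp add: k_def)
qed

lemma twisted_growth_equiv:
  obtains k and y :: "nat \<Rightarrow> ivec" and d where "rational_basis HV UNIV {..<k} y"
    "d \<in> {\<lambda>n. real n ^ 2, \<lambda>n. real n, \<lambda>n. ln (real n), \<lambda>n. 1 :: real}"
    "growth_equiv (\<lambda>n. real (gr n)) (\<lambda>n. real n ^ k * d n)"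
proof -
  obtain k and e :: "nat \<Rightarrow> ivec" where e: "rational_basis HV UNIV {..<k} e"
    using rational_basis_exists[OF HV_subgroup _ add_subgroup_UNIV, of m] LV_bound LV_sub_HV by blast
  show thesis
  proof (cases "\<epsilon> = 1")
    case False
    then have "\<exists>d\<in>periods (P v). d \<noteq> 0 \<and> \<bar>d\<bar> \<le> 2" for v
      using eps_cases two_in_periods[of "P v"] by (intro bexI[of _ 2]) auto
    from that[OF e _ growth_bounded[OF e this]] show thesis by simp
  next
    case eps: True
    show thesis
    proof (rule biorthogonal_exists[OF eps])
      fix r q \<Delta> g and y :: "nat \<Rightarrow> ivec"
      assume bi: "biorthogonal r \<Delta> g y" and y: "rational_basis HV UNIV {..<r + q} y"
        and y0: "\<And>u i. u \<in> KV \<Longrightarrow> r \<le> i \<Longrightarrow> i < r + q \<Longrightarrow> W u (y i) = 0"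
        and form: "\<And>u v. u \<in> KV \<Longrightarrow> \<Delta> * W u v = (\<Sum>j<r. W u (y j) * W (g j) v)"
      show thesis
      proof (cases "\<forall>u\<in>KV. \<Delta> * \<tau>V u = (\<Sum>j<r. W u (y j) * \<tau>V (g j))")
        case True
        have "\<exists>d \<in> {\<lambda>n. real n ^ 2, \<lambda>n. real n, \<lambda>n. ln (real n), \<lambda>n. 1 :: real}.
            growth_equiv (\<lambda>n. real (gr n)) (\<lambda>n. real n ^ (r + q) * d n)"
        proof (rule growth_compatible[OF eps bi y])
          show "W u (y i) = 0" if "u \<in> KV" "r \<le> i" "i < r + q" for u i by (rule y0[OF that])
          show "\<Delta> * W u v = (\<Sum>j<r. W u (y j) * W (g j) v)" if "u \<in> KV" for u v by (rule form[OF that])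
          show "\<Delta> * \<tau>V u = (\<Sum>j<r. W u (y j) * \<tau>V (g j))" if "u \<in> KV" for u using True that by blast
        qed
        then obtain d where "d \<in> {\<lambda>n. real n ^ 2, \<lambda>n. real n, \<lambda>n. ln (real n), \<lambda>n. 1 :: real}"
          "growth_equiv (\<lambda>n. real (gr n)) (\<lambda>n. real n ^ (r + q) * d n)" ..
        then show thesis by (rule that[OF y])
      next
        case False
        then obtain u where u: "u \<in> KV" "\<Delta> * \<tau>V u \<noteq> (\<Sum>j<r. W u (y j) * \<tau>V (g j))" by blast
        define d where "d = \<Delta> * \<tau>V u - (\<Sum>j<r. W u (y j) * \<tau>V (g j))"
        have "d \<in> periods (P v)" for v
        proof -
          have "\<Delta> * (\<tau>V u + W u v) - (\<Sum>j<r. W u (y j) * (\<tau>V (g j) + W (g j) v)) \<in> periods (P v)"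
            using u(1) bi by (intro periods_diff periods_mult periods_sum)
              (auto simp: periods_P_iff[OF eps] biorthogonal_def)
          moreover have "\<Delta> * (\<tau>V u + W u v) - (\<Sum>j<r. W u (y j) * (\<tau>V (g j) + W (g j) v)) = d"
            unfolding d_def distrib_left form[OF u(1)] by (simp add: sum.distrib)
          ultimately show ?thesis by simp
        qed
        then have "\<exists>e\<in>periods (P v). e \<noteq> 0 \<and> \<bar>e\<bar> \<le> \<bar>d\<bar>" for v
          using u(2) by (intro bexI[of _ d]) (auto simp: d_def)
        from that[OF y _ growth_bounded[OF y this]] show thesis by simp
      qed
    qed
  qed
qed

end

lemma (in group) int_pow_inj_of_infinite_range:
  assumes c: "c \<in> carrier G" and inf: "infinite (range (\<lambda>z::int. c [^] z))"
    and eq: "c [^] (y::int) = c [^] (z::int)"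
  shows "y = z"
proof (rule ccontr)
  assume "y \<noteq> z"
  define d where "d = \<bar>y - z\<bar>"
  have d: "d > 0" using \<open>y \<noteq> z\<close> by (simp add: d_def)
  have "c [^] (y - z) = \<one>" "c [^] (z - y) = \<one>"
    using c eq int_pow_diff[of c y z] int_pow_diff[of c z y] by simp_all
  then have one: "c [^] d = \<one>" by (simp add: d_def abs_if)
  have "c [^] n \<in> (\<lambda>i::int. c [^] i) ` {0..<d}" for n :: int
  proof -
    have "c [^] n = c [^] (d * (n div d)) \<otimes> c [^] (n mod d)"
      by (subst int_pow_mult[OF c, symmetric]) simp
    also have "c [^] (d * (n div d)) = (c [^] d) [^] (n div d)"
      using c by (simp add: int_pow_pow)
    also have "(c [^] d) [^] (n div d) \<otimes> c [^] (n mod d) = c [^] (n mod d)"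
      using c by (simp add: one)
    finally show ?thesis using d by auto
  qed
  then have "range (\<lambda>z::int. c [^] z) \<subseteq> (\<lambda>i::int. c [^] i) ` {0..<d}" by blast
  with inf show False using finite_subset by blast
qed

lemma generalised_Heisenberg_group_imp_heisenberg:
  fixes G :: "('a, 'b) monoid_scheme" (structure)
  assumes "generalised_Heisenberg_group G" "finite_generating_set G S" "\<psi> \<in> iso G G"
  obtains c m s where "heisenberg G c \<psi> S m s"
proof -
  interpret group G using assms(1) by (simp add: generalised_Heisenberg_group_def)
  let ?D = "derived G (carrier G)"
  have D: "?D \<subseteq> center G" "cyclic_group (G\<lparr>carrier := ?D\<rparr>)" "infinite ?D"
    using assms(1) by (auto simp: generalised_Heisenberg_group_def)
  have sub: "subgroup ?D G" by (rule derived_is_subgroup) simp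
  obtain c where c: "c \<in> ?D" and "?D = range (\<lambda>n::int. c [^]\<^bsub>G\<lparr>carrier := ?D\<rparr>\<^esub> n)"
    using D(2) group.cyclic_group[OF subgroup_imp_group[OF sub]] by auto
  then have range: "?D = range (\<lambda>n::int. c [^] n)"
    using int_pow_consistent[OF sub c] by simp
  have cc: "c \<in> carrier G" using c sub subgroup.subset by blast
  have S: "finite S" "S \<subseteq> carrier G" "generate G S = carrier G"
    using assms(2) by (auto simp: finite_generating_set_def)
  obtain s where "bij_betw s {0..<card S} S" using ex_bij_betw_nat_finite[OF S(1)] by blast
  then have s: "s ` {..<card S} = S" by (simp add: bij_betw_def atLeast0LessThan)
  have "heisenberg G c \<psi> S (card S) s"
  proof
    show "y = z" if "c [^] y = c [^] z" for y z :: int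
      using int_pow_inj_of_infinite_range[OF cc _ that] D(3) range by simp
    show "c \<otimes> g = g \<otimes> c" if "g \<in> carrier G" for g
      using c D(1) that by (auto simp: center_def)
  qed (use cc range assms(3) S s in auto)
  then show thesis by (rule that)
qed

theorem theoremA:
  fixes G :: "('a, 'b) monoid_scheme" and S :: "'a set" and \<psi> :: "'a \<Rightarrow> 'a"
  assumes "generalised_Heisenberg_group G"
    and "finite_generating_set G S"
    and "\<psi> \<in> iso G G"
  shows "\<exists>d \<in> {\<lambda>n. real n ^ 2, \<lambda>n. real n, \<lambda>n. ln (real n), \<lambda>n. 1 :: real}.
           growth_equiv
             (\<lambda>n. real (twisted_growth G S \<psi> n))
             (\<lambda>n. real n powi
                    (int (torsion_free_rank (abelianization G))
                     - int (endo_rank (abelianization G)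
                              (id_minus (abelianization G) (induced_ab \<psi>))))
                  * d n)"
proof -
  obtain c m s where "heisenberg G c \<psi> S m s"
    using generalised_Heisenberg_group_imp_heisenberg[OF assms] by blast
  then interpret heisenberg G c \<psi> S m s .
  obtain k y d where y: "rational_basis HV UNIV {..<k} y"
    and d: "d \<in> {\<lambda>n. real n ^ 2, \<lambda>n. real n, \<lambda>n. ln (real n), \<lambda>n. 1 :: real}"
      "growth_equiv (\<lambda>n. real (twisted_growth G S \<psi> n)) (\<lambda>n. real n ^ k * d n)"
    by (rule twisted_growth_equiv)
  show ?thesis
    using d(2) by (intro bexI[OF _ d(1)]) (simp add: rank_diff[OF y] power_int_of_nat)
qed

end
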